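(* Let $\bullet\in\{*,\mathrm{sh}\}$. For every nonnegative integer $n$, the following identity holds in $\mathcal{Z}[[t]]/t^2$ (with the convention $\zeta(1)=0$): \[ \zeta_{\mathcal{S}_2}^{\bullet}(\{1,3\}^n) =\frac{2(-4)^n}{(4n+2)!}\pi^{4n}+\Biggl(\sum_{n_0,n_1\ge0,\; n_0+n_1=n}\frac{(-4)^{n_0+1}\bigl(2-(-4)^{-n_1}\bigr)}{(4n_0+2)!}\pi^{4n_0}\zeta(4n_1+1)-(-1)^n\sum_{n_0,n_1\ge0,\; n_0+n_1=2n,\; n_0,n_1\ \mathrm{odd}}\frac{2^{n_0-n_1+2}}{(2n_0+2)!}\pi^{2n_0}\zeta(2n_1+1)\Biggr)t . \]
   Context: An index is a finite (possibly empty) sequence of positive integers; it is admissible if it is empty or its last component is greater than $1$. $\{a,b\}^n$ denotes the $n$-fold repetition of $a,b$ (e.g. $\{a,b\}^2=(a,b,a,b)$). For an admissible index, $\zeta(k_1,\dots,k_r)=\sum_{1\le n_1<\dots<n_r}\frac{1}{n_1^{k_1}\cdots n_r^{k_r}}$, with $\zeta(\emptyset)=1$. $\mathcal{Z}\subset\mathbb{R}$ is the $\mathbb{Q}$-span of all these values (a $\mathbb{Q}$-algebra). Harmonic regularization $\zeta^*$: on the $\mathbb{Q}$-vector space $\mathcal{I}$ freely generated by all indices, define the bilinear product $*$ by $\boldsymbol{k}*\emptyset=\emptyset*\boldsymbol{k}=\boldsymbol{k}$ and $(\boldsymbol{k},k)*(\boldsymbol{l},l)=(\boldsymbol{k}*(\boldsymbol{l},l),k)+(\boldsymbol{k}*\boldsymbol{l},k+l)+((\boldsymbol{k},k)*\boldsymbol{l},l)$.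 Then $\zeta^*:\mathcal{I}\to\mathbb{R}$ is the unique $\mathbb{Q}$-linear map that is multiplicative for $*$, equals $\zeta$ on admissible indices, and satisfies $\zeta^*(1)=0$. Shuffle regularization $\zeta^{\mathrm{sh}}$: identify the index $(k_1,\dots,k_r)$ with the word $yx^{k_1-1}\cdots yx^{k_r-1}$ in $\mathbb{Q}+y\mathbb{Q}\langle x,y\rangle$, equipped with the shuffle product. Then $\zeta^{\mathrm{sh}}$ is the unique $\mathbb{Q}$-linear map that is multiplicative for the shuffle product, equals $\zeta$ on admissible indices, and satisfies $\zeta^{\mathrm{sh}}(1)=0$. Both maps take values in $\mathcal{Z}$. For $\bullet\in\{*,\mathrm{sh}\}$, an index $(k_1,\dots,k_r)$ and $m\ge0$ put \[\zeta_m^{\bullet}(k_1,\dots,k_r)=\sum_{l_1,\dots,l_r\ge0,\; l_1+\dots+l_r=m}\zeta^{\bullet}(k_1+l_1,\dots,k_r+l_r)\prod_{i=1}^r\binom{k_i+l_i-1}{l_i}\] (so $\zeta_0^\bullet(\emptyset)=1$ and $\zeta_m^\bullet(\emptyset)=0$ for $m\ge1$), and \[\zeta_{\widehat{\mathcal{S}}}^{\bullet}(k_1,\dots,k_r)=\sum_{i=0}^r(-1)^{k_{i+1}+\dots+k_r}\zeta^{\bullet}(k_1,\dots,k_i)\sum_{m\ge0}\zeta_m^{\bullet}(k_r,\dots,k_{i+1})t^m\in\mathcal{Z}[[t]].\] For $m\ge1$, $\zeta_{\mathcal{S}_m}^{\bullet}(\boldsymbol{k})$ is the image of $\zeta_{\widehat{\mathcal{S}}}^{\bullet}(\boldsymbol{k})$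 in $\mathcal{Z}[[t]]/t^m$. On the right-hand side of the claim, $\zeta(k)$ for $k\ge2$ is the Riemann zeta value, and $\zeta(1)$ is interpreted as $0$. *)

theory Defs
  imports
    "HOL-Analysis.Analysis"
    "HOL-Library.Poly_Mapping"
    "HOL-Computational_Algebra.Formal_Power_Series"
    "HOL-Algebra.QuotRing"
begin

definition is_index :: "nat list \<Rightarrow> bool" where
  "is_index k \<longleftrightarrow> (\<forall>a\<in>set k. 1 \<le> a)"

definition admissible :: "nat list \<Rightarrow> bool" where
  "admissible k \<longleftrightarrow> is_index k \<and> (k = [] \<or> 1 < last k)"

text \<open>Meaningful for admissible \<open>k\<close> only (the family is then summable).\<close>

definition mzv :: "nat list \<Rightarrow> real" where
  "mzv k = (\<Sum>\<^sub>\<infinity>n\<in>{n. length n = length k \<and> sorted_wrt (<) n \<and> (\<forall>a\<in>set n. 1 \<le> a)}.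
              1 / (\<Prod>i<length k. real (n ! i) ^ (k ! i)))"

definition rat_mult_real :: "rat \<Rightarrow> real \<Rightarrow> real" where
  "rat_mult_real c x = of_rat c * x"

definition mzv_space :: "real set" where
  "mzv_space = module.span rat_mult_real (mzv ` {k. admissible k})"

text \<open>The rational vector space freely generated by the type \<^typ>\<open>'a\<close> is
  \<^typ>\<open>'a \<Rightarrow>\<^sub>0 rat\<close>; the space freely generated by a set \<open>B\<close> is its
  subspace of elements supported in \<open>B\<close>.\<close>

definition basis :: "'a \<Rightarrow> ('a \<Rightarrow>\<^sub>0 rat)" where
  "basis a = Poly_Mapping.single a 1"

definition qscale :: "rat \<Rightarrow> ('a \<Rightarrow>\<^sub>0 rat) \<Rightarrow> ('a \<Rightarrow>\<^sub>0 rat)" where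
  "qscale c f = Poly_Mapping.map ((*) c) f"

definition free_on :: "'a set \<Rightarrow> ('a \<Rightarrow>\<^sub>0 rat) set" where
  "free_on B = {f. Poly_Mapping.keys f \<subseteq> B}"

definition lin_ext :: "('a \<Rightarrow> ('b \<Rightarrow>\<^sub>0 rat)) \<Rightarrow> ('a \<Rightarrow>\<^sub>0 rat) \<Rightarrow> ('b \<Rightarrow>\<^sub>0 rat)" where
  "lin_ext g f = (\<Sum>a\<in>Poly_Mapping.keys f. qscale (Poly_Mapping.lookup f a) (g a))"

definition bilin_ext ::
  "('a \<Rightarrow> 'a \<Rightarrow> ('a \<Rightarrow>\<^sub>0 rat)) \<Rightarrow> ('a \<Rightarrow>\<^sub>0 rat) \<Rightarrow> ('a \<Rightarrow>\<^sub>0 rat) \<Rightarrow> ('a \<Rightarrow>\<^sub>0 rat)" where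
  "bilin_ext p f g = lin_ext (\<lambda>a. lin_ext (p a) g) f"

function harmonic_prod :: "nat list \<Rightarrow> nat list \<Rightarrow> (nat list \<Rightarrow>\<^sub>0 rat)" where
  "harmonic_prod k l =
     (if k = [] then basis l
      else if l = [] then basis k
      else lin_ext (\<lambda>w. basis (w @ [last k])) (harmonic_prod (butlast k) l)
         + lin_ext (\<lambda>w. basis (w @ [last k + last l])) (harmonic_prod (butlast k) (butlast l))
         + lin_ext (\<lambda>w. basis (w @ [last l])) (harmonic_prod k (butlast l)))"
  by auto
termination
  by (relation "Wellfounded.measure (\<lambda>(k, l). length k + length l)")
    (auto simp: add_less_le_mono)

declare harmonic_prod.simps [simp del]

datatype letter = X | Y

fun shuffle_prod :: "letter list \<Rightarrow> letter list \<Rightarrow> (letter list \<Rightarrow>\<^sub>0 rat)" where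
  "shuffle_prod [] v = basis v"
| "shuffle_prod u [] = basis u"
| "shuffle_prod (a # u) (b # v) =
     lin_ext (\<lambda>w. basis (a # w)) (shuffle_prod u (b # v))
   + lin_ext (\<lambda>w. basis (b # w)) (shuffle_prod (a # u) v)"

text \<open>The word \<open>y x\<^bsup>k\<^sub>1-1\<^esup> \<dots> y x\<^bsup>k\<^sub>r-1\<^esup>\<close>.\<close>

definition word :: "nat list \<Rightarrow> letter list" where
  "word k = concat (map (\<lambda>a. Y # replicate (a - 1) X) k)"

text \<open>\<open>Z\<close> is a rational-linear map on the space freely generated by \<open>B\<close>, where an index \<open>k\<close> is
  represented by the basis element \<open>enc k\<close> and \<open>p\<close> is the product of basis elements. So that
  such a \<open>Z\<close> is unique as a HOL function, it is extended by zero to basis elements outside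
  \<open>B\<close>.\<close>

definition is_regularization ::
  "'a set \<Rightarrow> (nat list \<Rightarrow> 'a) \<Rightarrow> ('a \<Rightarrow> 'a \<Rightarrow> ('a \<Rightarrow>\<^sub>0 rat)) \<Rightarrow> (('a \<Rightarrow>\<^sub>0 rat) \<Rightarrow> real) \<Rightarrow> bool"
where
  "is_regularization B enc p Z \<longleftrightarrow>
     Vector_Spaces.linear qscale rat_mult_real Z \<and>
     (\<forall>b. b \<notin> B \<longrightarrow> Z (basis b) = 0) \<and>
     (\<forall>f\<in>free_on B. \<forall>g\<in>free_on B. Z (bilin_ext p f g) = Z f * Z g) \<and>
     (\<forall>k. admissible k \<longrightarrow> Z (basis (enc k)) = mzv k) \<and>
     Z (basis (enc [1])) = 0"

definition zeta_harmonic_map :: "(nat list \<Rightarrow>\<^sub>0 rat) \<Rightarrow> real" where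
  "zeta_harmonic_map = (THE Z. is_regularization {k. is_index k} (\<lambda>k. k) harmonic_prod Z)"

text \<open>The words that are empty or start with \<open>y\<close> span
  \<open>\<rat> + y\<rat>\<langle>x,y\<rangle>\<close>.\<close>

definition zeta_shuffle_map :: "(letter list \<Rightarrow>\<^sub>0 rat) \<Rightarrow> real" where
  "zeta_shuffle_map = (THE Z. is_regularization {w. w = [] \<or> hd w = Y} word shuffle_prod Z)"

datatype reg = Harmonic | Shuffle

fun zeta_reg :: "reg \<Rightarrow> nat list \<Rightarrow> real" where
  "zeta_reg Harmonic k = zeta_harmonic_map (basis k)"
| "zeta_reg Shuffle k = zeta_shuffle_map (basis (word k))"

definition mzv_fps_ring :: "real fps ring" where
  "mzv_fps_ring = \<lparr>carrier = {f. \<forall>j. fps_nth f j \<in> mzv_space},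
                   mult = (*), one = 1, zero = 0, add = (+)\<rparr>"

definition t_ideal :: "nat \<Rightarrow> real fps set" where
  "t_ideal m = cgenideal mzv_fps_ring (fps_X ^ m)"

definition mzv_trunc_ring :: "nat \<Rightarrow> real fps set ring" where
  "mzv_trunc_ring m = FactRing mzv_fps_ring (t_ideal m)"

definition trunc_class :: "nat \<Rightarrow> real fps \<Rightarrow> real fps set" where
  "trunc_class m f = a_r_coset mzv_fps_ring (t_ideal m) f"

definition zeta_shifted :: "reg \<Rightarrow> nat \<Rightarrow> nat list \<Rightarrow> real" where
  "zeta_shifted b m k =
     (\<Sum>l\<in>{l. length l = length k \<and> sum_list l = m}.
        zeta_reg b (map2 (+) k l) *
        (\<Prod>i<length k. real ((k ! i + l ! i - 1) choose (l ! i))))"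

definition zeta_S_hat :: "reg \<Rightarrow> nat list \<Rightarrow> real fps" where
  "zeta_S_hat b k =
     (\<Sum>i\<le>length k.
        fps_const ((- 1) ^ sum_list (drop i k) * zeta_reg b (take i k)) *
        Abs_fps (\<lambda>m. zeta_shifted b m (rev (drop i k))))"

definition zeta_S :: "reg \<Rightarrow> nat \<Rightarrow> nat list \<Rightarrow> real fps set" where
  "zeta_S b m k = trunc_class m (zeta_S_hat b k)"

text \<open>Riemann zeta values at positive integers, with the convention \<open>\<zeta>(1) = 0\<close>.\<close>

definition zeta_val :: "nat \<Rightarrow> real" where
  "zeta_val k = (if k = 1 then 0 else suminf (\<lambda>n. 1 / real (Suc n) ^ k))"

end

theory Submission
  imports Defs "HOL-Real_Asymp.Real_Asymp"
begin

text \<open>Both regularizations extend to maps on words: \<open>\<zeta>\<^sup>s\<^sup>h\<close> to the character \<open>\<chi>\<close> of the shuffle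
  algebra on all words in \<open>x, y\<close> that vanishes on both letters, and the two agree on every index without
  adjacent ones. Let \<open>G(w) = \<Sum> \<chi>(u) \<chi>(S v)\<close>, summed over the factorizations \<open>w = u y v\<close> with \<open>S\<close> the
  antipode. For the word \<open>w\<close> of an index without adjacent ones, the coefficients of \<open>1\<close> and \<open>t\<close> of its
  symmetric multiple zeta value are \<open>G(w y)\<close> and \<open>G(w y x)\<close>, and \<open>G\<close> vanishes on proper shuffles.

  An alternating sum of shuffles of powers of \<open>yx\<close> collapses to \<open>(-4)\<^sup>n\<close> times the single word
  \<open>y(yxxy)\<^sup>n\<close>. Hence the two coefficients at \<open>{1,3}\<^sup>n\<close> become bilinear in \<open>\<zeta>({2}\<^sup>m)\<close>, and in \<open>\<zeta>({2}\<^sup>m)\<close> and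
  \<open>\<zeta>({2}\<^sup>a, 3, {2}\<^sup>b)\<close>. Both are integrals of polynomials over a quarter period, the second one against
  \<open>tan\<close>; the Fourier series of \<open>tan\<close> then gives Zagier's formula for \<open>\<zeta>({2}\<^sup>a, 3, {2}\<^sup>b)\<close>, and summing it
  with binomial identities gives the claim.\<close>

section \<open>Characters of the shuffle algebra\<close>

text \<open>Prefixes and reversed suffixes of {1,3} repeated may end in 1, so regularized values
  cannot be avoided. The way out is that no two ones are adjacent: every index that occurs, even
  after one entry is raised, has at most one trailing 1, and the single character \<chi> serves both
  regularizations. For the series \<Phi> with coefficients \<chi>, the function G gives the
  coefficients of \<Phi> y \<Phi>^-1. The antipode reverses a suffix and supplies the sign of the
  definition; the extra final y makes the reversed suffix an index word again. The x in G(w y x)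
  arises because \<chi>(x) = 0 turns a sum over raised entries into one value with x in front. The
  factor -4 is -2 times 2, one factor for each parity of the number of blocks yx, while the
  competing branches cancel. \<open>sh f u v\<close> is the value of the functional f on the shuffle
  of u and v. Shuffling functionals instead of formal sums lets one recursion serve numbers,
  polynomials and power series.\<close>

fun sh :: "('a list \<Rightarrow> 'r::comm_ring_1) \<Rightarrow> 'a list \<Rightarrow> 'a list \<Rightarrow> 'r" where
  "sh f [] v = f v"
| "sh f (a # u) [] = f (a # u)"
| "sh f (a # u) (b # v) = sh (\<lambda>w. f (a # w)) u (b # v) + sh (\<lambda>w. f (b # w)) (a # u) v"

lemma sh_Nil2 [simp]: "sh f u [] = f u"
  by (cases u) auto

lemma sh_add: "sh (\<lambda>w. f w + g w) u v = sh f u v + sh g u v"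
proof (induction f u v arbitrary: g rule: sh.induct)
  case (3 f a u b v)
  from "3.IH"(1)[of "\<lambda>w. g (a # w)"] "3.IH"(2)[of "\<lambda>w. g (b # w)"] show ?case
    by (simp only: sh.simps ac_simps)
qed auto

lemma sh_scale: "sh (\<lambda>w. c * f w) u v = c * sh f u v"
  by (induction f u v rule: sh.induct) (auto simp: algebra_simps)

lemma sh_diff: "sh (\<lambda>w. f w - g w) u v = sh f u v - sh g u v"
  using sh_add[of f "\<lambda>w. - 1 * g w" u v] sh_scale[of "- 1" g u v] by simp

lemma sh_commute: "sh f u v = sh f v u"
proof (induction f u v rule: sh.induct)
  case (3 f a u b v)
  then show ?case by (simp add: add.commute)
qed auto

text \<open>A shuffle only involves words of length \<open>length u + length v\<close>. This lets
  length-dependent signs, and identities valid for nonempty words, be used under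
  \<open>sh\<close>.\<close>

lemma sh_length_cong:
  assumes "\<And>w. length w = length u + length v \<Longrightarrow> f w = g w"
  shows "sh f u v = sh g u v"
  using assms
proof (induction f u v arbitrary: g rule: sh.induct)
  case (3 f a u b v)
  have "sh (\<lambda>w. f (a # w)) u (b # v) = sh (\<lambda>w. g (a # w)) u (b # v)"
    by (rule "3.IH"(1)) (auto intro!: "3.prems")
  moreover have "sh (\<lambda>w. f (b # w)) (a # u) v = sh (\<lambda>w. g (b # w)) (a # u) v"
    by (rule "3.IH"(2)) (auto intro!: "3.prems")
  ultimately show ?case by simp
qed auto

text \<open>The shuffle is symmetric under reversal, while \<open>sh\<close> reads words from the
  left. The computations with the antipode and with \<open>altsum\<close> read them from the
  right.\<close>

lemma sh_snoc:
  "sh f (u @ [a]) (v @ [b]) = sh (\<lambda>w. f (w @ [a])) u (v @ [b]) + sh (\<lambda>w. f (w @ [b])) (u @ [a]) v"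
proof (induction f u v rule: sh.induct)
  case (1 f v)
  then show ?case
  proof (induction v arbitrary: f)
    case (Cons c v)
    from Cons[of "\<lambda>w. f (c # w)"] show ?case by simp
  qed simp
next
  case (2 f c u)
  then show ?case
  proof (induction u arbitrary: f c)
    case Nil
    then show ?case by simp
  next
    case (Cons d u)
    from Cons[of "\<lambda>w. f (c # w)" d] show ?case by simp
  qed
next
  case (3 f c u d v)
  then show ?case by (simp add: add_ac)
qed

lemma sh_rev: "sh (\<lambda>w. f (rev w)) u v = sh f (rev u) (rev v)"
proof (induction "\<lambda>w. f (rev w)" u v arbitrary: f rule: sh.induct)
  case (3 a u b v)
  have "sh (\<lambda>w. f (rev (a # w))) u (b # v) = sh (\<lambda>w. f (w @ [a])) (rev u) (rev (b # v))"
    using "3.hyps"(1)[of "\<lambda>w. f (w @ [a])"] by simp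
  moreover have "sh (\<lambda>w. f (rev (b # w))) (a # u) v = sh (\<lambda>w. f (w @ [b])) (rev (a # u)) (rev v)"
    using "3.hyps"(2)[of "\<lambda>w. f (w @ [b])"] by simp
  ultimately show ?case by (simp add: sh_snoc)
qed auto

text \<open>The product of noncommutative generating series, read off on coefficients; dual to
  deconcatenation.\<close>

definition conv :: "('a list \<Rightarrow> 'r::comm_ring_1) \<Rightarrow> ('a list \<Rightarrow> 'r) \<Rightarrow> 'a list \<Rightarrow> 'r" where
  "conv \<alpha> \<beta> w = (\<Sum>i\<le>length w. \<alpha> (take i w) * \<beta> (drop i w))"

lemma conv_Nil [simp]: "conv \<alpha> \<beta> [] = \<alpha> [] * \<beta> []"
  by (simp add: conv_def)

lemma conv_Cons: "conv \<alpha> \<beta> (a # w) = \<alpha> [] * \<beta> (a # w) + conv (\<lambda>x. \<alpha> (a # x)) \<beta> w"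
  by (simp add: conv_def sum.atMost_Suc_shift del: sum.atMost_Suc)

text \<open>Deconcatenation is a homomorphism for the shuffle product: a word shuffled from u and v
  is cut by cutting u and v and shuffling prefixes and suffixes separately.\<close>

lemma sh_conv:
  "sh (conv \<alpha> \<beta>) u v =
     (\<Sum>i\<le>length u. \<Sum>j\<le>length v. sh \<alpha> (take i u) (take j v) * sh \<beta> (drop i u) (drop j v))"
proof (induction u arbitrary: v \<alpha>)
  case Nil
  then show ?case by (simp add: conv_def)
next
  case outer: (Cons a u)
  show ?case
  proof (induction v arbitrary: \<alpha>)
    case Nil
    then show ?case by (simp add: conv_def)
  next
    case (Cons b v)
    let ?\<alpha>a = "\<lambda>x. \<alpha> (a # x)" and ?\<alpha>b = "\<lambda>x. \<alpha> (b # x)"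
    let ?T = "\<lambda>\<alpha> u v i j. sh \<alpha> (take i u) (take j v) * sh \<beta> (drop i u) (drop j v)"
    have A: "sh (\<lambda>w. conv \<alpha> \<beta> (a # w)) u (b # v) =
        \<alpha> [] * sh (\<lambda>w. \<beta> (a # w)) u (b # v) + (\<Sum>i\<le>length u. \<Sum>j\<le>length (b # v). ?T ?\<alpha>a u (b # v) i j)"
      by (simp only: conv_Cons sh_add sh_scale outer.IH)
    have B: "sh (\<lambda>w. conv \<alpha> \<beta> (b # w)) (a # u) v =
        \<alpha> [] * sh (\<lambda>w. \<beta> (b # w)) (a # u) v + (\<Sum>i\<le>length (a # u). \<Sum>j\<le>length v. ?T ?\<alpha>b (a # u) v i j)"
      by (simp only: conv_Cons sh_add sh_scale Cons.IH)
    show ?case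
      by (simp add: A B sum.atMost_Suc_shift sum.distrib algebra_simps del: sum.atMost_Suc)
  qed
qed

text \<open>\<phi> composed with the antipode of the shuffle Hopf algebra; for a character this is
  the inverse under \<open>conv\<close>.\<close>

definition antip :: "('a list \<Rightarrow> 'r::comm_ring_1) \<Rightarrow> 'a list \<Rightarrow> 'r" where
  "antip \<phi> v = (- 1) ^ length v * \<phi> (rev v)"

definition is_char :: "('a list \<Rightarrow> 'r::comm_ring_1) \<Rightarrow> bool" where
  "is_char \<phi> \<longleftrightarrow> \<phi> [] = 1 \<and> (\<forall>u v. sh \<phi> u v = \<phi> u * \<phi> v)"

lemma is_char_antip:
  assumes "is_char \<phi>"
  shows "is_char (antip \<phi>)"
proof -
  have "sh (antip \<phi>) u v = antip \<phi> u * antip \<phi> v" for u v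
  proof -
    have "sh (antip \<phi>) u v = sh (\<lambda>w. (- 1) ^ (length u + length v) * \<phi> (rev w)) u v"
      by (rule sh_length_cong) (simp add: antip_def)
    also have "\<dots> = (- 1) ^ (length u + length v) * (\<phi> (rev u) * \<phi> (rev v))"
      using assms by (simp add: sh_scale sh_rev is_char_def)
    finally show ?thesis by (simp add: antip_def power_add mult_ac)
  qed
  with assms show ?thesis by (simp add: is_char_def antip_def)
qed

text \<open>Multiplicativity makes each summand a signed shuffle of a prefix with a reversed suffix.
  Sorted by last letters, the letter at position i comes last in two neighbouring summands, once
  from the suffix and once from the prefix, with opposite signs.\<close>

lemma conv_antip:
  assumes "is_char \<phi>" "w \<noteq> []"
  shows "conv \<phi> (antip \<phi>) w = 0"
proof -
  define n where "n = length w"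
  have n: "n > 0" using assms by (simp add: n_def)
  define t where "t i = sh (\<lambda>x. \<phi> (x @ [w ! i])) (take i w) (rev (drop (Suc i) w))" for i
  define g where "g i = (if i = 0 then 0 else t (i - 1)) + (if i < n then t i else 0)" for i
  have *: "\<phi> (take i w) * \<phi> (rev (drop i w)) = g i" if "i \<le> n" for i
  proof -
    have "\<phi> (take i w) * \<phi> (rev (drop i w)) = sh \<phi> (take i w) (rev (drop i w))"
      using assms(1) by (simp add: is_char_def)
    also have "\<dots> = g i"
    proof (cases "i = 0")
      case True
      have "rev w = rev (drop (Suc 0) w) @ [w ! 0]" using n unfolding n_def by (cases w) auto
      then show ?thesis using True n by (simp add: g_def t_def)
    next
      case False
      then obtain k where k: "i = Suc k" by (cases i) auto
      have 1: "take i w = take k w @ [w ! k]"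
        using that k unfolding n_def by (simp add: take_Suc_conv_app_nth)
      show ?thesis
      proof (cases "i < n")
        case True
        have 2: "rev (drop i w) = rev (drop (Suc i) w) @ [w ! i]"
          using True by (metis Cons_nth_drop_Suc n_def rev.simps(2))
        have "sh \<phi> (take i w) (rev (drop i w)) =
           sh (\<lambda>x. \<phi> (x @ [w ! k])) (take k w) (rev (drop i w)) +
           sh (\<lambda>x. \<phi> (x @ [w ! i])) (take i w) (rev (drop (Suc i) w))"
          unfolding 1 2 by (rule sh_snoc)
        then show ?thesis using k True by (simp add: g_def t_def)
      next
        case False
        with that have "i = n" by simp
        with k 1 show ?thesis by (simp add: g_def t_def n_def)
      qed
    qed
    finally show ?thesis .
  qed
  have tele: "(\<Sum>i\<le>m. (- 1) ^ (n - i) * g i) = (- 1) ^ (n - m) * (if m < n then t m else 0)" if "m \<le> n" for m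
    using that
  proof (induction m)
    case (Suc m)
    have "n - m = Suc (n - Suc m)" using Suc by simp
    then show ?case using Suc by (simp add: g_def algebra_simps)
  qed (use n in \<open>simp add: g_def\<close>)
  have "conv \<phi> (antip \<phi>) w = (\<Sum>i\<le>n. (- 1) ^ (n - i) * g i)"
    unfolding conv_def antip_def n_def[symmetric]
    by (rule sum.cong) (auto simp: *[symmetric] n_def algebra_simps)
  also have "\<dots> = 0" using tele[of n] by simp
  finally show ?thesis .
qed

text \<open>For a character \<open>\<phi>\<close> of a group-like series this is the coefficient function of
  \<open>\<phi> a \<phi>\<^sup>-\<^sup>1\<close>, a Lie series.\<close>

definition lie_of :: "'a \<Rightarrow> ('a list \<Rightarrow> 'r::comm_ring_1) \<Rightarrow> 'a list \<Rightarrow> 'r" where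
  "lie_of a \<phi> w = conv \<phi> (\<lambda>v. if v \<noteq> [] \<and> hd v = a then antip \<phi> (tl v) else 0) w"

text \<open>The first letter a of a shuffled word stems from u or from v, so \<open>\<eta>\<close>
  is a derivation over the character \<open>antip \<phi>\<close>. After convolution each of the two
  terms contains \<open>conv \<phi> (antip \<phi>)\<close> at a nonempty word, which is 0.\<close>

lemma lie_of_sh:
  assumes "is_char \<phi>" "u \<noteq> []" "v \<noteq> []"
  shows "sh (lie_of a \<phi>) u v = 0"
proof -
  define \<eta> where "\<eta> v = (if v \<noteq> [] \<and> hd v = a then antip \<phi> (tl v) else 0)" for v
  have S: "is_char (antip \<phi>)" using assms by (simp add: is_char_antip)
  have \<eta>: "sh \<eta> u v = \<eta> u * antip \<phi> v + antip \<phi> u * \<eta> v" for u v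
  proof (cases u)
    case Nil
    then show ?thesis using S by (simp add: \<eta>_def is_char_def)
  next
    case u: (Cons c u')
    show ?thesis
    proof (cases v)
      case Nil
      then show ?thesis using S by (simp add: \<eta>_def is_char_def)
    next
      case v: (Cons d v')
      have z: "sh (\<lambda>w. 0::'b) p q = 0" for p q :: "'a list"
        using sh_scale[of 0 "\<lambda>_. 0"] by simp
      have "sh (\<lambda>w. \<eta> (c # w)) u' v = \<eta> u * antip \<phi> v"
        using S by (cases "c = a") (auto simp: \<eta>_def u z is_char_def)
      moreover have "sh (\<lambda>w. \<eta> (d # w)) u v' = antip \<phi> u * \<eta> v"
        using S by (cases "d = a") (auto simp: \<eta>_def v z is_char_def)
      ultimately show ?thesis by (simp add: u v)
    qed
  qed
  have "lie_of a \<phi> = conv \<phi> \<eta>" unfolding lie_of_def \<eta>_def by (intro ext) simp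
  then have "sh (lie_of a \<phi>) u v =
     (\<Sum>i\<le>length u. \<Sum>j\<le>length v. (\<phi> (take i u) * \<phi> (take j v)) *
        (\<eta> (drop i u) * antip \<phi> (drop j v) + antip \<phi> (drop i u) * \<eta> (drop j v)))"
    using assms(1) by (simp add: sh_conv \<eta> is_char_def)
  also have "\<dots> = conv \<phi> \<eta> u * conv \<phi> (antip \<phi>) v + conv \<phi> (antip \<phi>) u * conv \<phi> \<eta> v"
    unfolding conv_def sum_product sum.distrib[symmetric]
    by (intro sum.cong refl) (simp add: algebra_simps)
  also have "\<dots> = 0" using assms by (simp add: conv_antip)
  finally show ?thesis .
qed

text \<open>Vanishing of \<open>G\<close> on the shuffle of \<open>u @ [a]\<close> with
  \<open>v @ [b]\<close> trades the final letter a for b at the cost of a sign. Iteration carries v,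
  reversed, to the right of a.\<close>

lemma sh_append_letter:
  assumes "\<And>u v. u \<noteq> [] \<Longrightarrow> v \<noteq> [] \<Longrightarrow> sh G u v = 0"
  shows "sh (\<lambda>w. G (w @ [a])) u v = (- 1) ^ length v * G (u @ [a] @ rev v)"
proof (induction v arbitrary: u a rule: rev_induct)
  case (snoc b v)
  have "0 = sh G (u @ [a]) (v @ [b])" using assms by simp
  also have "\<dots> = sh (\<lambda>w. G (w @ [a])) u (v @ [b]) + sh (\<lambda>w. G (w @ [b])) (u @ [a]) v"
    by (rule sh_snoc)
  finally show ?case using snoc[of b "u @ [a]"] by (simp add: eq_neg_iff_add_eq_0)
qed simp

section \<open>Alternating sums of shuffles\<close>

text \<open>(yx)^n is the word of the index with n twos; \<open>zag n\<close> is the same word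
  reversed.\<close>

definition zig :: "nat \<Rightarrow> letter list" where
  "zig n = concat (replicate n [Y, X])"

definition zag :: "nat \<Rightarrow> letter list" where
  "zag n = concat (replicate n [X, Y])"

lemma zig_0 [simp]: "zig 0 = []" and zig_Suc: "zig (Suc n) = Y # X # zig n"
  by (simp_all add: zig_def)

lemma zag_0 [simp]: "zag 0 = []" and zag_Suc: "zag (Suc n) = X # Y # zag n"
  by (simp_all add: zag_def)

lemma zig_Suc2: "zig (Suc n) = zig n @ [Y, X]"
  by (induction n) (simp_all add: zig_Suc)

lemma zag_snoc: "zag n @ [X] = X # zig n"
  by (induction n) (simp_all add: zig_Suc zag_Suc)

lemma rev_zig: "rev (zig n) = zag n"
  by (induction n) (simp_all add: zig_Suc2 zag_Suc)

lemma rev_zag: "rev (zag n) = zig n"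
  by (metis rev_zig rev_rev_ident)

lemma length_zig [simp]: "length (zig n) = 2 * n" and length_zag [simp]: "length (zag n) = 2 * n"
  by (induction n) (simp_all add: zig_Suc zag_Suc)

text \<open>The tails p and q keep what remains of a block yx after its x has been split off on the
  right. Only [] and [Y] arise, so three recursions close.\<close>

definition altsum :: "letter list \<Rightarrow> letter list \<Rightarrow> nat \<Rightarrow> (letter list \<Rightarrow> 'r::comm_ring_1) \<Rightarrow> 'r" where
  "altsum p q n f = (\<Sum>k\<le>n. (- 1) ^ k * sh f (zig (n - k) @ p) (zig k @ q))"

lemma altsum_flip:
  fixes f :: "letter list \<Rightarrow> 'r::comm_ring_1"
  shows "altsum p q n f = (- 1) ^ n * altsum q p n f"
proof -
  have "altsum p q n f = (\<Sum>k\<le>n. (- 1) ^ (n - k) * sh f (zig k @ p) (zig (n - k) @ q))"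
    unfolding altsum_def by (rule sum.reindex_bij_witness[of _ "\<lambda>k. n - k" "\<lambda>k. n - k"]) auto
  also have "\<dots> = (\<Sum>k\<le>n. (- 1) ^ n * ((- 1) ^ k * sh f (zig (n - k) @ q) (zig k @ p)))"
  proof (intro sum.cong refl)
    fix k assume "k \<in> {..n}"
    then have "(- 1 :: 'r) ^ (n - k) = (- 1) ^ n * (- 1) ^ k"
      by (auto simp: minus_one_power_iff)
    then show "(- 1) ^ (n - k) * sh f (zig k @ p) (zig (n - k) @ q) =
      (- 1) ^ n * ((- 1) ^ k * sh f (zig (n - k) @ q) (zig k @ p))"
      by (simp add: sh_commute[of f "zig k @ p"] mult_ac)
  qed
  finally show ?thesis by (simp add: altsum_def sum_distrib_left)
qed

text \<open>The last letter is the x closing the first word or the y closing the second. For k = Suc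
  n the first word is empty and only the y remains.\<close>

lemma altsum_step1:
  "altsum [] [Y] (Suc n) f = altsum [] [] (Suc n) (\<lambda>w. f (w @ [Y])) + altsum [Y] [Y] n (\<lambda>w. f (w @ [X]))"
proof -
  have 1: "sh f (zig (Suc n - k)) (zig k @ [Y]) =
    sh (\<lambda>w. f (w @ [X])) (zig (n - k) @ [Y]) (zig k @ [Y]) + sh (\<lambda>w. f (w @ [Y])) (zig (Suc n - k)) (zig k)"
    if "k \<le> n" for k
    using sh_snoc[of f "zig (n - k) @ [Y]" X "zig k" Y] that by (simp add: Suc_diff_le zig_Suc2)
  show ?thesis by (simp add: altsum_def 1 algebra_simps sum.distrib)
qed

text \<open>Both words end in x. Removing it from one or from the other gives two sums exchanged by
  \<open>altsum_flip\<close>, which double or cancel according to the parity of n. The shift of k in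
  \<open>B\<close> produces the minus sign.\<close>

lemma altsum_step2:
  "altsum [] [] (Suc n) f = ((- 1) ^ n - 1) * altsum [] [Y] n (\<lambda>w. f (w @ [X]))"
proof -
  let ?g = "\<lambda>w. f (w @ [X])"
  define A where "A k = (if k \<le> n then sh ?g (zig (n - k) @ [Y]) (zig k) else 0)" for k
  define B where "B k = (if 0 < k then sh ?g (zig (Suc n - k)) (zig (k - 1) @ [Y]) else 0)" for k
  have 1: "sh f (zig (Suc n - k)) (zig k) = A k + B k" if "k \<le> Suc n" for k
  proof (cases "k = 0")
    case True
    then show ?thesis using sh_snoc[of f] by (simp add: A_def B_def zig_Suc2)
  next
    case False
    then obtain j where j: "k = Suc j" by (cases k) auto
    show ?thesis
    proof (cases "k \<le> n")
      case True
      then have "n - j = Suc (n - Suc j)" using j by simp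
      then show ?thesis
        using sh_snoc[of f "zig (n - Suc j) @ [Y]" X "zig j @ [Y]" X] True j
        by (simp add: A_def B_def zig_Suc2)
    next
      case False
      with that j have "j = n" by simp
      then show ?thesis using j by (simp add: A_def B_def zig_Suc2)
    qed
  qed
  have "altsum [] [] (Suc n) f = (\<Sum>k\<le>Suc n. (- 1) ^ k * A k) + (\<Sum>k\<le>Suc n. (- 1) ^ k * B k)"
    unfolding altsum_def sum.distrib[symmetric] by (intro sum.cong refl) (simp add: 1 algebra_simps)
  also have "(\<Sum>k\<le>Suc n. (- 1) ^ k * A k) = altsum [Y] [] n ?g"
    by (simp add: altsum_def A_def)
  also have "(\<Sum>k\<le>Suc n. (- 1) ^ k * B k) = - altsum [] [Y] n ?g"
    by (simp add: altsum_def B_def sum.atMost_Suc_shift sum_negf del: sum.atMost_Suc)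
  also have "altsum [Y] [] n ?g = (- 1) ^ n * altsum [] [Y] n ?g"
    by (rule altsum_flip)
  finally show ?thesis by (simp add: algebra_simps)
qed

lemma altsum_step3:
  "altsum [Y] [Y] n f = (1 + (- 1) ^ n) * altsum [] [Y] n (\<lambda>w. f (w @ [Y]))"
proof -
  let ?g = "\<lambda>w. f (w @ [Y])"
  have "altsum [Y] [Y] n f = altsum [] [Y] n ?g + altsum [Y] [] n ?g"
    by (simp add: altsum_def sh_snoc algebra_simps sum.distrib)
  also have "altsum [Y] [] n ?g = (- 1) ^ n * altsum [] [Y] n ?g"
    by (rule altsum_flip)
  finally show ?thesis by (simp add: algebra_simps)
qed

text \<open>From right to left one round strips y, x, x, y. In \<open>altsum_step1\<close> parity
  decides which of the two branches survives; \<open>altsum_step2\<close> contributes -2 and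
  \<open>altsum_step3\<close> contributes 2.\<close>

lemma altsum_zig:
  "altsum [] [Y] (2 * n) f = (- 4) ^ n * f (Y # concat (replicate n [Y, X, X, Y]))"
proof (induction n arbitrary: f)
  case 0
  then show ?case by (simp add: altsum_def)
next
  case (Suc n)
  have "concat (replicate (Suc n) [Y, X, X, Y]) = concat (replicate n [Y, X, X, Y]) @ [Y, X, X, Y]"
    by (induction n) simp_all
  then show ?case
    using Suc[of "\<lambda>w. f (w @ [Y, X, X, Y])"]
    by (simp add: altsum_step1 altsum_step2 altsum_step3 del: replicate_Suc)
qed

text \<open>The prefix p holds the part already scanned, so \<open>lie_of Y\<close> can be evaluated
  letter by letter: each y contributes one cut, each x only extends p.\<close>

definition lie_from :: "(letter list \<Rightarrow> 'r::comm_ring_1) \<Rightarrow> letter list \<Rightarrow> letter list \<Rightarrow> 'r" where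
  "lie_from \<phi> p w = conv (\<lambda>x. \<phi> (p @ x)) (\<lambda>v. if v \<noteq> [] \<and> hd v = Y then antip \<phi> (tl v) else 0) w"

lemma lie_from_simps [simp]:
  "lie_from \<phi> p [] = 0"
  "lie_from \<phi> p (Y # w) = \<phi> p * antip \<phi> w + lie_from \<phi> (p @ [Y]) w"
  "lie_from \<phi> p (X # w) = lie_from \<phi> (p @ [X]) w"
  by (simp_all add: lie_from_def conv_Cons)

lemma lie_of_eq: "lie_of Y \<phi> w = lie_from \<phi> [] w"
  by (simp add: lie_of_def lie_from_def)

lemma lie_from_zig:
  "lie_from \<phi> p (zig n @ r) =
     (\<Sum>i<n. \<phi> (p @ zig i) * antip \<phi> (X # zig (n - 1 - i) @ r)) + lie_from \<phi> (p @ zig n) r"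
proof (induction n arbitrary: p)
  case (Suc n)
  show ?case by (simp add: zig_Suc Suc sum.lessThan_Suc_shift del: sum.lessThan_Suc)
qed simp

lemma lie_from_zag:
  "lie_from \<phi> p (zag n) = (\<Sum>l<n. \<phi> (p @ X # zig l) * antip \<phi> (zag (n - 1 - l)))"
proof -
  have "lie_from \<phi> p (zag n) = (\<Sum>l<n. \<phi> (p @ zag l @ [X]) * antip \<phi> (zag (n - 1 - l)))"
  proof (induction n arbitrary: p)
    case (Suc n)
    show ?case by (simp add: zag_Suc Suc sum.lessThan_Suc_shift del: sum.lessThan_Suc)
  qed simp
  then show ?thesis by (simp add: zag_snoc)
qed

lemma antip_zag: "antip \<phi> (zag n) = \<phi> (zig n)"
  by (simp add: antip_def rev_zag)

text \<open>\<open>lie_of Y\<close> kills every proper shuffle, which leaves k = n. In the remaining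
  word (yx)^n y each y is a cut, and the reversed suffix is again a power of yx.\<close>

lemma altsum_lie_of:
  assumes "is_char \<phi>"
  shows "altsum [] [Y] n (lie_of Y \<phi>) = (- 1) ^ n * (\<Sum>i\<le>n. \<phi> (zig i) * \<phi> (zig (n - i)))"
proof -
  have a: "antip \<phi> (X # zig m @ [Y]) = \<phi> (zig (Suc m))" for m
  proof -
    have "rev (X # zig m @ [Y]) = Y # zag m @ [X]" by (simp add: rev_zig)
    also have "\<dots> = zig (Suc m)" by (simp add: zag_snoc zig_Suc)
    finally show ?thesis by (simp add: antip_def)
  qed
  have antip_nil: "antip \<phi> [] = \<phi> []" by (simp add: antip_def)
  have "altsum [] [Y] n (lie_of Y \<phi>) = (\<Sum>k\<le>n. if k = n then (- 1) ^ n * lie_of Y \<phi> (zig n @ [Y]) else 0)"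
    unfolding altsum_def
  proof (intro sum.cong refl)
    fix k assume "k \<in> {..n}"
    moreover have "sh (lie_of Y \<phi>) (zig (n - k)) (zig k @ [Y]) = 0" if "k < n"
      using that by (intro lie_of_sh assms) (auto simp: zig_def)
    ultimately show "(- 1) ^ k * sh (lie_of Y \<phi>) (zig (n - k) @ []) (zig k @ [Y]) =
       (if k = n then (- 1) ^ n * lie_of Y \<phi> (zig n @ [Y]) else 0)"
      by auto
  qed
  also have "\<dots> = (- 1) ^ n * lie_of Y \<phi> (zig n @ [Y])" by simp
  also have "lie_of Y \<phi> (zig n @ [Y]) = (\<Sum>i<n. \<phi> (zig i) * \<phi> (zig (Suc (n - 1 - i)))) + \<phi> (zig n) * \<phi> []"
    using assms antip_nil by (simp add: lie_of_eq lie_from_zig a)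
  also have "\<dots> = (\<Sum>i\<le>n. \<phi> (zig i) * \<phi> (zig (n - i)))"
    using assms by (simp add: lessThan_Suc_atMost[symmetric] Suc_diff_Suc is_char_def del: lessThan_Suc_atMost)
  finally show ?thesis .
qed

text \<open>An x inserted before or after an existing x gives the same word, so every place except
  the front counts twice.\<close>

lemma sh_X_zig:
  fixes f :: "letter list \<Rightarrow> 'r::comm_ring_1"
  shows "sh f [X] (zig a) = f (X # zig a) + 2 * (\<Sum>j<a. f (zig (Suc j) @ X # zig (a - 1 - j)))"
proof (induction a arbitrary: f)
  case (Suc a)
  have "sh f [X] (zig (Suc a)) = f (X # zig (Suc a)) + f (Y # X # X # zig a) + sh (\<lambda>w. f (Y # X # w)) [X] (zig a)"
    by (simp add: zig_Suc)
  also have "sh (\<lambda>w. f (Y # X # w)) [X] (zig a) = f (Y # X # X # zig a) +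
     2 * (\<Sum>j<a. f (zig (Suc (Suc j)) @ X # zig (a - 1 - j)))"
    by (simp add: Suc zig_Suc)
  finally show ?case
    by (simp add: sum.lessThan_Suc_shift zig_Suc algebra_simps del: sum.lessThan_Suc)
qed simp

lemma sum_triangle:
  fixes F :: "nat \<Rightarrow> nat \<Rightarrow> 'r::comm_monoid_add"
  shows "(\<Sum>l\<le>n. \<Sum>j<l. F j (l - 1 - j)) = (\<Sum>a<n. \<Sum>b<n - a. F a b)"
proof -
  have "(\<Sum>l\<le>n. \<Sum>j<l. F j (l - 1 - j)) = (\<Sum>(l,j)\<in>(SIGMA l:{..n}. {..<l}). F j (l - 1 - j))"
    by (simp add: sum.Sigma)
  also have "\<dots> = (\<Sum>(a,b)\<in>(SIGMA a:{..<n}. {..<n - a}). F a b)"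
    by (rule sum.reindex_bij_witness[of _ "\<lambda>(a,b). (Suc (a + b), a)" "\<lambda>(l,j). (j, l - 1 - j)"]) auto
  also have "\<dots> = (\<Sum>a<n. \<Sum>b<n - a. F a b)"
    by (simp add: sum.Sigma)
  finally show ?thesis .
qed

text \<open>The appended x leads to \<phi> at (yx)^(a+1) x (yx)^b, the word of ({2}^a, 3, {2}^b),
  times \<phi> at a power of yx. Cuts on either side of the double x produce the same products up to
  sign.\<close>

lemma altsum_lie_of_X:
  fixes \<phi> :: "letter list \<Rightarrow> 'r::comm_ring_1"
  assumes "is_char \<phi>" "\<phi> [X] = 0"
  shows "altsum [] [Y] (2 * n) (\<lambda>w. lie_of Y \<phi> (w @ [X])) =
    (\<Sum>a<2*n. \<Sum>b<2*n - a. (2 + 2 * (- 1) ^ a) * (\<phi> (zig (Suc a) @ X # zig b) * \<phi> (zig (2 * n - 1 - a - b))))"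
proof -
  define N where "N = 2 * n"
  define T where "T j a = \<phi> (zig j @ X # zig a)" for j a
  define Z where "Z j = \<phi> (zig j)" for j
  define F where "F a b = T (Suc a) b * Z (N - 1 - a - b)" for a b
  \<comment> \<open>A word with leading x is not an index word; \<phi>(x) = 0 expresses it through
    words with the additional x inside.\<close>
  have T0: "T 0 a = - 2 * (\<Sum>j<a. T (Suc j) (a - 1 - j))" for a
  proof -
    have "sh \<phi> [X] (zig a) = 0" using assms by (simp add: is_char_def)
    then show ?thesis unfolding sh_X_zig T_def by (simp add: eq_neg_iff_add_eq_0)
  qed
  have a1: "antip \<phi> (X # zig a @ zag b) = - T b a" for a b
  proof -
    have "rev (X # zig a @ zag b) = zig b @ zag a @ [X]" by (simp add: rev_zig rev_zag)
    then show ?thesis by (simp add: antip_def zag_snoc T_def)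
  qed
  have g: "lie_of Y \<phi> (zig i @ zag m) = (\<Sum>l<m. T i l * Z (m - 1 - l)) - (\<Sum>j<i. Z j * T m (i - 1 - j))" for i m
    by (simp add: lie_of_eq lie_from_zig lie_from_zag a1 antip_zag T_def Z_def sum_negf)
  \<comment> \<open>By \<open>sh_append_letter\<close> the second word moves, reversed, behind the
    x, where it completes \<open>zag (Suc k)\<close>; its odd length gives the sign.\<close>
  have "altsum [] [Y] N (\<lambda>w. lie_of Y \<phi> (w @ [X])) =
     (\<Sum>k\<le>N. - ((- 1) ^ k * lie_of Y \<phi> (zig (N - k) @ zag (Suc k))))"
    unfolding altsum_def
    using sh_append_letter[of "lie_of Y \<phi>" X, OF lie_of_sh[OF assms(1)]]
    by (intro sum.cong refl) (simp add: rev_zig zag_Suc power_add power_mult)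
  also have "\<dots> = (\<Sum>k\<le>N. (- 1) ^ k * (\<Sum>j<N - k. Z j * T (Suc k) (N - k - 1 - j)))
       - (\<Sum>k\<le>N. (- 1) ^ k * (\<Sum>l<Suc k. T (N - k) l * Z (k - l)))"
    by (simp add: g algebra_simps sum_subtractf del: sum.lessThan_Suc)
  also have "(\<Sum>k\<le>N. (- 1) ^ k * (\<Sum>j<N - k. Z j * T (Suc k) (N - k - 1 - j))) =
      (\<Sum>a<N. (- 1) ^ a * (\<Sum>b<N - a. F a b))"
  proof -
    have "(\<Sum>j<N - k. Z j * T (Suc k) (N - k - 1 - j)) = (\<Sum>b<N - k. F k b)" for k
      by (rule sum.reindex_bij_witness[of _ "\<lambda>j. N - k - 1 - j" "\<lambda>j. N - k - 1 - j"])
        (auto simp: F_def mult.commute)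
    then show ?thesis by (simp add: lessThan_Suc_atMost[symmetric])
  qed
  also have "(\<Sum>k\<le>N. (- 1) ^ k * (\<Sum>l<Suc k. T (N - k) l * Z (k - l))) =
     (\<Sum>k<N. (- 1) ^ k * (\<Sum>l<Suc k. T (N - k) l * Z (k - l))) + (\<Sum>l\<le>N. T 0 l * Z (N - l))"
    by (simp add: lessThan_Suc_atMost[symmetric] N_def del: lessThan_Suc_atMost)
  \<comment> \<open>The substitution of N - 1 - k for k yields minus the other sum because N is
    even, so together they give the weight 2 (-1)^a. The constant 2 comes from the term k = N, where
    x stands in front.\<close>
  also have "(\<Sum>k<N. (- 1) ^ k * (\<Sum>l<Suc k. T (N - k) l * Z (k - l))) = - (\<Sum>a<N. (- 1) ^ a * (\<Sum>b<N - a. F a b))"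
    unfolding sum_negf[symmetric]
  proof (rule sum.reindex_bij_witness[of _ "\<lambda>k. N - 1 - k" "\<lambda>k. N - 1 - k"])
    fix k assume k: "k \<in> {..<N}"
    then have "(- 1 :: 'r) ^ (N - 1 - k) = - ((- 1) ^ k)"
      by (auto simp: minus_one_power_iff N_def)
    moreover have "N - (N - 1 - k) = Suc k" "Suc (N - 1 - k) = N - k" using k by auto
    ultimately show "- ((- 1) ^ (N - 1 - k) * (\<Sum>b<N - (N - 1 - k). F (N - 1 - k) b)) =
       (- 1) ^ k * (\<Sum>l<Suc k. T (N - k) l * Z (k - l))"
      using k by (simp add: F_def)
  qed auto
  also have "(\<Sum>l\<le>N. T 0 l * Z (N - l)) = - 2 * (\<Sum>a<N. \<Sum>b<N - a. F a b)"
  proof -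
    have "(\<Sum>l\<le>N. T 0 l * Z (N - l)) = - 2 * (\<Sum>l\<le>N. \<Sum>j<l. F j (l - 1 - j))"
      unfolding sum_distrib_left by (auto intro!: sum.cong simp: T0 F_def sum_distrib_right sum_distrib_left mult_ac sum_negf)
    then show ?thesis using sum_triangle[of F N] by simp
  qed
  finally show ?thesis
    by (simp add: N_def[symmetric] F_def T_def[symmetric] Z_def[symmetric] sum.distrib
        distrib_right sum_distrib_left mult.assoc sum_negf)
qed

section \<open>Regularization through polynomial asymptotics\<close>

definition ev :: "('a \<Rightarrow> real) \<Rightarrow> ('a \<Rightarrow>\<^sub>0 rat) \<Rightarrow> real" where
  "ev F f = (\<Sum>a\<in>Poly_Mapping.keys f. of_rat (Poly_Mapping.lookup f a) * F a)"

lemma ev_superset: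
  assumes "finite A" "Poly_Mapping.keys f \<subseteq> A"
  shows "ev F f = (\<Sum>a\<in>A. of_rat (Poly_Mapping.lookup f a) * F a)"
  unfolding ev_def using assms
  by (intro sum.mono_neutral_left) (auto simp: in_keys_iff)

lemma lookup_qscale [simp]: "Poly_Mapping.lookup (qscale c f) a = c * Poly_Mapping.lookup f a"
  by (simp add: qscale_def map.rep_eq when_def)

lemma keys_qscale: "Poly_Mapping.keys (qscale c f) \<subseteq> Poly_Mapping.keys f"
  by (auto simp: in_keys_iff)

lemma ev_add [simp]: "ev F (f + g) = ev F f + ev F g"
proof -
  let ?A = "Poly_Mapping.keys f \<union> Poly_Mapping.keys g"
  have "ev F (f + g) = (\<Sum>a\<in>?A. of_rat (Poly_Mapping.lookup (f + g) a) * F a)"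
    by (rule ev_superset) (auto simp: Poly_Mapping.keys_add)
  also have "\<dots> = ev F f + ev F g"
    by (simp add: ev_superset[of ?A] lookup_add of_rat_add distrib_right sum.distrib)
  finally show ?thesis .
qed

lemma ev_0 [simp]: "ev F 0 = 0"
  by (simp add: ev_def)

lemma ev_sum: "ev F (\<Sum>i\<in>I. f i) = (\<Sum>i\<in>I. ev F (f i))"
  by (induction I rule: infinite_finite_induct) auto

lemma ev_qscale [simp]: "ev F (qscale c f) = of_rat c * ev F f"
  by (subst ev_superset[OF _ keys_qscale]) (auto simp: ev_def sum_distrib_left of_rat_mult mult_ac)

lemma ev_basis [simp]: "ev F (basis a) = F a"
  by (simp add: ev_def basis_def)

lemma ev_lin_ext: "ev F (lin_ext g f) = ev (\<lambda>a. ev F (g a)) f"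
  unfolding lin_ext_def ev_sum ev_qscale ev_def[of "\<lambda>a. ev F (g a)"] ..

lemma ev_cong: "(\<And>a. a \<in> Poly_Mapping.keys f \<Longrightarrow> F a = G a) \<Longrightarrow> ev F f = ev G f"
  by (simp add: ev_def)

lemma ev_times: "ev (\<lambda>a. ev (\<lambda>b. F a * G b) g) f = ev F f * ev G g"
proof -
  have "ev F f * ev G g = (\<Sum>a\<in>Poly_Mapping.keys f. \<Sum>b\<in>Poly_Mapping.keys g.
      of_rat (Poly_Mapping.lookup f a) * F a * (of_rat (Poly_Mapping.lookup g b) * G b))"
    by (simp add: ev_def sum_product)
  then show ?thesis by (simp add: ev_def sum_distrib_left mult_ac)
qed

lemma ev_scale: "ev (\<lambda>a. c * F a) f = c * ev F f"
  by (simp add: ev_def sum_distrib_left mult_ac)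

lemma ev_bilin_ext: "ev F (bilin_ext p f g) = ev (\<lambda>a. ev (\<lambda>b. ev F (p a b)) g) f"
  by (simp add: bilin_ext_def ev_lin_ext)

lemma vector_space_real: "vector_space rat_mult_real"
  by unfold_locales (simp_all add: rat_mult_real_def of_rat_add of_rat_mult algebra_simps)

lemma vector_space_qscale: "vector_space (qscale :: rat \<Rightarrow> ('a \<Rightarrow>\<^sub>0 rat) \<Rightarrow> _)"
  by unfold_locales (auto intro!: poly_mapping_eqI simp: lookup_add algebra_simps)

lemma linear_ev: "Vector_Spaces.linear qscale rat_mult_real (ev F)"
proof -
  interpret a: vector_space "qscale :: rat \<Rightarrow> ('a \<Rightarrow>\<^sub>0 rat) \<Rightarrow> _" by (rule vector_space_qscale)
  interpret b: vector_space rat_mult_real by (rule vector_space_real)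
  show ?thesis by unfold_locales (simp_all add: rat_mult_real_def)
qed

lemma poly_mapping_basis_sum:
  "f = (\<Sum>a\<in>Poly_Mapping.keys f. qscale (Poly_Mapping.lookup f a) (basis a))"
proof (rule poly_mapping_eqI)
  fix x
  have "Poly_Mapping.lookup (\<Sum>a\<in>Poly_Mapping.keys f. qscale (Poly_Mapping.lookup f a) (basis a)) x =
    (\<Sum>a\<in>Poly_Mapping.keys f. Poly_Mapping.lookup f a * (if a = x then 1 else 0))"
    by (simp add: lookup_sum basis_def lookup_single when_def)
  also have "\<dots> = Poly_Mapping.lookup f x"
    by (simp add: sum.delta' if_distrib[of "\<lambda>y. _ * y"] in_keys_iff cong: if_cong)
  finally show "Poly_Mapping.lookup f x =
    Poly_Mapping.lookup (\<Sum>a\<in>Poly_Mapping.keys f. qscale (Poly_Mapping.lookup f a) (basis a)) x" ..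
qed

lemma linear_eq_ev:
  assumes "Vector_Spaces.linear qscale rat_mult_real Z"
  shows "Z f = ev (\<lambda>a. Z (basis a)) f"
proof -
  interpret Vector_Spaces.linear qscale rat_mult_real Z by fact
  show ?thesis
    by (subst poly_mapping_basis_sum[of f]) (simp add: sum scale rat_mult_real_def ev_def)
qed

text \<open>Linear maps are exactly the maps \<open>ev F\<close>, and multiplicativity is bilinear,
  so basis elements suffice. A regularization becomes a condition on the function F.\<close>

lemma is_regularization_iff:
  "is_regularization B enc p Z \<longleftrightarrow> (\<exists>F. Z = ev F \<and> (\<forall>b. b \<notin> B \<longrightarrow> F b = 0) \<and>
     (\<forall>a\<in>B. \<forall>b\<in>B. ev F (p a b) = F a * F b) \<and> (\<forall>k. admissible k \<longrightarrow> F (enc k) = mzv k) \<and> F (enc [1]) = 0)"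
    (is "?L \<longleftrightarrow> ?R")
proof
  assume L: ?L
  define F where "F a = Z (basis a)" for a
  have Z: "Z = ev F"
    unfolding F_def by (intro ext linear_eq_ev) (use L in \<open>simp add: is_regularization_def\<close>)
  have b: "bilin_ext p (basis a) (basis b) = p a b" for a b
    by (auto intro!: poly_mapping_eqI simp: bilin_ext_def lin_ext_def basis_def)
  have "ev F (p a b) = F a * F b" if "a \<in> B" "b \<in> B" for a b
  proof -
    have "basis a \<in> free_on B" "basis b \<in> free_on B" using that by (auto simp: free_on_def basis_def)
    with L have "Z (bilin_ext p (basis a) (basis b)) = Z (basis a) * Z (basis b)"
      unfolding is_regularization_def by blast
    then show ?thesis by (simp add: b Z)
  qed
  moreover have "F b = 0" if "b \<notin> B" for b
    using L that by (simp add: is_regularization_def F_def)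
  moreover have "F (enc k) = mzv k" if "admissible k" for k
    using L that by (simp add: is_regularization_def F_def)
  moreover have "F (enc [1]) = 0"
    using L by (simp add: is_regularization_def F_def)
  ultimately show ?R using Z by blast
next
  assume ?R
  then obtain F where Z: "Z = ev F" and F: "\<forall>b. b \<notin> B \<longrightarrow> F b = 0"
     "\<forall>a\<in>B. \<forall>b\<in>B. ev F (p a b) = F a * F b" "\<forall>k. admissible k \<longrightarrow> F (enc k) = mzv k" "F (enc [1]) = 0"
    by blast
  have "Z (bilin_ext p f g) = Z f * Z g" if "f \<in> free_on B" "g \<in> free_on B" for f g
  proof -
    have "Z (bilin_ext p f g) = ev (\<lambda>a. ev (\<lambda>b. F a * F b) g) f"
      unfolding Z ev_bilin_ext using that F(2) by (intro ev_cong) (auto simp: free_on_def)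
    then show ?thesis by (simp add: ev_times Z)
  qed
  moreover have "Z (basis a) = F a" for a by (simp add: Z)
  moreover have "Vector_Spaces.linear qscale rat_mult_real Z" unfolding Z by (rule linear_ev)
  ultimately show ?L using F unfolding is_regularization_def by auto
qed

text \<open>The condition on all powers of \<open>T\<close> makes the functions that are polynomial in \<open>T\<close> up to a
  negligible error closed under products.\<close>

definition negl :: "'a filter \<Rightarrow> ('a \<Rightarrow> real) \<Rightarrow> ('a \<Rightarrow> real) \<Rightarrow> bool" where
  "negl F T f \<longleftrightarrow> (\<forall>j. ((\<lambda>x. f x * T x ^ j) \<longlongrightarrow> 0) F)"

definition polyasym :: "'a filter \<Rightarrow> ('a \<Rightarrow> real) \<Rightarrow> ('a \<Rightarrow> real) \<Rightarrow> real poly \<Rightarrow> bool" where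
  "polyasym F T f p \<longleftrightarrow> negl F T (\<lambda>x. f x - poly p (T x))"

lemma neglD: "negl F T f \<Longrightarrow> ((\<lambda>x. f x * T x ^ j) \<longlongrightarrow> 0) F"
  by (simp add: negl_def)

lemma negl_add: "negl F T f \<Longrightarrow> negl F T g \<Longrightarrow> negl F T (\<lambda>x. f x + g x)"
  unfolding negl_def by (auto simp: distrib_right intro!: tendsto_add_zero)

lemma negl_scale: "negl F T f \<Longrightarrow> negl F T (\<lambda>x. c * f x)"
  unfolding negl_def by (auto simp: mult.assoc intro!: tendsto_mult_right_zero)

lemma negl_mult_T: "negl F T f \<Longrightarrow> negl F T (\<lambda>x. T x * f x)"
  unfolding negl_def
proof
  fix j assume "\<forall>j. ((\<lambda>x. f x * T x ^ j) \<longlongrightarrow> 0) F"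
  from spec[OF this, of "Suc j"] show "((\<lambda>x. T x * f x * T x ^ j) \<longlongrightarrow> 0) F"
    by (simp add: mult_ac)
qed

lemma negl_mult_poly: "negl F T f \<Longrightarrow> negl F T (\<lambda>x. poly p (T x) * f x)"
proof (induction p)
  case 0
  then show ?case by (simp add: negl_def)
next
  case (pCons a p)
  from negl_add[OF negl_scale[OF pCons(3), of a] negl_mult_T[OF pCons(2)[OF pCons(3)]]]
  show ?case by (simp add: algebra_simps)
qed

lemma negl_mult: "negl F T f \<Longrightarrow> negl F T g \<Longrightarrow> negl F T (\<lambda>x. f x * g x)"
  unfolding negl_def
proof
  fix j assume a: "\<forall>j. ((\<lambda>x. f x * T x ^ j) \<longlongrightarrow> 0) F" "\<forall>j. ((\<lambda>x. g x * T x ^ j) \<longlongrightarrow> 0) F"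
  from tendsto_mult[OF spec[OF a(1), of 0] spec[OF a(2), of j]]
  show "((\<lambda>x. f x * g x * T x ^ j) \<longlongrightarrow> 0) F" by (simp add: mult_ac)
qed

lemma polyasym_poly: "polyasym F T (\<lambda>x. poly p (T x)) p"
  by (simp add: polyasym_def negl_def)

lemma polyasym_add: "polyasym F T f p \<Longrightarrow> polyasym F T g q \<Longrightarrow> polyasym F T (\<lambda>x. f x + g x) (p + q)"
  unfolding polyasym_def by (drule (1) negl_add) (simp add: algebra_simps)

lemma polyasym_scale: "polyasym F T f p \<Longrightarrow> polyasym F T (\<lambda>x. c * f x) (smult c p)"
  unfolding polyasym_def by (drule negl_scale[of F T _ c]) (simp add: algebra_simps)

lemma polyasym_mult:
  assumes "polyasym F T f p" "polyasym F T g q"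
  shows "polyasym F T (\<lambda>x. f x * g x) (p * q)"
proof -
  from assms have "negl F T (\<lambda>x. (f x - poly p (T x)) * (g x - poly q (T x)))"
    unfolding polyasym_def by (rule negl_mult)
  from negl_add[OF this negl_add[OF negl_mult_poly[OF assms(1)[unfolded polyasym_def], of q]
       negl_mult_poly[OF assms(2)[unfolded polyasym_def], of p]]]
  show ?thesis unfolding polyasym_def by (simp add: algebra_simps)
qed

lemma polyasym_sum_list:
  "(\<And>w. w \<in> set L \<Longrightarrow> \<exists>p. polyasym F T (f w) p) \<Longrightarrow> \<exists>p. polyasym F T (\<lambda>x. \<Sum>w\<leftarrow>L. f w x) p"
proof (induction L)
  case Nil
  then show ?case using polyasym_poly[of F T 0] by auto
next
  case (Cons a L)
  from Cons.prems[of a] obtain p where p: "polyasym F T (f a) p" by auto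
  from Cons obtain q where q: "polyasym F T (\<lambda>x. \<Sum>w\<leftarrow>L. f w x) q" by fastforce
  from polyasym_add[OF p q] show ?case by auto
qed

text \<open>A polynomial with positive leading coefficient eventually stays above that coefficient,
  so a nonzero polynomial in a divergent T cannot tend to 0.\<close>

lemma poly_tendsto_zero_imp_0:
  assumes "filterlim T at_top F" "F \<noteq> bot" "((\<lambda>x. poly p (T x)) \<longlongrightarrow> 0) F"
  shows "p = (0 :: real poly)"
proof (rule ccontr)
  assume "p \<noteq> 0"
  have *: False if q: "lead_coeff q > 0" "((\<lambda>x. poly q (T x)) \<longlongrightarrow> 0) F" for q
  proof -
    obtain n where n: "\<forall>x\<ge>n. lead_coeff q \<le> poly q x" using poly_pinfty_gt_lc[OF q(1)] by blast
    have "\<forall>\<^sub>F x in F. T x \<ge> n" using assms(1) by (simp add: filterlim_at_top)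
    then have 1: "\<forall>\<^sub>F x in F. lead_coeff q \<le> poly q (T x)" by eventually_elim (use n in blast)
    have "lead_coeff q \<le> 0" using tendsto_lowerbound[OF q(2) 1 assms(2)] .
    with q(1) show False by simp
  qed
  show False
  proof (cases "lead_coeff p > 0")
    case True
    from *[OF this assms(3)] show False .
  next
    case False
    with \<open>p \<noteq> 0\<close> have "lead_coeff (- p) > 0" by (simp add: order_less_le)
    moreover have "((\<lambda>x. poly (- p) (T x)) \<longlongrightarrow> 0) F" using tendsto_minus[OF assms(3)] by simp
    ultimately show False by (rule *)
  qed
qed

text \<open>For q an o(1) error suffices: once some polynomial with negligible error exists, a plain
  limit identifies it.\<close>

lemma polyasym_unique_limit:
  assumes "filterlim T at_top F" "F \<noteq> bot" "polyasym F T f p" "((\<lambda>x. f x - poly q (T x)) \<longlongrightarrow> 0) F"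
  shows "p = q"
proof -
  have "((\<lambda>x. f x - poly p (T x)) \<longlongrightarrow> 0) F" using assms(3) neglD[of F T _ 0] by (simp add: polyasym_def)
  from tendsto_diff[OF assms(4) this] have "((\<lambda>x. poly (p - q) (T x)) \<longlongrightarrow> 0) F" by simp
  from poly_tendsto_zero_imp_0[OF assms(1,2) this] show ?thesis by simp
qed

lemma polyasym_unique:
  assumes "filterlim T at_top F" "F \<noteq> bot" "polyasym F T f p" "polyasym F T f q"
  shows "p = q"
  using polyasym_unique_limit[OF assms(1-3), of q] assms(4) neglD[of F T _ 0] by (simp add: polyasym_def)

section \<open>Truncated multiple zeta values\<close>

text \<open>The first exponent belongs to the largest summation variable, the one that the recursion
  peels off; \<open>zpart\<close> reverses to the order used by \<open>mzv\<close>.\<close>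

fun ztrunc :: "nat list \<Rightarrow> nat \<Rightarrow> real" where
  "ztrunc [] N = 1"
| "ztrunc (a # k) N = (\<Sum>m=1..N. ztrunc k (m - 1) / real m ^ a)"

definition zpart :: "nat \<Rightarrow> nat list \<Rightarrow> real" where
  "zpart N k = ztrunc (rev k) N"

lemma zpart_Nil [simp]: "zpart N [] = 1"
  by (simp add: zpart_def)

lemma zpart_snoc: "zpart N (k @ [a]) = (\<Sum>m=1..N. zpart (m - 1) k / real m ^ a)"
  by (simp add: zpart_def)

lemma zpart_0: "k \<noteq> [] \<Longrightarrow> zpart 0 k = 0"
  by (cases k rule: rev_cases) (simp_all add: zpart_snoc)

lemma zpart_Suc: "zpart (Suc N) (k @ [a]) = zpart N (k @ [a]) + zpart N k / real (Suc N) ^ a"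
  by (simp add: zpart_snoc)

lemma zpart_nonneg: "zpart N k \<ge> 0"
  by (induction k arbitrary: N rule: rev_induct) (auto simp: zpart_snoc intro!: sum_nonneg divide_nonneg_nonneg)

lemma zpart_mono: "M \<le> N \<Longrightarrow> zpart M k \<le> zpart N k"
  by (cases k rule: rev_cases)
    (auto simp: zpart_snoc intro!: sum_mono2 divide_nonneg_nonneg zpart_nonneg)

lemma zpart_one: "zpart N [1] = harm N"
  using zpart_snoc[of N "[]" 1] by (simp add: harm_def inverse_eq_divide)

definition zchains :: "nat \<Rightarrow> nat list set" where
  "zchains r = {n. length n = r \<and> sorted_wrt (<) n \<and> (\<forall>a\<in>set n. 1 \<le> a)}"

definition zchains_upto :: "nat \<Rightarrow> nat \<Rightarrow> nat list set" where
  "zchains_upto N r = {n\<in>zchains r. \<forall>a\<in>set n. a \<le> N}"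

lemma finite_zchains_upto [simp]: "finite (zchains_upto N r)"
  by (rule finite_subset[OF _ finite_lists_length_eq[of "{..N}" r]]) (auto simp: zchains_upto_def zchains_def)

lemma zchains_upto_subset: "zchains_upto N r \<subseteq> zchains r"
  by (auto simp: zchains_upto_def)

lemma zpart_eq_sum: "zpart N k = (\<Sum>n\<in>zchains_upto N (length k). 1 / (\<Prod>i<length k. real (n ! i) ^ (k ! i)))"
proof (induction k arbitrary: N rule: rev_induct)
  case Nil
  have "zchains_upto N 0 = {[]}" by (auto simp: zchains_upto_def zchains_def)
  then show ?case by simp
next
  case (snoc a k)
  let ?r = "length k"
  have "zpart N (k @ [a]) = (\<Sum>m=1..N. \<Sum>n\<in>zchains_upto (m - 1) ?r.
           1 / (\<Prod>i<?r. real (n ! i) ^ (k ! i)) / real m ^ a)"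
    by (simp add: zpart_snoc snoc sum_divide_distrib)
  also have "\<dots> = (\<Sum>(m,n)\<in>(SIGMA m:{1..N}. zchains_upto (m - 1) ?r).
           1 / (\<Prod>i<?r. real (n ! i) ^ (k ! i)) / real m ^ a)"
    by (simp add: sum.Sigma)
  also have "\<dots> = (\<Sum>n\<in>zchains_upto N (Suc ?r). 1 / (\<Prod>i<Suc ?r. real (n ! i) ^ ((k @ [a]) ! i)))"
  proof (rule sum.reindex_bij_witness[of _ "\<lambda>n. (last n, butlast n)" "\<lambda>(m,n). n @ [m]"])
    fix p assume "p \<in> (SIGMA m:{1..N}. zchains_upto (m - 1) ?r)"
    then obtain m n where p: "p = (m, n)" "m \<in> {1..N}" "n \<in> zchains_upto (m - 1) ?r" by auto
    then show "(case p of (m,n) \<Rightarrow> n @ [m]) \<in> zchains_upto N (Suc ?r)"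
      by (fastforce simp: zchains_upto_def zchains_def sorted_wrt_append)
    show "(last (case p of (m,n) \<Rightarrow> n @ [m]), butlast (case p of (m,n) \<Rightarrow> n @ [m])) = p"
      using p by simp
    have "length n = ?r" using p by (simp add: zchains_upto_def zchains_def)
    then show "1 / (\<Prod>i<Suc ?r. real ((case p of (m,n) \<Rightarrow> n @ [m]) ! i) ^ ((k @ [a]) ! i)) =
       (case p of (m,n) \<Rightarrow> 1 / (\<Prod>i<?r. real (n ! i) ^ (k ! i)) / real m ^ a)"
      using p by (simp add: nth_append)
  next
    fix n assume n: "n \<in> zchains_upto N (Suc ?r)"
    then have ne: "n \<noteq> []" by (auto simp: zchains_upto_def zchains_def)
    then obtain n' m where nm: "n = n' @ [m]" by (metis append_butlast_last_id)
    show "(case (last n, butlast n) of (m,n) \<Rightarrow> n @ [m]) = n" using ne by simp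
    show "(last n, butlast n) \<in> (SIGMA m:{1..N}. zchains_upto (m - 1) ?r)"
      using n unfolding nm by (fastforce simp: zchains_upto_def zchains_def sorted_wrt_append)
  qed
  finally show ?case by simp
qed

text \<open>\<open>mzv\<close> is an unordered infinite sum. Its terms are nonnegative and the
  finite sets \<open>zchains_upto N\<close> exhaust the index set, so L bounds all finite partial
  sums and is the sum.\<close>

lemma mzv_eqI:
  assumes "(\<lambda>N. zpart N k) \<longlonglongrightarrow> L"
  shows "mzv k = L"
proof -
  let ?f = "\<lambda>n. 1 / (\<Prod>i<length k. real (n ! i) ^ (k ! i))"
  let ?A = "zchains (length k)"
  have lim: "filterlim (\<lambda>N. zchains_upto N (length k)) (finite_subsets_at_top ?A) sequentially"
    unfolding filterlim_finite_subsets_at_top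
  proof (intro allI impI)
    fix S assume S: "finite S \<and> S \<subseteq> ?A"
    then have "finite (\<Union>n\<in>S. set n)" by auto
    then obtain M where M: "\<forall>a\<in>(\<Union>n\<in>S. set n). a \<le> M" using finite_nat_set_iff_bounded_le by auto
    have "S \<subseteq> zchains_upto N (length k)" if "N \<ge> M" for N
    proof
      fix n assume n: "n \<in> S"
      with S have "n \<in> zchains (length k)" by auto
      moreover have "a \<le> N" if "a \<in> set n" for a using M n that \<open>N \<ge> M\<close> by fastforce
      ultimately show "n \<in> zchains_upto N (length k)" by (simp add: zchains_upto_def)
    qed
    then show "\<forall>\<^sub>F N in sequentially. finite (zchains_upto N (length k)) \<and>
       S \<subseteq> zchains_upto N (length k) \<and> zchains_upto N (length k) \<subseteq> ?A"
      by (intro eventually_sequentiallyI[of M] conjI zchains_upto_subset finite_zchains_upto)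
  qed
  have nonneg: "?f n \<ge> 0" for n by (intro divide_nonneg_nonneg prod_nonneg) auto
  have bd: "sum ?f S \<le> L" if S: "finite S" "S \<subseteq> ?A" for S
  proof -
    from lim S have "\<forall>\<^sub>F N in sequentially. finite (zchains_upto N (length k)) \<and>
        S \<subseteq> zchains_upto N (length k) \<and> zchains_upto N (length k) \<subseteq> ?A"
      unfolding filterlim_finite_subsets_at_top by blast
    then have "\<forall>\<^sub>F N in sequentially. S \<subseteq> zchains_upto N (length k)" by eventually_elim blast
    then obtain N where "S \<subseteq> zchains_upto N (length k)" by (auto simp: eventually_sequentially)
    then have "sum ?f S \<le> zpart N k" unfolding zpart_eq_sum by (intro sum_mono2 nonneg) auto
    also have "\<dots> \<le> L" using assms by (intro incseq_le) (auto simp: incseq_def zpart_mono)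
    finally show ?thesis .
  qed
  have "?f summable_on ?A"
    by (rule nonneg_bounded_partial_sums_imp_summable_on[where C = L], rule nonneg,
        rule eventually_finite_subsets_at_top_weakI, rule bd)
  then have "(?f has_sum infsum ?f ?A) ?A" by simp
  then have "(\<lambda>N. sum ?f (zchains_upto N (length k))) \<longlonglongrightarrow> infsum ?f ?A"
    unfolding has_sum_def using lim by (rule filterlim_compose)
  with assms have "L = infsum ?f ?A" unfolding zpart_eq_sum by (rule LIMSEQ_unique)
  then show ?thesis by (simp add: mzv_def zchains_def)
qed

lemma ev_harmonic_Nil1 [simp]: "ev F (harmonic_prod [] l) = F l"
  by (subst harmonic_prod.simps) simp

lemma ev_harmonic_Nil2 [simp]: "ev F (harmonic_prod k []) = F k"
  by (subst harmonic_prod.simps) simp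

lemma ev_harmonic_snoc:
  "ev F (harmonic_prod (k @ [a]) (l @ [b])) = ev (\<lambda>w. F (w @ [a])) (harmonic_prod k (l @ [b]))
    + ev (\<lambda>w. F (w @ [a + b])) (harmonic_prod k l) + ev (\<lambda>w. F (w @ [b])) (harmonic_prod (k @ [a]) l)"
  by (subst harmonic_prod.simps) (simp add: ev_lin_ext)

lemma ev_sum_fun: "ev (\<lambda>w. \<Sum>i\<in>I. F i w) f = (\<Sum>i\<in>I. ev (F i) f)"
  unfolding ev_def sum_distrib_left by (rule sum.swap)

text \<open>Both sides have the same increment from N to N + 1: the increment of a product of two
  sums has three terms, and these are the three terms of the harmonic recursion.\<close>

lemma zpart_mult: "ev (zpart N) (harmonic_prod k l) = zpart N k * zpart N l"
proof (induction "length k + length l" arbitrary: k l N rule: less_induct)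
  case less
  show ?case
  proof (cases k rule: rev_cases)
    case Nil
    then show ?thesis by simp
  next
    case k: (snoc k' a)
    show ?thesis
    proof (cases l rule: rev_cases)
      case Nil
      then show ?thesis by simp
    next
      case l: (snoc l' b)
      have step: "ev (\<lambda>w. zpart N (w @ [c])) (harmonic_prod p q) = (\<Sum>m=1..N. zpart (m - 1) p * zpart (m - 1) q / real m ^ c)"
        if "length p + length q < length k + length l" for p q c
      proof -
        have "ev (\<lambda>w. zpart N (w @ [c])) (harmonic_prod p q) =
           (\<Sum>m=1..N. ev (\<lambda>w. (1 / real m ^ c) * zpart (m - 1) w) (harmonic_prod p q))"
          unfolding zpart_snoc ev_sum_fun by simp
        also have "\<dots> = (\<Sum>m=1..N. zpart (m - 1) p * zpart (m - 1) q / real m ^ c)"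
          unfolding ev_scale using less[OF that] by simp
        finally show ?thesis .
      qed
      have "ev (zpart N) (harmonic_prod k l) =
         (\<Sum>m=1..N. zpart (m - 1) k' * zpart (m - 1) (l' @ [b]) / real m ^ a) +
         (\<Sum>m=1..N. zpart (m - 1) k' * zpart (m - 1) l' / real m ^ (a + b)) +
         (\<Sum>m=1..N. zpart (m - 1) (k' @ [a]) * zpart (m - 1) l' / real m ^ b)"
        unfolding k l ev_harmonic_snoc by (subst (1 2 3) step) (auto simp: k l)
      also have "\<dots> = zpart N (k' @ [a]) * zpart N (l' @ [b])"
      proof (induction N)
        case (Suc N)
        then show ?case by (simp add: zpart_Suc power_add algebra_simps)
      qed (simp add: zpart_0)
      finally show ?thesis by (simp add: k l)
    qed
  qed
qed

section \<open>Reduction of trailing letters\<close>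

definition trail :: "'a \<Rightarrow> 'a list \<Rightarrow> nat" where
  "trail a w = length (takeWhile ((=) a) (rev w))"

lemma trail_Nil [simp]: "trail a [] = 0"
  and trail_snoc: "trail a (w @ [b]) = (if a = b then Suc (trail a w) else 0)"
  by (simp_all add: trail_def)

lemma is_index_append [simp]: "is_index (k @ l) \<longleftrightarrow> is_index k \<and> is_index l"
  by (auto simp: is_index_def)

lemma is_index_Nil [simp]: "is_index []"
  and is_index_Cons [simp]: "is_index (a # k) \<longleftrightarrow> 1 \<le> a \<and> is_index k"
  by (auto simp: is_index_def)

lemma admissible_iff_trail: "admissible k \<longleftrightarrow> is_index k \<and> trail 1 k = 0"
  by (cases k rule: rev_cases) (auto simp: admissible_def trail_snoc)

text \<open>A new 1 can enter the block of trailing ones in \<open>Suc (trail 1 k)\<close> places,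
  each giving \<open>k @ [1]\<close>; every other term has no more trailing ones than k. The list L
  does not depend on F.\<close>

lemma harmonic_one:
  assumes "is_index k"
  shows "\<exists>L. (\<forall>w\<in>set L. is_index w \<and> trail 1 w \<le> trail 1 k) \<and>
     (\<forall>F. ev F (harmonic_prod k [1]) = real (Suc (trail 1 k)) * F (k @ [1]) + (\<Sum>w\<leftarrow>L. F w))"
  using assms
proof (induction k rule: rev_induct)
  case Nil
  show ?case by (intro exI[of _ "[]"]) simp
next
  case (snoc a k)
  then obtain L where L: "\<forall>w\<in>set L. is_index w \<and> trail 1 w \<le> trail 1 k"
    "\<And>F. ev F (harmonic_prod k [1]) = real (Suc (trail 1 k)) * F (k @ [1]) + (\<Sum>w\<leftarrow>L. F w)"
    by auto
  have e: "ev F (harmonic_prod (k @ [a]) [1]) = real (Suc (trail 1 k)) * F (k @ [1, a]) + (\<Sum>w\<leftarrow>L. F (w @ [a]))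
      + F (k @ [a + 1]) + F (k @ [a, 1])" for F
    using ev_harmonic_snoc[of F k a "[]" 1] L(2)[of "\<lambda>w. F (w @ [a])"] by simp
  show ?case
  proof (cases "a = 1")
    case True
    let ?L = "map (\<lambda>w. w @ [1]) L @ [k @ [2]]"
    have "\<forall>w\<in>set ?L. is_index w \<and> trail 1 w \<le> trail 1 (k @ [a])"
      using True L(1) snoc.prems by (auto simp: trail_snoc)
    moreover have "ev F (harmonic_prod (k @ [a]) [1]) =
       real (Suc (trail 1 (k @ [a]))) * F ((k @ [a]) @ [1]) + (\<Sum>w\<leftarrow>?L. F w)" for F
      using True e[of F] by (simp add: trail_snoc o_def algebra_simps numeral_2_eq_2)
    ultimately show ?thesis by blast
  next
    case False
    let ?L = "map (\<lambda>w. w @ [a]) L @ [k @ [a + 1]] @ replicate (Suc (trail 1 k)) (k @ [1, a])"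
    have t: "trail 1 (k @ [1, a]) = 0" using False trail_snoc[of 1 "k @ [1]" a] by simp
    have "\<forall>w\<in>set ?L. is_index w \<and> trail 1 w \<le> trail 1 (k @ [a])"
      using False L(1) snoc.prems t by (auto simp: trail_snoc simp del: replicate_Suc)
    moreover have "ev F (harmonic_prod (k @ [a]) [1]) =
       real (Suc (trail 1 (k @ [a]))) * F ((k @ [a]) @ [1]) + (\<Sum>w\<leftarrow>?L. F w)" for F
      using False e[of F] by (simp add: trail_snoc o_def algebra_simps sum_list_replicate)
    ultimately show ?thesis by blast
  qed
qed

text \<open>Indices are reduced to admissible ones: in the product with (1) all terms but
  \<open>k @ [1]\<close> have fewer trailing ones than it, and its own coefficient is not 0.\<close>

lemma index_trail_induct [consumes 1, case_names admissible trailing]: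
  assumes "is_index k"
    and "\<And>k. admissible k \<Longrightarrow> P k"
    and "\<And>k L. is_index k \<Longrightarrow> P k \<Longrightarrow> (\<And>w. w \<in> set L \<Longrightarrow> is_index w \<and> P w) \<Longrightarrow>
      (\<And>F. ev F (harmonic_prod k [1]) = real (Suc (trail 1 k)) * F (k @ [1]) + (\<Sum>w\<leftarrow>L. F w)) \<Longrightarrow> P (k @ [1])"
  shows "P k"
  using assms(1)
proof (induction "trail 1 k" arbitrary: k rule: less_induct)
  case less
  show ?case
  proof (cases "trail 1 k = 0")
    case True
    with less.prems show ?thesis by (intro assms(2)) (simp add: admissible_iff_trail)
  next
    case False
    then obtain k' where k': "k = k' @ [1]"
      by (cases k rule: rev_cases) (auto simp: trail_snoc split: if_splits)
    with less.prems have "is_index k'" by simp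
    from harmonic_one[OF this] obtain L where L: "\<forall>w\<in>set L. is_index w \<and> trail 1 w \<le> trail 1 k'"
      "\<And>F. ev F (harmonic_prod k' [1]) = real (Suc (trail 1 k')) * F (k' @ [1]) + (\<Sum>w\<leftarrow>L. F w)"
      by blast
    show ?thesis unfolding k'
      by (rule assms(3)[OF \<open>is_index k'\<close> _ _ L(2)]) (use L(1) less.hyps k' \<open>is_index k'\<close> in \<open>auto simp: trail_snoc less_Suc_eq_le\<close>)
  qed
qed

text \<open>Shuffle counterpart of \<open>harmonic_one\<close>. First letters are tracked as well,
  so that words starting with y are reduced to such words.\<close>

lemma sh_one:
  fixes u :: "'a list"
  shows "\<exists>L. (\<forall>w\<in>set L. trail a w \<le> trail a u \<and> w \<noteq> [] \<and> (hd w = a \<or> u \<noteq> [] \<and> hd w = hd u)) \<and>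
     (\<forall>F::'a list \<Rightarrow> real. sh F u [a] = real (Suc (trail a u)) * F (u @ [a]) + (\<Sum>w\<leftarrow>L. F w))"
proof (induction u rule: rev_induct)
  case Nil
  show ?case by (intro exI[of _ "[]"]) simp
next
  case (snoc b u)
  then obtain L where L: "\<forall>w\<in>set L. trail a w \<le> trail a u \<and> w \<noteq> [] \<and> (hd w = a \<or> u \<noteq> [] \<and> hd w = hd u)"
    "\<And>F::'a list \<Rightarrow> real. sh F u [a] = real (Suc (trail a u)) * F (u @ [a]) + (\<Sum>w\<leftarrow>L. F w)"
    by auto
  have e: "sh F (u @ [b]) [a] = real (Suc (trail a u)) * F (u @ [a, b]) + (\<Sum>w\<leftarrow>L. F (w @ [b]))
      + F (u @ [b, a])" for F :: "'a list \<Rightarrow> real"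
    using sh_snoc[of F u b "[]" a] L(2)[of "\<lambda>w. F (w @ [b])"] by simp
  show ?case
  proof (cases "a = b")
    case True
    let ?L = "map (\<lambda>w. w @ [a]) L"
    have "\<forall>w\<in>set ?L. trail a w \<le> trail a (u @ [b]) \<and> w \<noteq> [] \<and> (hd w = a \<or> u @ [b] \<noteq> [] \<and> hd w = hd (u @ [b]))"
      using True L(1) by (auto simp: trail_snoc hd_append)
    moreover have "sh F (u @ [b]) [a] = real (Suc (trail a (u @ [b]))) * F ((u @ [b]) @ [a]) + (\<Sum>w\<leftarrow>?L. F w)"
      for F :: "'a list \<Rightarrow> real"
      using True e[of F] by (simp add: trail_snoc o_def algebra_simps)
    ultimately show ?thesis by blast
  next
    case False
    let ?L = "map (\<lambda>w. w @ [b]) L @ replicate (Suc (trail a u)) (u @ [a, b])"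
    have t: "trail a (u @ [a, b]) = 0" using False trail_snoc[of a "u @ [a]" b] by simp
    have "\<forall>w\<in>set ?L. trail a w \<le> trail a (u @ [b]) \<and> w \<noteq> [] \<and> (hd w = a \<or> u @ [b] \<noteq> [] \<and> hd w = hd (u @ [b]))"
      using False L(1) t by (auto simp: trail_snoc hd_append simp del: replicate_Suc)
    moreover have "sh F (u @ [b]) [a] = real (Suc (trail a (u @ [b]))) * F ((u @ [b]) @ [a]) + (\<Sum>w\<leftarrow>?L. F w)"
      for F :: "'a list \<Rightarrow> real"
      using False by (simp add: e trail_snoc o_def algebra_simps sum_list_replicate)
    ultimately show ?thesis by blast
  qed
qed

lemma word_trail_induct [case_names convergent trailing]:
  assumes "\<And>u. trail a u = 0 \<Longrightarrow> P u"
    and "\<And>u L. P u \<Longrightarrow> (\<And>w. w \<in> set L \<Longrightarrow> P w \<and> w \<noteq> [] \<and> (hd w = a \<or> u \<noteq> [] \<and> hd w = hd u)) \<Longrightarrow>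
      (\<And>F::_ \<Rightarrow> real. sh F u [a] = real (Suc (trail a u)) * F (u @ [a]) + (\<Sum>w\<leftarrow>L. F w)) \<Longrightarrow> P (u @ [a])"
  shows "P u"
proof (induction "trail a u" arbitrary: u rule: less_induct)
  case less
  show ?case
  proof (cases "trail a u = 0")
    case False
    then obtain u' where u': "u = u' @ [a]"
      by (cases u rule: rev_cases) (auto simp: trail_snoc split: if_splits)
    from sh_one[of a u'] obtain L where L: "\<forall>w\<in>set L. trail a w \<le> trail a u' \<and> w \<noteq> [] \<and> (hd w = a \<or> u' \<noteq> [] \<and> hd w = hd u')"
      "\<And>F::_ \<Rightarrow> real. sh F u' [a] = real (Suc (trail a u')) * F (u' @ [a]) + (\<Sum>w\<leftarrow>L. F w)"
      by blast
    show ?thesis unfolding u'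
      by (rule assms(2)[OF _ _ L(2)]) (use L(1) less.hyps u' in \<open>auto simp: trail_snoc less_Suc_eq_le\<close>)
  qed (rule assms(1))
qed

section \<open>Error estimates for partial sums and Abel means\<close>

lemma harm_le: "n \<ge> 1 \<Longrightarrow> harm n \<le> 1 + ln (real n)"
  using decseqD[OF decseq_harm_diff_ln, of 0 "n - 1"] by (simp add: harm_expand)

lemma harm_power_bound:
  "\<exists>C\<ge>0. \<forall>n\<ge>1. harm n ^ k \<le> C * real n powr (1/4)"
proof -
  have "(\<lambda>n. (1 + ln (real n)) ^ k * real n powr (- (1/4))) \<longlonglongrightarrow> 0" by real_asymp
  then have "Bseq (\<lambda>n. (1 + ln (real n)) ^ k * real n powr (- (1/4)))"
    by (intro convergent_imp_Bseq convergentI)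
  then obtain C where C: "\<And>n. \<bar>(1 + ln (real n)) ^ k * real n powr (- (1/4))\<bar> \<le> C" "C > 0"
    unfolding Bseq_def by auto
  have "harm n ^ k \<le> C * real n powr (1/4)" if "n \<ge> 1" for n
  proof -
    have "harm n ^ k \<le> (1 + ln (real n)) ^ k"
      using that by (intro power_mono harm_le harm_nonneg)
    also have "\<dots> = (1 + ln (real n)) ^ k * real n powr (- (1/4)) * real n powr (1/4)"
      using that by (simp add: powr_minus)
    also have "\<dots> \<le> C * real n powr (1/4)"
      using C(1)[of n] by (intro mult_right_mono) auto
    finally show ?thesis .
  qed
  with C(2) show ?thesis by (intro exI[of _ C]) auto
qed

text \<open>One factor n^(1/4) absorbs the power of \<open>harm n\<close>, the other is the weight;
  against n^2 the exponent -3/2 remains. The weight later turns convergence into a rate.\<close>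

lemma summable_harm_bound:
  assumes "\<And>n. n \<ge> 1 \<Longrightarrow> \<bar>c n\<bar> \<le> C * harm n ^ k / real n ^ 2"
  shows "summable (\<lambda>n. \<bar>c n\<bar> * real n powr (1/4))"
proof -
  obtain D where D: "D \<ge> 0" "\<And>n. n \<ge> 1 \<Longrightarrow> harm n ^ k \<le> D * real n powr (1/4)"
    using harm_power_bound by blast
  have "summable (\<lambda>n. \<bar>C\<bar> * D * real n powr (- (3/2)))"
    by (intro summable_mult) (simp add: summable_real_powr_iff)
  moreover have "norm (\<bar>c n\<bar> * real n powr (1/4)) \<le> \<bar>C\<bar> * D * real n powr (- (3/2))" if "n \<ge> 1" for n
  proof -
    have "\<bar>c n\<bar> \<le> C * harm n ^ k / real n ^ 2" by (rule assms) fact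
    also have "\<dots> \<le> \<bar>C\<bar> * (D * real n powr (1/4)) / real n ^ 2"
      by (intro divide_right_mono mult_mono D(2) that) (auto simp: harm_nonneg)
    finally have "\<bar>c n\<bar> * real n powr (1/4) \<le> \<bar>C\<bar> * (D * real n powr (1/4)) / real n ^ 2 * real n powr (1/4)"
      by (rule mult_right_mono) auto
    also have "\<dots> = \<bar>C\<bar> * D * real n powr (- (3/2))"
    proof -
      have "real n powr (- (3/2)) = real n powr (1/4) * real n powr (1/4) / real n powr 2"
        by (simp only: powr_add[symmetric] powr_diff[symmetric]) simp
      also have "real n powr 2 = real n ^ 2" using that by (simp add: powr_numeral)
      finally show ?thesis by simp
    qed
    finally show ?thesis by simp
  qed
  then have "\<exists>N. \<forall>n\<ge>N. norm (\<bar>c n\<bar> * real n powr (1/4)) \<le> \<bar>C\<bar> * D * real n powr (- (3/2))"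
    by blast
  ultimately show ?thesis by (rule summable_comparison_test[rotated])
qed

lemma summable_abs_powr:
  fixes c :: "nat \<Rightarrow> real"
  assumes "summable (\<lambda>n. \<bar>c n\<bar> * real n powr (1/4))"
  shows "summable (\<lambda>n. \<bar>c n\<bar>)"
proof (rule summable_comparison_test[OF _ assms], intro exI allI impI)
  fix n :: nat assume "1 \<le> n"
  then have "real n powr (1/4) \<ge> 1" by (intro ge_one_powr_ge_zero) auto
  then show "norm \<bar>c n\<bar> \<le> \<bar>c n\<bar> * real n powr (1/4)"
    using mult_left_mono[of 1 "real n powr (1/4)" "\<bar>c n\<bar>"] by simp
qed

text \<open>Beyond N the weight is at least N^(1/4), so the tail is of order N^(-1/4), which beats
  every power of \<open>harm N\<close>.\<close>

lemma partial_sums_tail_bound: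
  fixes c :: "nat \<Rightarrow> real"
  assumes "summable (\<lambda>n. \<bar>c n\<bar> * real n powr (1/4))" "N \<ge> 1"
  shows "\<bar>(\<Sum>n\<le>N. c n) - suminf c\<bar> \<le> real N powr (- (1/4)) * suminf (\<lambda>n. \<bar>c n\<bar> * real n powr (1/4))"
proof -
  have sc: "summable (\<lambda>n. \<bar>c n\<bar>)" by (rule summable_abs_powr) fact
  have 1: "summable (\<lambda>n. \<bar>c (n + Suc N)\<bar>)" using sc by (rule summable_ignore_initial_segment)
  have 2: "summable (\<lambda>n. \<bar>c (n + Suc N)\<bar> * real (n + Suc N) powr (1/4))"
    using assms(1) by (rule summable_ignore_initial_segment)
  have "suminf c = (suminf (\<lambda>n. c (n + Suc N))) + (\<Sum>n<Suc N. c n)"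
    using summable_rabs_cancel[OF sc] by (rule suminf_split_initial_segment)
  then have "\<bar>(\<Sum>n\<le>N. c n) - suminf c\<bar> = \<bar>suminf (\<lambda>n. c (n + Suc N))\<bar>"
    by (simp add: lessThan_Suc_atMost)
  also have "\<dots> \<le> (suminf (\<lambda>n. \<bar>c (n + Suc N)\<bar>))" by (rule summable_rabs) fact
  also have "\<dots> \<le> (suminf (\<lambda>n. real N powr (- (1/4)) * (\<bar>c (n + Suc N)\<bar> * real (n + Suc N) powr (1/4))))"
  proof (intro suminf_le 1 summable_mult 2)
    fix n
    have "real N powr (- (1/4)) * real (n + Suc N) powr (1/4) \<ge> real N powr (- (1/4)) * real N powr (1/4)"
      by (intro mult_left_mono powr_mono2) auto
    also have "real N powr (- (1/4)) * real N powr (1/4) = 1"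
      using assms(2) by (simp add: powr_add[symmetric])
    finally have "\<bar>c (n + Suc N)\<bar> * 1 \<le> \<bar>c (n + Suc N)\<bar> * (real N powr (- (1/4)) * real (n + Suc N) powr (1/4))"
      by (rule mult_left_mono) simp
    then show "\<bar>c (n + Suc N)\<bar> \<le> real N powr (- (1/4)) * (\<bar>c (n + Suc N)\<bar> * real (n + Suc N) powr (1/4))"
      unfolding mult_1_right mult.left_commute[of "\<bar>c (n + Suc N)\<bar>" "real N powr (- (1/4))"] .
  qed
  also have "\<dots> = real N powr (- (1/4)) * (suminf (\<lambda>n. \<bar>c (n + Suc N)\<bar> * real (n + Suc N) powr (1/4)))"
    by (rule suminf_mult) fact
  also have "(suminf (\<lambda>n. \<bar>c (n + Suc N)\<bar> * real (n + Suc N) powr (1/4))) \<le> suminf (\<lambda>n. \<bar>c n\<bar> * real n powr (1/4))"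
    unfolding suminf_split_initial_segment[OF assms(1), of "Suc N"] by (simp add: sum_nonneg)
  finally show "\<bar>(\<Sum>n\<le>N. c n) - suminf c\<bar> \<le> real N powr (- (1/4)) * suminf (\<lambda>n. \<bar>c n\<bar> * real n powr (1/4))"
    by (simp add: mult_left_mono)
qed

lemma negl_harm_partial_sums:
  assumes "summable (\<lambda>n. \<bar>c n\<bar> * real n powr (1/4))"
  shows "negl sequentially harm (\<lambda>N. (\<Sum>n\<le>N. c n) - suminf c)"
  unfolding negl_def
proof
  fix j
  let ?S = "suminf (\<lambda>n. \<bar>c n\<bar> * real n powr (1/4))"
  have "((\<lambda>N. ?S * ((1 + ln (real N)) ^ j * real N powr (- (1/4)))) \<longlongrightarrow> ?S * 0) sequentially"
    by (intro tendsto_mult tendsto_const) real_asymp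
  then show "((\<lambda>N. ((\<Sum>n\<le>N. c n) - suminf c) * harm N ^ j) \<longlongrightarrow> 0) sequentially"
    unfolding mult_zero_right
  proof (rule Lim_null_comparison[rotated], intro eventually_sequentiallyI[of 1])
    fix N :: nat assume N: "1 \<le> N"
    have "\<bar>(\<Sum>n\<le>N. c n) - suminf c\<bar> \<le> real N powr (- (1/4)) * ?S"
      by (rule partial_sums_tail_bound[OF assms N])
    then have "\<bar>(\<Sum>n\<le>N. c n) - suminf c\<bar> * harm N ^ j \<le> (real N powr (- (1/4)) * ?S) * (1 + ln (real N)) ^ j"
      using N by (intro mult_mono power_mono harm_le) (auto simp: harm_nonneg intro!: mult_nonneg_nonneg suminf_nonneg assms)
    then show "norm (((\<Sum>n\<le>N. c n) - suminf c) * harm N ^ j) \<le> ?S * ((1 + ln (real N)) ^ j * real N powr (- (1/4)))"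
      by (simp add: abs_mult power_abs mult_ac)
  qed
qed

text \<open>Bernoulli's inequality bounds the left side by x = n (1 - s), trivially it is at most 1,
  and the minimum of x and 1 is at most x^(1/4).\<close>

lemma one_minus_power_le:
  fixes s :: real
  assumes "0 < s" "s < 1"
  shows "1 - s ^ n \<le> real n powr (1/4) * (1 - s) powr (1/4)"
proof (cases "n = 0")
  case False
  let ?x = "real n * (1 - s)"
  have "1 + real n * (- (1 - s)) \<le> (1 + - (1 - s)) ^ n"
    using assms by (intro Bernoulli_inequality) auto
  then have 1: "1 - s ^ n \<le> ?x" by (simp add: algebra_simps)
  have x: "?x > 0" using assms False by simp
  have "1 - s ^ n \<le> ?x powr (1/4)"
  proof (cases "?x \<le> 1")
    case True
    then have "?x powr 1 \<le> ?x powr (1/4)" using x by (intro powr_mono') auto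
    with 1 x show ?thesis by simp
  next
    case False
    then have "1 \<le> ?x powr (1/4)" by (intro ge_one_powr_ge_zero) auto
    moreover have "s ^ n \<ge> 0" using assms by simp
    ultimately show ?thesis by linarith
  qed
  then show ?thesis using assms by (simp add: powr_mult)
qed auto

text \<open>Abel means in place of partial sums: the same weight n^(1/4) now yields the rate (1 -
  s)^(1/4), which beats every power of the logarithm.\<close>

lemma negl_ln_power_series:
  assumes "summable (\<lambda>n. \<bar>c n\<bar> * real n powr (1/4))"
  shows "negl (at_left 1) (\<lambda>s. - ln (1 - s)) (\<lambda>s. (suminf (\<lambda>n. c n * s ^ n)) - suminf c)"
  unfolding negl_def
proof
  fix j
  let ?S = "suminf (\<lambda>n. \<bar>c n\<bar> * real n powr (1/4))"
  have sc: "summable (\<lambda>n. \<bar>c n\<bar>)" by (rule summable_abs_powr) fact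
  have "((\<lambda>s. ?S * ((1 - s) powr (1/4) * (- ln (1 - s)) ^ j)) \<longlongrightarrow> ?S * 0) (at_left (1::real))"
    by (intro tendsto_mult tendsto_const) real_asymp
  then have lim: "((\<lambda>s. ?S * ((1 - s) powr (1/4) * (- ln (1 - s)) ^ j)) \<longlongrightarrow> 0) (at_left (1::real))"
    unfolding mult_zero_right .
  have "\<forall>\<^sub>F s in at_left (1::real). s \<in> {0<..<1}"
    by (rule eventually_at_leftI[of 0]) auto
  then have "\<forall>\<^sub>F s in at_left (1::real). norm (((suminf (\<lambda>n. c n * s ^ n)) - suminf c) * (- ln (1 - s)) ^ j) \<le>
     ?S * ((1 - s) powr (1/4) * (- ln (1 - s)) ^ j)"
  proof eventually_elim
    case (elim s)
    then have s: "0 < s" "s < 1" by auto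
    have 3: "summable (\<lambda>n. \<bar>c n * s ^ n\<bar>)"
    proof (rule summable_comparison_test[OF _ sc], intro exI allI impI)
      fix n
      have "s ^ n \<le> 1" "s ^ n \<ge> 0" using s by (auto intro: power_le_one)
      then show "norm \<bar>c n * s ^ n\<bar> \<le> \<bar>c n\<bar>" by (simp add: abs_mult mult_left_le)
    qed
    have b: "\<bar>c n * s ^ n - c n\<bar> \<le> (1 - s) powr (1/4) * (\<bar>c n\<bar> * real n powr (1/4))" for n
    proof -
      have "\<bar>c n * s ^ n - c n\<bar> = \<bar>c n\<bar> * \<bar>s ^ n - 1\<bar>"
        by (simp add: abs_mult[symmetric] algebra_simps)
      also have "\<bar>s ^ n - 1\<bar> = 1 - s ^ n" using s by (simp add: power_le_one)
      also have "\<bar>c n\<bar> * (1 - s ^ n) \<le> \<bar>c n\<bar> * (real n powr (1/4) * (1 - s) powr (1/4))"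
        using one_minus_power_le[OF s, of n] by (intro mult_left_mono) auto
      finally show ?thesis by (simp add: mult_ac)
    qed
    have 4: "summable (\<lambda>n. (1 - s) powr (1/4) * (\<bar>c n\<bar> * real n powr (1/4)))"
      using assms by (rule summable_mult)
    have 5: "summable (\<lambda>n. \<bar>c n * s ^ n - c n\<bar>)"
      by (rule summable_comparison_test[OF _ 4], intro exI allI impI) (use b in simp)
    have "(suminf (\<lambda>n. c n * s ^ n)) - suminf c = (suminf (\<lambda>n. c n * s ^ n - c n))"
      using summable_rabs_cancel[OF 3] summable_rabs_cancel[OF sc] by (rule suminf_diff)
    then have "\<bar>(suminf (\<lambda>n. c n * s ^ n)) - suminf c\<bar> \<le> (suminf (\<lambda>n. \<bar>c n * s ^ n - c n\<bar>))"
      using summable_rabs[OF 5] by simp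
    also have "\<dots> \<le> (suminf (\<lambda>n. (1 - s) powr (1/4) * (\<bar>c n\<bar> * real n powr (1/4))))"
      by (intro suminf_le 4 5 b)
    also have "\<dots> = (1 - s) powr (1/4) * ?S" by (rule suminf_mult) fact
    finally have "\<bar>(suminf (\<lambda>n. c n * s ^ n)) - suminf c\<bar> * (- ln (1 - s)) ^ j \<le> (1 - s) powr (1/4) * ?S * (- ln (1 - s)) ^ j"
      using s by (intro mult_right_mono) auto
    moreover have "\<bar>- ln (1 - s)\<bar> = - ln (1 - s)" using s by simp
    ultimately show ?case unfolding real_norm_def abs_mult power_abs by (simp only: mult_ac)
  qed
  from Lim_null_comparison[OF this lim]
  show "((\<lambda>s. ((suminf (\<lambda>n. c n * s ^ n)) - suminf c) * (- ln (1 - s)) ^ j) \<longlongrightarrow> 0) (at_left 1)" .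
qed

section \<open>Polylogarithms\<close>

lemma sh_zero [simp]: "sh (\<lambda>w. 0) u v = 0"
proof -
  have "sh (\<lambda>w. 0 * 0) u v = 0 * sh (\<lambda>w. 0) u v" by (rule sh_scale)
  then show ?thesis unfolding mult_zero_left .
qed

lemma sh_hom_on:
  assumes "\<And>w. Q (f w)" "\<And>x y. Q x \<Longrightarrow> Q y \<Longrightarrow> Q (x + y) \<and> h (x + y) = h x + h y"
  shows "Q (sh f u v) \<and> h (sh f u v) = sh (\<lambda>w. h (f w)) u v"
  using assms(1)
proof (induction f u v rule: sh.induct)
  case (3 f a u b v)
  from "3.IH"(1)[OF "3.prems"] "3.IH"(2)[OF "3.prems"] show ?case by (simp add: assms(2))
qed auto

lemma sh_hom:
  assumes "\<And>x y. h (x + y) = h x + h y"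
  shows "h (sh f u v) = sh (\<lambda>w. h (f w)) u v"
  using sh_hom_on[of "\<lambda>_. True" f h] assms by simp

definition if_hd :: "'a \<Rightarrow> ('a list \<Rightarrow> 'r::comm_ring_1) \<Rightarrow> 'a list \<Rightarrow> 'r" where
  "if_hd a f w = (if w \<noteq> [] \<and> hd w = a then f (tl w) else 0)"

definition if_last :: "'a \<Rightarrow> ('a list \<Rightarrow> 'r::comm_ring_1) \<Rightarrow> 'a list \<Rightarrow> 'r" where
  "if_last a f w = (if w \<noteq> [] \<and> last w = a then f (butlast w) else 0)"

text \<open>The first letter of a shuffled word is the first letter of u or of v, hence stripping a
  prescribed first letter is a derivation.\<close>

lemma sh_if_hd:
  assumes "u \<noteq> []" "v \<noteq> []"
  shows "sh (if_hd a f) u v = if_hd a (\<lambda>x. sh f x v) u + if_hd a (sh f u) v"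
proof -
  obtain c u' where u: "u = c # u'" using assms(1) by (cases u) auto
  obtain d v' where v: "v = d # v'" using assms(2) by (cases v) auto
  have "sh (\<lambda>w. if_hd a f (b # w)) p q = (if b = a then sh f p q else 0)" for b p q
    by (simp add: if_hd_def)
  then show ?thesis by (simp add: u v) (simp add: if_hd_def)
qed

lemma sh_if_last:
  assumes "u \<noteq> []" "v \<noteq> []"
  shows "sh (if_last a f) u v = if_last a (\<lambda>x. sh f x v) u + if_last a (sh f u) v"
proof -
  obtain c u' where u: "u = u' @ [c]" using assms(1) by (cases u rule: rev_cases) auto
  obtain d v' where v: "v = v' @ [d]" using assms(2) by (cases v rule: rev_cases) auto
  have "sh (\<lambda>w. if_last a f (w @ [b])) p q = (if b = a then sh f p q else 0)" for b p q
    by (simp add: if_last_def)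
  then show ?thesis by (simp add: u v sh_snoc) (simp add: if_last_def)
qed

text \<open>The polylogarithm of a word \<open>u\<close> is a polynomial in \<open>log\<close> over power series, and
  \<open>li_fps u\<close> is its part without \<open>log\<close>. Leading letters \<open>X\<close> only contribute logarithms, which is
  the reason for the term with \<open>tl u\<close>.\<close>

function li_fps :: "letter list \<Rightarrow> real fps" where
  "li_fps u = (if u = [] then 1 else Abs_fps (\<lambda>n. if n = 0 then 0 else
     ((if last u = X then fps_nth (li_fps (butlast u)) n else (\<Sum>m<n. fps_nth (li_fps (butlast u)) m))
      - (if hd u = X then fps_nth (li_fps (tl u)) n else 0)) / real n))"
  by auto
termination by (relation "Wellfounded.measure length") auto

declare li_fps.simps [simp del]

lemma li_fps_Nil [simp]: "li_fps [] = 1"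
  by (simp add: li_fps.simps)

lemma li_fps_0: "u \<noteq> [] \<Longrightarrow> fps_nth (li_fps u) 0 = 0"
  by (subst li_fps.simps) simp

lemma li_fps_nth:
  "u \<noteq> [] \<Longrightarrow> n > 0 \<Longrightarrow> fps_nth (li_fps u) n =
     ((if last u = X then fps_nth (li_fps (butlast u)) n else (\<Sum>m<n. fps_nth (li_fps (butlast u)) m))
      - (if hd u = X then fps_nth (li_fps (tl u)) n else 0)) / real n"
  by (subst li_fps.simps) simp

text \<open>The operator s d/ds, under which the forms ds/s and ds/(1-s) become the factors 1 and
  \<open>geo_fps\<close>.\<close>

definition euler_op :: "real fps \<Rightarrow> real fps" where
  "euler_op f = fps_X * fps_deriv f"

lemma euler_op_nth: "fps_nth (euler_op f) n = real n * fps_nth f n"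
  by (cases n) (simp_all add: euler_op_def)

lemma euler_op_add: "euler_op (f + g) = euler_op f + euler_op g"
  by (simp add: euler_op_def distrib_left)

lemma euler_op_mult: "euler_op (f * g) = euler_op f * g + f * euler_op g"
  by (simp add: euler_op_def algebra_simps)

lemma euler_op_cancel:
  assumes "euler_op f = euler_op g" "fps_nth f 0 = fps_nth g 0"
  shows "f = g"
proof (rule fps_ext)
  fix n
  have "real n * fps_nth f n = real n * fps_nth g n" using assms(1) by (metis euler_op_nth)
  then show "fps_nth f n = fps_nth g n" using assms(2) by (cases n) auto
qed

definition geo_fps :: "real fps" where
  "geo_fps = Abs_fps (\<lambda>n. if n = 0 then 0 else 1)"

lemma geo_fps_mult_nth: "fps_nth (geo_fps * f) n = (\<Sum>m<n. fps_nth f m)"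
proof -
  have "fps_nth (geo_fps * f) n = (\<Sum>i\<in>{0..n}. fps_nth f i * (if n - i = 0 then 0 else 1))"
    unfolding mult.commute[of geo_fps] fps_mult_nth by (simp add: geo_fps_def)
  also have "\<dots> = (\<Sum>m<n. fps_nth f m)"
    by (rule sum.mono_neutral_cong_right) auto
  finally show ?thesis .
qed

text \<open>The differential equation of polylogarithms: a last letter x integrates ds/s, a last
  letter y integrates ds/(1-s). The correction strips a leading x, since that is the effect of
  differentiating the powers of log s that were split off.\<close>

lemma euler_op_li_fps:
  assumes "u \<noteq> []"
  shows "euler_op (li_fps u) = if_last X li_fps u + geo_fps * if_last Y li_fps u - if_hd X li_fps u"
proof (rule fps_ext)
  fix n
  have l: "last u = Y" if "last u \<noteq> X" using that by (cases "last u") auto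
  show "fps_nth (euler_op (li_fps u)) n =
     fps_nth (if_last X li_fps u + geo_fps * if_last Y li_fps u - if_hd X li_fps u) n"
  proof (cases "n = 0")
    case False
    then show ?thesis using assms l
      by (auto simp: euler_op_nth li_fps_nth if_last_def if_hd_def geo_fps_mult_nth)
  next
    case True
    show ?thesis
    proof (cases "length u = 1")
      case True
      then obtain c where "u = [c]" by (auto simp: length_Suc_conv)
      then show ?thesis using \<open>n = 0\<close> by (cases c) (auto simp: euler_op_nth if_last_def if_hd_def geo_fps_mult_nth geo_fps_def)
    next
      case False
      then have "butlast u \<noteq> []" "tl u \<noteq> []" using assms by (cases u; auto)+
      then show ?thesis using \<open>n = 0\<close> assms
        by (auto simp: euler_op_nth if_last_def if_hd_def geo_fps_mult_nth li_fps_0)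
    qed
  qed
qed

text \<open>Both sides solve the same differential equation: \<open>euler_op\<close> and the
  stripping of a first or last letter are derivations, so induction on the total length applies.
  Nonempty words have constant term 0.\<close>

lemma sh_li_fps: "sh li_fps u v = li_fps u * li_fps v"
proof (induction "length u + length v" arbitrary: u v rule: less_induct)
  case less
  show ?case
  proof (cases "u = [] \<or> v = []")
    case True
    then show ?thesis by auto
  next
    case False
    then have ne: "u \<noteq> []" "v \<noteq> []" by auto
    have IH: "if_last a (\<lambda>x. sh li_fps x v) u = if_last a li_fps u * li_fps v"
      "if_last a (sh li_fps u) v = li_fps u * if_last a li_fps v"
      "if_hd a (\<lambda>x. sh li_fps x v) u = if_hd a li_fps u * li_fps v"
      "if_hd a (sh li_fps u) v = li_fps u * if_hd a li_fps v" for a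
      using ne less by (auto simp: if_last_def if_hd_def)
    show ?thesis
    proof (rule euler_op_cancel)
      have "euler_op (sh li_fps u v) = sh (\<lambda>w. euler_op (li_fps w)) u v"
        by (rule sh_hom) (rule euler_op_add)
      also have "\<dots> = sh (\<lambda>w. if_last X li_fps w + geo_fps * if_last Y li_fps w - if_hd X li_fps w) u v"
        using ne by (intro sh_length_cong euler_op_li_fps) auto
      also have "\<dots> = euler_op (li_fps u * li_fps v)"
        unfolding sh_diff sh_add sh_scale
        using ne by (simp add: sh_if_last sh_if_hd IH euler_op_mult euler_op_li_fps algebra_simps)
      finally show "euler_op (sh li_fps u v) = euler_op (li_fps u * li_fps v)" .
      have "fps_nth (sh li_fps u v) 0 = sh (\<lambda>w. fps_nth (li_fps w) 0) u v"
        by (rule sh_hom[of "\<lambda>f. fps_nth f 0"]) simp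
      also have "\<dots> = sh (\<lambda>w. 0) u v"
        using ne by (intro sh_length_cong li_fps_0) auto
      finally show "fps_nth (sh li_fps u v) 0 = fps_nth (li_fps u * li_fps v) 0"
        using ne by (simp add: li_fps_0)
    qed
  qed
qed

lemma harm_ge_1: "n \<ge> 1 \<Longrightarrow> (1::real) \<le> harm n"
  using harm_mono[of 1 n, where 'a = real] by (simp add: harm_expand)

text \<open>Each letter costs at most one factor \<open>harm n\<close>, through the sum over smaller
  m; a last letter x saves a further 1/n.\<close>

lemma li_fps_bound:
  "\<exists>C\<ge>0. \<forall>n\<ge>1. \<bar>fps_nth (li_fps u) n\<bar> \<le> C * harm n ^ length u / real n \<and>
     (u \<noteq> [] \<and> last u = X \<longrightarrow> \<bar>fps_nth (li_fps u) n\<bar> \<le> C * harm n ^ length u / real n ^ 2)"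
proof (induction "length u" arbitrary: u rule: less_induct)
  case less
  show ?case
  proof (cases "u = []")
    case True
    then show ?thesis by (intro exI[of _ 0]) auto
  next
    case False
    define k where "k = length u - 1"
    have k: "length (butlast u) = k" "length (tl u) = k" "length u = Suc k"
      using False by (auto simp: k_def)
    from less[of "butlast u"] k obtain C1 where C1: "C1 \<ge> 0"
      "\<And>n. n \<ge> 1 \<Longrightarrow> \<bar>fps_nth (li_fps (butlast u)) n\<bar> \<le> C1 * harm n ^ k / real n" by auto
    from less[of "tl u"] k obtain C2 where C2: "C2 \<ge> 0"
      "\<And>n. n \<ge> 1 \<Longrightarrow> \<bar>fps_nth (li_fps (tl u)) n\<bar> \<le> C2 * harm n ^ k / real n" by auto
    have c0: "\<bar>fps_nth (li_fps w) 0\<bar> \<le> 1" for w by (cases "w = []") (auto simp: li_fps_0)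
    \<comment> \<open>The 1 accounts for the constant coefficient in the sum over m < n, C1 and C2
      for the two shorter words.\<close>
    define C where "C = 1 + C1 + C2"
    have sum: "\<bar>\<Sum>m<n. fps_nth (li_fps (butlast u)) m\<bar> \<le> (1 + C1) * harm n ^ Suc k" if n: "n \<ge> 1" for n
    proof -
      have "\<bar>\<Sum>m<n. fps_nth (li_fps (butlast u)) m\<bar> \<le> (\<Sum>m<n. \<bar>fps_nth (li_fps (butlast u)) m\<bar>)"
        by (rule sum_abs)
      also have "(\<Sum>m<n. \<bar>fps_nth (li_fps (butlast u)) m\<bar>) =
         \<bar>fps_nth (li_fps (butlast u)) 0\<bar> + (\<Sum>m=1..<n. \<bar>fps_nth (li_fps (butlast u)) m\<bar>)"
      proof -
        have "{..<n} = insert 0 {1..<n}" using n by auto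
        then show ?thesis by simp
      qed
      also have "(\<Sum>m=1..<n. \<bar>fps_nth (li_fps (butlast u)) m\<bar>) \<le> (\<Sum>m=1..<n. C1 * harm n ^ k * inverse (real m))"
      proof (rule sum_mono)
        fix m assume m: "m \<in> {1..<n}"
        have "\<bar>fps_nth (li_fps (butlast u)) m\<bar> \<le> C1 * harm m ^ k / real m" using C1(2) m by simp
        also have "\<dots> \<le> C1 * harm n ^ k / real m"
          using C1(1) m by (intro divide_right_mono mult_left_mono power_mono harm_mono) (auto simp: harm_nonneg)
        finally show "\<bar>fps_nth (li_fps (butlast u)) m\<bar> \<le> C1 * harm n ^ k * inverse (real m)"
          by (simp add: divide_inverse)
      qed
      also have "\<dots> \<le> C1 * harm n ^ k * harm n"
      proof -
        have "(\<Sum>m=1..<n. inverse (real m)) \<le> harm n" unfolding harm_def by (intro sum_mono2) auto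
        then show ?thesis unfolding sum_distrib_left[symmetric]
          by (rule mult_left_mono) (simp add: C1(1) harm_nonneg)
      qed
      also have "\<bar>fps_nth (li_fps (butlast u)) 0\<bar> \<le> 1 * harm n ^ Suc k"
        using c0[of "butlast u"] one_le_power[OF harm_ge_1[OF n], of "Suc k"] by (simp only: mult_1)
      finally show ?thesis by (simp only: power_Suc2 distrib_right mult.assoc add.commute)
    qed
    have "\<bar>fps_nth (li_fps u) n\<bar> \<le> C * harm n ^ length u / real n \<and>
     (u \<noteq> [] \<and> last u = X \<longrightarrow> \<bar>fps_nth (li_fps u) n\<bar> \<le> C * harm n ^ length u / real n ^ 2)" if n: "n \<ge> 1" for n
    proof -
      let ?h = "harm n :: real"
      have h: "?h ^ k \<le> ?h ^ Suc k" using harm_ge_1[OF n] by (intro power_increasing) auto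
      have h0: "?h ^ k \<ge> 0" by (simp add: harm_nonneg)
      have t: "\<bar>if hd u = X then fps_nth (li_fps (tl u)) n else 0\<bar> \<le> C2 * ?h ^ Suc k / real n"
      proof -
        have "C2 * ?h ^ k / real n \<le> C2 * ?h ^ Suc k / real n"
          by (intro divide_right_mono mult_left_mono h C2(1)) simp
        moreover have "0 \<le> C2 * ?h ^ Suc k / real n"
          by (intro divide_nonneg_nonneg mult_nonneg_nonneg C2(1) zero_le_power harm_nonneg) simp
        ultimately show ?thesis using C2(2)[OF n] by (cases "hd u = X") (simp_all del: power_Suc)
      qed
      have t': "C2 * ?h ^ Suc k / real n \<le> C2 * ?h ^ Suc k"
      proof -
        have "0 \<le> C2 * ?h ^ Suc k"
          by (intro mult_nonneg_nonneg C2(1) zero_le_power harm_nonneg)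
        then have "C2 * ?h ^ Suc k / real n \<le> C2 * ?h ^ Suc k / 1"
          using n by (intro divide_left_mono) auto
        then show ?thesis by simp
      qed
      show ?thesis
      proof (cases "last u = X")
        case True
        have b: "\<bar>fps_nth (li_fps (butlast u)) n\<bar> \<le> C1 * ?h ^ Suc k / real n"
        proof -
          have "C1 * ?h ^ k / real n \<le> C1 * ?h ^ Suc k / real n"
            by (intro divide_right_mono mult_left_mono h C1(1)) simp
          with C1(2)[OF n] show ?thesis by linarith
        qed
        have "\<bar>fps_nth (li_fps u) n\<bar> = \<bar>fps_nth (li_fps (butlast u)) n - (if hd u = X then fps_nth (li_fps (tl u)) n else 0)\<bar> / real n"
          using False True n by (simp add: li_fps_nth)
        also have "\<dots> \<le> (C1 * ?h ^ Suc k / real n + C2 * ?h ^ Suc k / real n) / real n"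
          using b t by (intro divide_right_mono) linarith+
        also have "\<dots> \<le> (C * ?h ^ Suc k / real n) / real n"
        proof -
          have "0 \<le> ?h ^ Suc k" by (intro zero_le_power harm_nonneg)
          then have "C1 * ?h ^ Suc k + C2 * ?h ^ Suc k \<le> C * ?h ^ Suc k" by (simp only: C_def distrib_right)
          then show ?thesis unfolding add_divide_distrib[symmetric] by (intro divide_right_mono) auto
        qed
        finally have A: "\<bar>fps_nth (li_fps u) n\<bar> \<le> C * ?h ^ length u / real n ^ 2"
          by (simp add: k power2_eq_square)
        also have "\<dots> \<le> C * ?h ^ length u / real n"
        proof (rule divide_left_mono)
          show "real n \<le> real n ^ 2" using n by (simp add: power2_eq_square)
          show "0 \<le> C * ?h ^ length u"
            using C1(1) C2(1) by (intro mult_nonneg_nonneg zero_le_power harm_nonneg) (simp add: C_def)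
          show "0 < real n ^ 2 * real n" using n by simp
        qed
        finally show ?thesis using A by simp
      next
        case False
        have "\<bar>fps_nth (li_fps u) n\<bar> = \<bar>(\<Sum>m<n. fps_nth (li_fps (butlast u)) m) - (if hd u = X then fps_nth (li_fps (tl u)) n else 0)\<bar> / real n"
          using False \<open>u \<noteq> []\<close> n by (simp add: li_fps_nth)
        also have "\<dots> \<le> ((1 + C1) * ?h ^ Suc k + C2 * ?h ^ Suc k) / real n"
          using sum[OF n] t t' by (intro divide_right_mono) linarith+
        also have "\<dots> = C * ?h ^ length u / real n" by (simp add: C_def k algebra_simps)
        finally show ?thesis using False by simp
      qed
    qed
    moreover have "C \<ge> 0" using C1(1) C2(1) by (simp add: C_def)
    ultimately show ?thesis by blast
  qed
qed

lemma summable_li_fps_X: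
  assumes "trail Y u = 0"
  shows "summable (\<lambda>n. \<bar>fps_nth (li_fps u) n\<bar> * real n powr (1/4))"
proof (cases u rule: rev_cases)
  case Nil
  have "summable (\<lambda>n. if n = 0 then 0 else (0::real))" by (rule summable_finite[of "{}"]) auto
  moreover have "(\<lambda>n. \<bar>fps_nth (li_fps u) n\<bar> * real n powr (1/4)) = (\<lambda>n. if n = 0 then 0 else 0)"
    by (rule ext) (simp add: Nil)
  ultimately show ?thesis by simp
next
  case (snoc u' c)
  with assms have "last u = X" "u \<noteq> []" by (cases c; simp add: trail_snoc)+
  with li_fps_bound[of u] obtain C where
    "\<And>n. n \<ge> 1 \<Longrightarrow> \<bar>fps_nth (li_fps u) n\<bar> \<le> C * harm n ^ length u / real n ^ 2" by blast
  then show ?thesis by (rule summable_harm_bound)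
qed

lemma li_fps_bounded: "\<exists>C. \<forall>n. \<bar>fps_nth (li_fps u) n\<bar> \<le> C"
proof -
  obtain C where C: "C \<ge> 0" "\<And>n. n \<ge> 1 \<Longrightarrow> \<bar>fps_nth (li_fps u) n\<bar> \<le> C * harm n ^ length u / real n"
    using li_fps_bound[of u] by blast
  obtain D where D: "D \<ge> 0" "\<And>n. n \<ge> 1 \<Longrightarrow> harm n ^ length u \<le> D * real n powr (1/4)"
    using harm_power_bound by blast
  have "\<bar>fps_nth (li_fps u) n\<bar> \<le> max 1 (C * D)" for n
  proof (cases "n = 0")
    case True
    then show ?thesis by (cases "u = []") (auto simp: li_fps_0)
  next
    case False
    then have n: "n \<ge> 1" by simp
    have "\<bar>fps_nth (li_fps u) n\<bar> \<le> C * harm n ^ length u / real n" by (rule C(2)) fact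
    also have "\<dots> \<le> C * (D * real n powr 1) / real n"
      using n C(1) D(1) order_trans[OF D(2)[OF n] mult_left_mono[OF powr_mono[of "1/4" 1 "real n"] D(1)]]
      by (intro divide_right_mono mult_left_mono) auto
    also have "\<dots> = C * D" using n by simp
    finally show ?thesis by simp
  qed
  then show ?thesis by blast
qed

section \<open>Polylogarithms as functions on the unit interval\<close>

definition li :: "letter list \<Rightarrow> real \<Rightarrow> real" where
  "li u s = suminf (\<lambda>n. fps_nth (li_fps u) n * s ^ n)"

definition abs_conv :: "real \<Rightarrow> real fps \<Rightarrow> bool" where
  "abs_conv s f \<longleftrightarrow> summable (\<lambda>n. \<bar>fps_nth f n * s ^ n\<bar>)"

lemma abs_conv_li_fps:
  assumes "0 < s" "s < 1"
  shows "abs_conv s (li_fps u)"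
proof -
  obtain C where C: "\<And>n. \<bar>fps_nth (li_fps u) n\<bar> \<le> C" using li_fps_bounded by blast
  have 1: "summable (\<lambda>n. C * s ^ n)" using assms by (intro summable_mult summable_geometric) auto
  have 2: "norm \<bar>fps_nth (li_fps u) n * s ^ n\<bar> \<le> C * s ^ n" for n
    using C[of n] assms by (simp add: abs_mult mult_right_mono)
  show ?thesis unfolding abs_conv_def
    by (rule summable_comparison_test'[OF 1, of 0]) (rule 2)
qed

lemma abs_conv_add:
  assumes "abs_conv s f" "abs_conv s g"
  shows "abs_conv s (f + g)"
    and "suminf (\<lambda>n. fps_nth (f + g) n * s ^ n) = suminf (\<lambda>n. fps_nth f n * s ^ n) + suminf (\<lambda>n. fps_nth g n * s ^ n)"
proof -
  from assms have 1: "summable (\<lambda>n. \<bar>fps_nth f n * s ^ n\<bar> + \<bar>fps_nth g n * s ^ n\<bar>)"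
    unfolding abs_conv_def by (rule summable_add)
  show "abs_conv s (f + g)"
    unfolding abs_conv_def
  proof (rule summable_comparison_test'[OF 1, of 0])
    fix n
    have "\<bar>fps_nth f n * s ^ n + fps_nth g n * s ^ n\<bar> \<le> \<bar>fps_nth f n * s ^ n\<bar> + \<bar>fps_nth g n * s ^ n\<bar>"
      by (rule abs_triangle_ineq)
    then show "norm \<bar>fps_nth (f + g) n * s ^ n\<bar> \<le> \<bar>fps_nth f n * s ^ n\<bar> + \<bar>fps_nth g n * s ^ n\<bar>"
      by (simp only: fps_add_nth distrib_right real_norm_def abs_idempotent)
  qed
  show "suminf (\<lambda>n. fps_nth (f + g) n * s ^ n) = suminf (\<lambda>n. fps_nth f n * s ^ n) + suminf (\<lambda>n. fps_nth g n * s ^ n)"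
    using suminf_add[OF summable_rabs_cancel[OF assms(1)[unfolded abs_conv_def]]
      summable_rabs_cancel[OF assms(2)[unfolded abs_conv_def]]] by (simp add: distrib_right)
qed

lemma sh_li:
  assumes "0 < s" "s < 1"
  shows "sh (\<lambda>w. li w s) u v = li u s * li v s"
proof -
  have "sh (\<lambda>w. li w s) u v = suminf (\<lambda>n. fps_nth (sh li_fps u v) n * s ^ n)"
    using sh_hom_on[of "abs_conv s" li_fps "\<lambda>f. suminf (\<lambda>n. fps_nth f n * s ^ n)" u v]
      abs_conv_li_fps[OF assms] abs_conv_add[of s] unfolding li_def by metis
  also have "\<dots> = suminf (\<lambda>n. \<Sum>i\<le>n. (fps_nth (li_fps u) i * s ^ i) * (fps_nth (li_fps v) (n - i) * s ^ (n - i)))"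
  proof (intro arg_cong[where f = suminf] ext)
    fix n
    have e: "(fps_nth (li_fps u) i * s ^ i) * (fps_nth (li_fps v) (n - i) * s ^ (n - i)) =
      fps_nth (li_fps u) i * fps_nth (li_fps v) (n - i) * s ^ n" if "i \<le> n" for i
      using that power_add[of s i "n - i"] by simp
    have "fps_nth (sh li_fps u v) n * s ^ n = (\<Sum>i\<le>n. fps_nth (li_fps u) i * fps_nth (li_fps v) (n - i) * s ^ n)"
      by (simp add: sh_li_fps fps_mult_nth sum_distrib_right atMost_atLeast0)
    also have "\<dots> = (\<Sum>i\<le>n. (fps_nth (li_fps u) i * s ^ i) * (fps_nth (li_fps v) (n - i) * s ^ (n - i)))"
      by (rule sum.cong) (simp_all only: e atMost_iff)
    finally show "fps_nth (sh li_fps u v) n * s ^ n =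
      (\<Sum>i\<le>n. (fps_nth (li_fps u) i * s ^ i) * (fps_nth (li_fps v) (n - i) * s ^ (n - i)))" .
  qed
  also have "\<dots> = li u s * li v s"
    unfolding li_def using abs_conv_li_fps[OF assms]
    by (intro Cauchy_product[symmetric]) (auto simp: abs_conv_def)
  finally show ?thesis .
qed

lemma li_Y:
  assumes "0 < s" "s < 1"
  shows "li [Y] s = - ln (1 - s)"
proof -
  have "(\<lambda>n. - ((- (- s)) ^ n) / real n) sums ln (1 + (- s))"
    using assms by (intro ln_series') auto
  from sums_minus[OF this] have "(\<lambda>n. s ^ n / real n) sums - ln (1 - s)" by simp
  moreover have "fps_nth (li_fps [Y]) n * s ^ n = s ^ n / real n" for n
    by (cases "n = 0") (simp_all add: li_fps_0 li_fps_nth sum.delta)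
  ultimately show ?thesis unfolding li_def by (metis (no_types, lifting) sums_cong sums_unique)
qed

lemma word_Nil [simp]: "word [] = []" and word_snoc: "word (k @ [a]) = word k @ Y # replicate (a - 1) X"
  by (simp_all add: word_def)

lemma word_eq_Nil_iff [simp]: "word k = [] \<longleftrightarrow> k = []"
  by (cases k) (auto simp: word_def)

lemma hd_word: "k \<noteq> [] \<Longrightarrow> hd (word k) = Y"
  by (cases k) (auto simp: word_def)

text \<open>No x leads such a word, so the recursion of \<open>li_fps\<close> has no correction term
  and produces the sum over chains with largest entry n. This ties the power series to the truncated
  values.\<close>

lemma li_fps_word:
  assumes "is_index k"
  shows "(\<Sum>m\<le>N. fps_nth (li_fps (word k)) m) = zpart N k"
    and "k \<noteq> [] \<Longrightarrow> n > 0 \<Longrightarrow> fps_nth (li_fps (word k)) n = zpart (n - 1) (butlast k) / real n ^ last k"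
  using assms
proof (induction k arbitrary: N n rule: rev_induct)
  case Nil
  case 1
  show ?case by (simp add: sum.delta)
next
  case Nil
  case 2
  then show ?case by simp
next
  case (snoc a k)
  have *: "fps_nth (li_fps (word k @ Y # replicate j X)) n = zpart (n - 1) k / real n ^ Suc j"
    if "is_index k" "n > 0" for n j
  proof (induction j)
    case 0
    have hd: "hd (word k @ [Y]) = Y" by (cases "k = []") (auto simp: hd_word)
    have "(\<Sum>m<n. fps_nth (li_fps (word k)) m) = (\<Sum>m\<le>n - 1. fps_nth (li_fps (word k)) m)"
      using \<open>n > 0\<close> by (intro sum.cong) auto
    then show ?case using that snoc.IH(1)[of "n - 1"] hd by (simp add: li_fps_nth)
  next
    case (Suc j)
    define W where "W = word k @ Y # replicate j X"
    have e: "word k @ Y # replicate (Suc j) X = W @ [X]"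
      by (simp add: W_def replicate_append_same[symmetric])
    have "hd (word k @ Y # replicate (Suc j) X) = Y" by (cases "k = []") (auto simp: hd_word)
    then have hd: "hd (W @ [X]) = Y" unfolding e .
    have "fps_nth (li_fps (W @ [X])) n = fps_nth (li_fps W) n / real n"
      using that hd by (simp add: li_fps_nth)
    then show ?case unfolding e using Suc by (simp add: W_def[symmetric])
  qed
  {
    case 2
    then have "is_index k" "a \<ge> 1" by auto
    with *[of n "a - 1"] 2 show ?case by (simp add: word_snoc)
  }
  {
    case 1
    then have k: "is_index k" "a \<ge> 1" by auto
    have "(\<Sum>m\<le>N. fps_nth (li_fps (word (k @ [a]))) m) = (\<Sum>m=1..N. fps_nth (li_fps (word (k @ [a]))) m)"
      by (rule sum.mono_neutral_right) (auto simp: li_fps_0 not_less_eq_eq)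
    also have "\<dots> = zpart N (k @ [a])"
      using *[of _ "a - 1"] k by (auto simp: zpart_snoc word_snoc intro!: sum.cong)
    finally show ?case .
  }
qed

section \<open>The two regularized zeta maps\<close>

lemma polyasym_cong:
  assumes "\<forall>\<^sub>F x in F. f x = g x"
  shows "polyasym F T f p \<longleftrightarrow> polyasym F T g p"
proof -
  have "((\<lambda>x. (f x - poly p (T x)) * T x ^ j) \<longlongrightarrow> 0) F \<longleftrightarrow> ((\<lambda>x. (g x - poly p (T x)) * T x ^ j) \<longlongrightarrow> 0) F" for j
    by (rule tendsto_cong) (use assms in \<open>eventually_elim, simp\<close>)
  then show ?thesis by (simp add: polyasym_def negl_def)
qed

lemma polyasym_sh:
  assumes "\<And>w. polyasym F T (f w) (p w)"
  shows "polyasym F T (\<lambda>x. sh (\<lambda>w. f w x) u v) (sh p u v)"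
  using assms
proof (induction p u v arbitrary: f rule: sh.induct)
  case (3 p a u b v)
  from "3.IH"(1)[of "\<lambda>w. f (a # w)"] "3.IH"(2)[of "\<lambda>w. f (b # w)"] "3.prems"
  show ?case by (simp add: polyasym_add)
qed auto

lemma polyasym_ev:
  assumes "\<And>w. w \<in> Poly_Mapping.keys f \<Longrightarrow> polyasym F T (g w) (p w)"
  shows "polyasym F T (\<lambda>x. ev (\<lambda>w. g w x) f) (\<Sum>w\<in>Poly_Mapping.keys f. smult (of_rat (Poly_Mapping.lookup f w)) (p w))"
proof -
  have "polyasym F T (\<lambda>x. \<Sum>w\<in>A. of_rat (Poly_Mapping.lookup f w) * g w x) (\<Sum>w\<in>A. smult (of_rat (Poly_Mapping.lookup f w)) (p w))"
    if "finite A" "A \<subseteq> Poly_Mapping.keys f" for A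
    using that
  proof (induction A)
    case empty
    show ?case using polyasym_poly[of F T 0] by simp
  next
    case (insert w A)
    then show ?case using polyasym_add[OF polyasym_scale[OF assms[of w]]] by simp
  qed
  then show ?thesis by (simp add: ev_def)
qed

lemma solve_linear: "c \<noteq> 0 \<Longrightarrow> c * x + S = R \<Longrightarrow> 1 / c * (R + (- 1) * S) = (x::real)"
  by (auto simp: field_simps)

lemma at_left_1_unit: "\<forall>\<^sub>F s in at_left (1::real). 0 < s \<and> s < 1"
  by (rule eventually_at_leftI[of 0]) auto

lemma minus_ln_at_top: "filterlim (\<lambda>s::real. - ln (1 - s)) at_top (at_left 1)"
  by real_asymp

lemma polyasym_li_Y: "polyasym (at_left 1) (\<lambda>s. - ln (1 - s)) (li [Y]) [:0, 1:]"
proof -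
  have "\<forall>\<^sub>F s in at_left (1::real). li [Y] s = poly [:0, 1:] (- ln (1 - s))"
    using at_left_1_unit by eventually_elim (simp add: li_Y)
  from polyasym_cong[OF this] show ?thesis using polyasym_poly[of _ "\<lambda>s. - ln (1 - s)" "[:0, 1:]"] by blast
qed

lemma polyasym_convergent:
  assumes "negl F T (\<lambda>x. f x - L)"
  shows "polyasym F T f [:L:]"
  using assms by (simp add: polyasym_def)

lemma polyasym_li_conv:
  assumes "trail Y u = 0"
  shows "polyasym (at_left 1) (\<lambda>s. - ln (1 - s)) (li u) [:suminf (fps_nth (li_fps u)):]"
  using negl_ln_power_series[OF summable_li_fps_X[OF assms]] unfolding li_def by (rule polyasym_convergent)

text \<open>\<open>word_trail_induct\<close> expresses \<open>li (u @ [Y])\<close> through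
  \<open>li u\<close>, the function -ln (1 - s) and words with fewer trailing y; these operations
  preserve polynomial asymptotics.\<close>

lemma ex_polyasym_li: "\<exists>p. polyasym (at_left 1) (\<lambda>s. - ln (1 - s)) (li u) p"
proof (induction u rule: word_trail_induct[where a = Y])
  case (convergent u)
  then show ?case using polyasym_li_conv by blast
next
  case (trailing u L)
  let ?c = "real (Suc (trail Y u))"
  let ?T = "\<lambda>s::real. - ln (1 - s)"
  have "\<exists>p. polyasym (at_left 1) ?T (\<lambda>s. \<Sum>w\<leftarrow>L. li w s) p"
    using trailing(2) by (intro polyasym_sum_list) auto
  then obtain p q where pq: "polyasym (at_left 1) ?T (li u) p" "polyasym (at_left 1) ?T (\<lambda>s. \<Sum>w\<leftarrow>L. li w s) q"
    using trailing(1) by blast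
  have "polyasym (at_left 1) ?T (\<lambda>s. (1 / ?c) * (li u s * li [Y] s + (- 1) * (\<Sum>w\<leftarrow>L. li w s)))
     (smult (1 / ?c) (p * [:0, 1:] + smult (- 1) q))"
    by (intro polyasym_scale polyasym_add polyasym_mult pq polyasym_li_Y)
  then have P: "\<exists>p. polyasym (at_left 1) ?T (\<lambda>s. (1 / ?c) * (li u s * li [Y] s + (- 1) * (\<Sum>w\<leftarrow>L. li w s))) p"
    by blast
  have "\<forall>\<^sub>F s in at_left (1::real). (1 / ?c) * (li u s * li [Y] s + (- 1) * (\<Sum>w\<leftarrow>L. li w s)) = li (u @ [Y]) s"
    using at_left_1_unit
  proof eventually_elim
    case (elim s)
    have "?c * li (u @ [Y]) s + (\<Sum>w\<leftarrow>L. li w s) = li u s * li [Y] s"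
      using trailing(3)[of "\<lambda>w. li w s"] sh_li[of s u "[Y]"] elim by simp
    moreover have "?c \<noteq> 0" by simp
    ultimately show ?case by (rule solve_linear[rotated])
  qed
  from polyasym_cong[OF this] P show ?case by simp
qed

definition li_poly :: "letter list \<Rightarrow> real poly" where
  "li_poly u = (SOME p. polyasym (at_left 1) (\<lambda>s. - ln (1 - s)) (li u) p)"

lemma polyasym_li: "polyasym (at_left 1) (\<lambda>s. - ln (1 - s)) (li u) (li_poly u)"
  unfolding li_poly_def using ex_polyasym_li by (rule someI_ex)

lemmas polyasym_li_unique = polyasym_unique[OF minus_ln_at_top trivial_limit_at_left_real]

lemma li_poly_eqI: "polyasym (at_left 1) (\<lambda>s. - ln (1 - s)) (li u) p \<Longrightarrow> li_poly u = p"
  using polyasym_li by (rule polyasym_li_unique)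

text \<open>The character \<chi>: the constant term in -ln (1 - s), which sends y to 0. It sends x
  to 0 because \<open>li_fps\<close> already omits the powers of log s.\<close>

definition shuffle_zeta :: "letter list \<Rightarrow> real" where
  "shuffle_zeta u = poly (li_poly u) 0"

lemma sh_li_poly: "sh li_poly u v = li_poly u * li_poly v"
proof (rule polyasym_li_unique)
  show "polyasym (at_left 1) (\<lambda>s. - ln (1 - s)) (\<lambda>s. sh (\<lambda>w. li w s) u v) (sh li_poly u v)"
    by (intro polyasym_sh polyasym_li)
  have "\<forall>\<^sub>F s in at_left (1::real). li u s * li v s = sh (\<lambda>w. li w s) u v"
    using at_left_1_unit by eventually_elim (simp add: sh_li)
  from polyasym_cong[OF this] polyasym_mult[OF polyasym_li polyasym_li]
  show "polyasym (at_left 1) (\<lambda>s. - ln (1 - s)) (\<lambda>s. sh (\<lambda>w. li w s) u v) (li_poly u * li_poly v)" by blast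
qed

lemma shuffle_zeta_conv: "trail Y u = 0 \<Longrightarrow> shuffle_zeta u = suminf (fps_nth (li_fps u))"
  by (simp add: shuffle_zeta_def li_poly_eqI[OF polyasym_li_conv])

lemma shuffle_zeta_Y [simp]: "shuffle_zeta [Y] = 0"
  by (simp add: shuffle_zeta_def li_poly_eqI[OF polyasym_li_Y])

lemma shuffle_zeta_X [simp]: "shuffle_zeta [X] = 0"
proof -
  have "fps_nth (li_fps [X]) = (\<lambda>_. 0)"
  proof
    show "fps_nth (li_fps [X]) n = 0" for n
      by (cases "n = 0") (simp_all add: li_fps_0 li_fps_nth)
  qed
  then have "suminf (fps_nth (li_fps [X])) = 0" by simp
  then show ?thesis by (simp add: shuffle_zeta_conv trail_def)
qed

lemma is_char_shuffle_zeta: "is_char shuffle_zeta"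
proof -
  have "sh shuffle_zeta u v = shuffle_zeta u * shuffle_zeta v" for u v
    using sh_hom[of "\<lambda>p. poly p 0" li_poly u v] by (simp add: shuffle_zeta_def[abs_def] sh_li_poly)
  moreover have "fps_nth (li_fps []) = (\<lambda>n. if n = 0 then 1 else 0)"
    by (rule ext) simp
  then have "suminf (fps_nth (li_fps [])) = 1"
    using sums_single[of 0 "\<lambda>_. 1::real"] by (simp add: sums_iff)
  then have "shuffle_zeta [] = 1" by (simp add: shuffle_zeta_conv)
  ultimately show ?thesis by (simp add: is_char_def)
qed

lemma trail_word: "is_index k \<Longrightarrow> trail Y (word k) = trail 1 k"
proof (induction k rule: rev_induct)
  case (snoc a k)
  show ?case
  proof (cases "a = 1")
    case True
    then show ?thesis using snoc by (simp add: trail_snoc word_snoc)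
  next
    case False
    then obtain j where j: "a - 1 = Suc j" using snoc.prems by (cases "a - 1") auto
    have "word (k @ [a]) = (word k @ Y # replicate j X) @ [X]"
      unfolding word_snoc j by (simp add: replicate_append_same)
    then show ?thesis using False by (simp only: trail_snoc) simp
  qed
qed simp

lemma admissible_limits:
  assumes "admissible k"
  shows "mzv k = suminf (fps_nth (li_fps (word k)))"
    and "negl sequentially harm (\<lambda>N. zpart N k - mzv k)"
proof -
  have k: "is_index k" "trail Y (word k) = 0"
    using assms by (simp_all add: admissible_iff_trail trail_word)
  have n: "negl sequentially harm (\<lambda>N. zpart N k - suminf (fps_nth (li_fps (word k))))"
    using negl_harm_partial_sums[OF summable_li_fps_X[OF k(2)]] by (simp add: li_fps_word(1)[OF k(1)])
  from neglD[OF this, of 0] have "(\<lambda>N. zpart N k) \<longlonglongrightarrow> suminf (fps_nth (li_fps (word k)))"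
    by (simp add: LIM_zero_iff)
  then show 1: "mzv k = suminf (fps_nth (li_fps (word k)))" by (rule mzv_eqI)
  show "negl sequentially harm (\<lambda>N. zpart N k - mzv k)" using n by (simp add: 1)
qed

lemma shuffle_zeta_admissible: "admissible k \<Longrightarrow> shuffle_zeta (word k) = mzv k"
  by (simp add: admissible_limits(1) shuffle_zeta_conv trail_word admissible_iff_trail)

lemma ex_polyasym_zpart: "is_index k \<Longrightarrow> \<exists>p. polyasym sequentially harm (\<lambda>N. zpart N k) p"
proof (induction k rule: index_trail_induct)
  case (admissible k)
  then show ?case using polyasym_convergent[OF admissible_limits(2)] by blast
next
  case (trailing k L)
  let ?c = "real (Suc (trail 1 k))"
  have "\<exists>p. polyasym sequentially harm (\<lambda>N. \<Sum>w\<leftarrow>L. zpart N w) p"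
    using trailing.IH(2) by (intro polyasym_sum_list) blast
  then obtain p q where pq: "polyasym sequentially harm (\<lambda>N. zpart N k) p"
    "polyasym sequentially harm (\<lambda>N. \<Sum>w\<leftarrow>L. zpart N w) q"
    using trailing.IH(1) by blast
  have h: "polyasym sequentially harm harm [:0, 1:]"
    using polyasym_poly[of sequentially harm "[:0, 1:]"] by simp
  have "polyasym sequentially harm (\<lambda>N. (1 / ?c) * (zpart N k * harm N + (- 1) * (\<Sum>w\<leftarrow>L. zpart N w)))
     (smult (1 / ?c) (p * [:0, 1:] + smult (- 1) q))"
    by (intro polyasym_scale polyasym_add polyasym_mult pq h)
  then have P: "\<exists>p. polyasym sequentially harm (\<lambda>N. (1 / ?c) * (zpart N k * harm N + (- 1) * (\<Sum>w\<leftarrow>L. zpart N w))) p"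
    by blast
  have "(1 / ?c) * (zpart N k * harm N + (- 1) * (\<Sum>w\<leftarrow>L. zpart N w)) = zpart N (k @ [1])" for N
  proof -
    have "?c * zpart N (k @ [1]) + (\<Sum>w\<leftarrow>L. zpart N w) = zpart N k * harm N"
      using trailing.hyps(2)[of "zpart N"] by (simp only: zpart_mult zpart_one)
    moreover have "?c \<noteq> 0" by simp
    ultimately show ?thesis by (rule solve_linear[rotated])
  qed
  with P show ?case by (simp only:)
qed

definition zpart_poly :: "nat list \<Rightarrow> real poly" where
  "zpart_poly k = (SOME p. polyasym sequentially harm (\<lambda>N. zpart N k) p)"

lemma polyasym_zpart: "is_index k \<Longrightarrow> polyasym sequentially harm (\<lambda>N. zpart N k) (zpart_poly k)"
  unfolding zpart_poly_def using ex_polyasym_zpart by (rule someI_ex)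

lemmas polyasym_harm_unique = polyasym_unique[OF harm_at_top sequentially_bot]

text \<open>The value 0 outside the indices is the one that \<open>is_regularization\<close>
  prescribes.\<close>

definition harmonic_zeta :: "nat list \<Rightarrow> real" where
  "harmonic_zeta k = (if is_index k then poly (zpart_poly k) 0 else 0)"

lemma harmonic_zeta_non_index: "\<not> is_index k \<Longrightarrow> harmonic_zeta k = 0"
  by (simp add: harmonic_zeta_def)

lemma harmonic_zeta_eqI:
  assumes "is_index k" "polyasym sequentially harm (\<lambda>N. zpart N k) p"
  shows "harmonic_zeta k = poly p 0"
  using polyasym_harm_unique[OF assms(2) polyasym_zpart[OF assms(1)]] assms(1) by (simp add: harmonic_zeta_def)

lemma harmonic_zeta_admissible: "admissible k \<Longrightarrow> harmonic_zeta k = mzv k"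
  using harmonic_zeta_eqI[OF _ polyasym_convergent[OF admissible_limits(2)]] by (simp add: admissible_iff_trail)

lemma harmonic_zeta_one: "harmonic_zeta [1] = 0"
  using harmonic_zeta_eqI[of "[1]" "[:0, 1:]"] polyasym_poly[of sequentially harm "[:0, 1:]"]
  by (simp add: zpart_one[simplified])

lemma ev_harmonic_cong:
  assumes "is_index k" "is_index l" "\<And>w. is_index w \<Longrightarrow> F w = G w"
  shows "ev F (harmonic_prod k l) = ev G (harmonic_prod k l)"
  using assms
proof (induction "length k + length l" arbitrary: k l F G rule: less_induct)
  case less
  show ?case
  proof (cases "k = [] \<or> l = []")
    case True
    then show ?thesis using less.prems by auto
  next
    case False
    then obtain k' a l' b where kl: "k = k' @ [a]" "l = l' @ [b]" by (metis rev_exhaust)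
    have "ev (\<lambda>w. F (w @ [c])) (harmonic_prod p q) = ev (\<lambda>w. G (w @ [c])) (harmonic_prod p q)"
      if "length p + length q < length k + length l" "is_index p" "is_index q" "1 \<le> c" for p q c
      by (rule less.hyps) (use that less.prems(3) in auto)
    then show ?thesis using less.prems(1,2) by (simp add: kl ev_harmonic_snoc)
  qed
qed

lemma harmonic_zeta_mult:
  assumes "is_index k" "is_index l"
  shows "ev harmonic_zeta (harmonic_prod k l) = harmonic_zeta k * harmonic_zeta l"
proof -
  let ?f = "harmonic_prod k l"
  \<comment> \<open>Asymptotics are known for indices only. Elsewhere both sides are set to 0, and
    by \<open>ev_harmonic_cong\<close> a product of indices does not see the change.\<close>
  define z where "z w N = (if is_index w then zpart N w else 0)" for w N
  define q where "q w = (if is_index w then zpart_poly w else 0)" for w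
  let ?p = "\<Sum>w\<in>Poly_Mapping.keys ?f. smult (of_rat (Poly_Mapping.lookup ?f w)) (q w)"
  have zq: "polyasym sequentially harm (z w) (q w)" for w
    using polyasym_zpart[of w] polyasym_poly[of sequentially harm 0] by (simp add: z_def[abs_def] q_def)
  have "polyasym sequentially harm (\<lambda>N. ev (\<lambda>w. z w N) ?f) ?p"
    by (intro polyasym_ev zq)
  moreover have "ev (\<lambda>w. z w N) ?f = zpart N k * zpart N l" for N
    unfolding zpart_mult[symmetric] by (rule ev_harmonic_cong) (use assms in \<open>auto simp: z_def\<close>)
  ultimately have "polyasym sequentially harm (\<lambda>N. zpart N k * zpart N l) ?p" by (simp only:)
  moreover have "polyasym sequentially harm (\<lambda>N. zpart N k * zpart N l) (zpart_poly k * zpart_poly l)"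
    by (intro polyasym_mult polyasym_zpart assms)
  ultimately have "?p = zpart_poly k * zpart_poly l" by (rule polyasym_harm_unique)
  then have "poly ?p 0 = harmonic_zeta k * harmonic_zeta l"
    using assms by (simp add: harmonic_zeta_def)
  moreover have "harmonic_zeta w = poly (q w) 0" for w
    by (simp add: harmonic_zeta_def q_def)
  then have "poly ?p 0 = ev harmonic_zeta ?f"
    by (simp add: ev_def poly_sum)
  ultimately show ?thesis by simp
qed

text \<open>Existence is the map just built. Uniqueness is an induction on trailing ones: the
  product with (1), whose value is 0, determines \<open>F (k @ [1])\<close>.\<close>

lemma zeta_harmonic_map_eq: "zeta_harmonic_map = ev harmonic_zeta"
  unfolding zeta_harmonic_map_def
proof (rule the_equality)
  show "is_regularization {k. is_index k} (\<lambda>k. k) harmonic_prod (ev harmonic_zeta)"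
    unfolding is_regularization_iff mem_Collect_eq
    using harmonic_zeta_mult harmonic_zeta_admissible harmonic_zeta_one harmonic_zeta_non_index by blast
next
  fix Z assume "is_regularization {k. is_index k} (\<lambda>k. k) harmonic_prod Z"
  then obtain F where F: "Z = ev F" "\<And>b. \<not> is_index b \<Longrightarrow> F b = 0"
     "\<And>a b. is_index a \<Longrightarrow> is_index b \<Longrightarrow> ev F (harmonic_prod a b) = F a * F b"
     "\<And>k. admissible k \<Longrightarrow> F k = mzv k" "F [1] = 0"
    unfolding is_regularization_iff mem_Collect_eq by blast
  have "F k = harmonic_zeta k" if "is_index k" for k
    using that
  proof (induction k rule: index_trail_induct)
    case (admissible k)
    then show ?case by (simp add: F harmonic_zeta_admissible)
  next
    case (trailing k L)
    have "(\<Sum>w\<leftarrow>L. F w) = (\<Sum>w\<leftarrow>L. harmonic_zeta w)"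
      using trailing.IH(2) by (intro arg_cong[where f = sum_list] map_cong) auto
    moreover have "ev F (harmonic_prod k [1]) = 0" using trailing.hyps(1) F(3)[of k "[1]"] F(5) by simp
    moreover have "ev harmonic_zeta (harmonic_prod k [1]) = 0"
      using trailing.hyps(1) harmonic_zeta_mult[of k "[1]"] harmonic_zeta_one by simp
    ultimately have "real (Suc (trail 1 k)) * F (k @ [1]) = real (Suc (trail 1 k)) * harmonic_zeta (k @ [1])"
      using trailing.hyps(2)[of F] trailing.hyps(2)[of harmonic_zeta] by linarith
    then show ?case by simp
  qed
  then have "F = harmonic_zeta" using F(2) by (auto simp: harmonic_zeta_def)
  with F(1) show "Z = ev harmonic_zeta" by simp
qed

lemma zeta_reg_Harmonic: "zeta_reg Harmonic k = harmonic_zeta k"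
  by (simp add: zeta_harmonic_map_eq)

lemma ev_shuffle_prod: "ev F (shuffle_prod u v) = sh F u v"
  by (induction u v arbitrary: F rule: shuffle_prod.induct) (simp_all add: ev_lin_ext)

definition y_words :: "letter list set" where
  "y_words = {w. w = [] \<or> hd w = Y}"

text \<open>Words starting with y shuffle to words starting with y, so \<chi> stays multiplicative
  there after being cut off to 0 on all other words.\<close>

lemma sh_y_words:
  assumes "\<And>w. w \<in> y_words \<Longrightarrow> F w = G w" "u \<in> y_words" "v \<in> y_words"
  shows "sh F u v = sh G u v"
  using assms by (cases u; cases v) (auto simp: y_words_def)

lemma word_in_y_words [simp]: "word k \<in> y_words"
  by (cases "k = []") (auto simp: y_words_def hd_word)

lemma y_words_eq: "w \<in> y_words \<Longrightarrow> \<exists>k. is_index k \<and> w = word k"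
proof (induction w rule: rev_induct)
  case Nil
  show ?case by (intro exI[of _ "[]"]) simp
next
  case (snoc c w)
  then have "w \<in> y_words" by (cases w) (auto simp: y_words_def)
  with snoc obtain k where k: "is_index k" "w = word k" by blast
  show ?case
  proof (cases c)
    case Y
    then show ?thesis using k by (intro exI[of _ "k @ [1]"]) (simp add: word_snoc)
  next
    case X
    with snoc.prems have "k \<noteq> []" using k by (auto simp: y_words_def)
    then obtain k' a where ka: "k = k' @ [a]" by (metis rev_exhaust)
    with k have "a = Suc (a - 1)" by simp
    then have "replicate (Suc a - 1) X = replicate (a - 1) X @ [X]"
      by (metis diff_Suc_1 replicate_append_same replicate_Suc)
    then show ?thesis using k X ka by (intro exI[of _ "k' @ [Suc a]"]) (simp add: word_snoc)
  qed
qed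

lemma zeta_shuffle_map_eq: "zeta_shuffle_map = ev (\<lambda>w. if w \<in> y_words then shuffle_zeta w else 0)"
  unfolding zeta_shuffle_map_def y_words_def[symmetric]
proof (rule the_equality)
  let ?F = "\<lambda>w. if w \<in> y_words then shuffle_zeta w else 0"
  have m: "sh ?F a b = shuffle_zeta a * shuffle_zeta b" if "a \<in> y_words" "b \<in> y_words" for a b
    using sh_y_words[of ?F shuffle_zeta a b] that is_char_shuffle_zeta by (simp add: is_char_def)
  have 1: "word [1] = [Y]" using word_snoc[of "[]" 1] by simp
  show "is_regularization y_words word shuffle_prod (ev ?F)"
    unfolding is_regularization_iff
    by (intro exI[of _ ?F]) (simp add: ev_shuffle_prod m shuffle_zeta_admissible 1[simplified])
  fix Z assume "is_regularization y_words word shuffle_prod Z"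
  then obtain F where F: "Z = ev F" "\<And>b. b \<notin> y_words \<Longrightarrow> F b = 0"
     "\<And>a b. a \<in> y_words \<Longrightarrow> b \<in> y_words \<Longrightarrow> sh F a b = F a * F b"
     "\<And>k. admissible k \<Longrightarrow> F (word k) = mzv k" "F [Y] = 0"
    unfolding is_regularization_iff ev_shuffle_prod 1 by blast
  have "w \<in> y_words \<longrightarrow> F w = shuffle_zeta w" for w
  proof (induction w rule: word_trail_induct[where a = Y])
    case (convergent u)
    show ?case
    proof
      assume "u \<in> y_words"
      then obtain k where "is_index k" "u = word k" using y_words_eq by blast
      with convergent show "F u = shuffle_zeta u"
        by (simp add: trail_word F shuffle_zeta_admissible admissible_iff_trail)
    qed
  next
    case (trailing u L)
    show ?case
    proof
      assume u: "u @ [Y] \<in> y_words"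
      then have u': "u \<in> y_words" by (cases u) (auto simp: y_words_def)
      have "F w = shuffle_zeta w" if "w \<in> set L" for w
        using trailing(2)[OF that] u' by (auto simp: y_words_def)
      then have "(\<Sum>w\<leftarrow>L. F w) = (\<Sum>w\<leftarrow>L. shuffle_zeta w)"
        by (intro arg_cong[where f = sum_list] map_cong) auto
      moreover have "sh F u [Y] = 0" using u' F(3)[of u "[Y]"] F(5) by (simp add: y_words_def)
      moreover have "sh shuffle_zeta u [Y] = 0" using is_char_shuffle_zeta by (simp add: is_char_def)
      ultimately have "real (Suc (trail Y u)) * F (u @ [Y]) = real (Suc (trail Y u)) * shuffle_zeta (u @ [Y])"
        using trailing(3)[of F] trailing(3)[of shuffle_zeta] by linarith
      then show "F (u @ [Y]) = shuffle_zeta (u @ [Y])" by simp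
    qed
  qed
  then have "F = ?F" using F(2) by auto
  with F(1) show "Z = ev ?F" by simp
qed

lemma zeta_reg_Shuffle: "zeta_reg Shuffle k = shuffle_zeta (word k)"
  by (simp add: zeta_shuffle_map_eq)

section \<open>Symmetric multiple zeta values to first order\<close>

interpretation rat_real: vector_space rat_mult_real
  by (rule vector_space_real)

lemma mzv_space_add: "x \<in> mzv_space \<Longrightarrow> y \<in> mzv_space \<Longrightarrow> x + y \<in> mzv_space"
  unfolding mzv_space_def by (rule rat_real.span_add)

lemma mzv_space_0 [simp]: "0 \<in> mzv_space"
  unfolding mzv_space_def by (rule rat_real.span_zero)

lemma mzv_space_scale: "x \<in> mzv_space \<Longrightarrow> of_rat c * x \<in> mzv_space"
  unfolding mzv_space_def using rat_real.span_scale[of x _ c] by (simp add: rat_mult_real_def)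

lemma mzv_space_minus: "x \<in> mzv_space \<Longrightarrow> - x \<in> mzv_space"
  unfolding mzv_space_def by (rule rat_real.span_neg)

lemma mzv_space_diff: "x \<in> mzv_space \<Longrightarrow> y \<in> mzv_space \<Longrightarrow> x - y \<in> mzv_space"
  unfolding mzv_space_def by (rule rat_real.span_diff)

lemma mzv_space_nat_mult: "x \<in> mzv_space \<Longrightarrow> real n * x \<in> mzv_space"
  using mzv_space_scale[of x "of_nat n"] by simp

lemma mzv_space_sum: "(\<And>i. i \<in> I \<Longrightarrow> f i \<in> mzv_space) \<Longrightarrow> sum f I \<in> mzv_space"
  unfolding mzv_space_def by (rule rat_real.span_sum)

lemma mzv_space_sum_list: "(\<And>w. w \<in> set L \<Longrightarrow> f w \<in> mzv_space) \<Longrightarrow> (\<Sum>w\<leftarrow>L. f w) \<in> mzv_space"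
  by (induction L) (auto intro: mzv_space_add)

lemma mzv_in_space: "admissible k \<Longrightarrow> mzv k \<in> mzv_space"
  unfolding mzv_space_def by (intro rat_real.span_base) auto

lemma mzv_space_cancel_nat:
  assumes "real (Suc n) * x \<in> mzv_space"
  shows "x \<in> mzv_space"
proof -
  have "of_rat (1 / of_nat (Suc n)) * (real (Suc n) * x) \<in> mzv_space"
    using assms by (rule mzv_space_scale)
  also have "of_rat (1 / of_nat (Suc n)) * (real (Suc n) * x) = x"
    by (simp add: of_rat_divide field_simps del: of_nat_Suc)
  finally show ?thesis .
qed

lemma harmonic_zeta_in_space: "harmonic_zeta k \<in> mzv_space"
proof (cases "is_index k")
  case True
  then show ?thesis
  proof (induction k rule: index_trail_induct)
    case (admissible k)
    then show ?case by (simp add: harmonic_zeta_admissible mzv_in_space)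
  next
    case (trailing k L)
    have "ev harmonic_zeta (harmonic_prod k [1]) = 0"
      using trailing.hyps(1) harmonic_zeta_mult[of k "[1]"] harmonic_zeta_one by simp
    with trailing.hyps(2)[of harmonic_zeta]
    have "real (Suc (trail 1 k)) * harmonic_zeta (k @ [1]) = - (\<Sum>w\<leftarrow>L. harmonic_zeta w)"
      by linarith
    also have "\<dots> \<in> mzv_space"
      using trailing.IH(2) by (intro mzv_space_minus mzv_space_sum_list) blast
    finally show ?case by (rule mzv_space_cancel_nat)
  qed
qed (simp add: harmonic_zeta_def)

lemma shuffle_zeta_in_space: "w \<in> y_words \<Longrightarrow> shuffle_zeta w \<in> mzv_space"
proof (induction w rule: word_trail_induct[where a = Y])
  case (convergent u)
  then obtain k where "is_index k" "u = word k" using y_words_eq by blast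
  with convergent show ?case
    by (simp add: trail_word shuffle_zeta_admissible admissible_iff_trail mzv_in_space)
next
  case (trailing u L)
  then have u: "u \<in> y_words" by (cases u) (auto simp: y_words_def)
  have "sh shuffle_zeta u [Y] = 0" using is_char_shuffle_zeta by (simp add: is_char_def)
  with trailing(3)[of shuffle_zeta]
  have "real (Suc (trail Y u)) * shuffle_zeta (u @ [Y]) = - (\<Sum>w\<leftarrow>L. shuffle_zeta w)"
    by linarith
  also have "\<dots> \<in> mzv_space"
  proof (intro mzv_space_minus mzv_space_sum_list)
    fix w assume w: "w \<in> set L"
    then have "w \<in> y_words" using trailing(2)[OF w] u by (auto simp: y_words_def)
    then show "shuffle_zeta w \<in> mzv_space" using trailing(2)[OF w] by blast
  qed
  finally show ?case by (rule mzv_space_cancel_nat)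
qed

lemma zeta_reg_in_space: "zeta_reg b k \<in> mzv_space"
proof (cases b)
  case Harmonic
  then show ?thesis using harmonic_zeta_in_space by (simp only: zeta_reg_Harmonic)
next
  case Shuffle
  then show ?thesis using shuffle_zeta_in_space by (simp only: zeta_reg_Shuffle) simp
qed

text \<open>A product of two admissible values expands by the harmonic product into regularized
  values, which lie in the span; bilinearity does the rest. The coefficients of
  \<open>zeta_S_hat\<close> are sums of such products.\<close>

lemma mzv_space_mult:
  assumes "x \<in> mzv_space" "y \<in> mzv_space"
  shows "x * y \<in> mzv_space"
proof -
  have base: "mzv k * mzv l \<in> mzv_space" if "admissible k" "admissible l" for k l
  proof -
    have "mzv k * mzv l = ev harmonic_zeta (harmonic_prod k l)"
      using that harmonic_zeta_mult[of k l] by (simp add: harmonic_zeta_admissible admissible_iff_trail)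
    also have "\<dots> \<in> mzv_space"
      unfolding ev_def by (intro mzv_space_sum mzv_space_scale harmonic_zeta_in_space)
    finally show ?thesis .
  qed
  have closed: "rat_real.subspace {x. x * y \<in> mzv_space}" for y
    by (auto simp: rat_real.subspace_def distrib_right rat_mult_real_def mult.assoc
        intro: mzv_space_add mzv_space_scale)
  have 1: "x * mzv l \<in> mzv_space" if "admissible l" "x \<in> mzv_space" for x l
  proof -
    have "mzv_space \<subseteq> {x. x * mzv l \<in> mzv_space}"
      unfolding mzv_space_def[of] using closed base that(1)
      by (intro rat_real.span_minimal) (auto simp: mzv_space_def[symmetric])
    with that(2) show ?thesis by auto
  qed
  have "mzv_space \<subseteq> {y. y * x \<in> mzv_space}"
  proof -
    have "mzv ` {k. admissible k} \<subseteq> {y. y * x \<in> mzv_space}"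
      using 1[OF _ assms(1)] by (auto simp: mult.commute)
    then show ?thesis using rat_real.span_minimal[OF _ closed] unfolding mzv_space_def by blast
  qed
  with assms(2) show ?thesis by (auto simp: mult.commute)
qed

lemma zeta_shifted_in_space: "zeta_shifted b m k \<in> mzv_space"
proof -
  have "zeta_reg b (map2 (+) k l) * (\<Prod>i<length k. real ((k ! i + l ! i - 1) choose (l ! i))) \<in> mzv_space" for l
    using mzv_space_nat_mult[OF zeta_reg_in_space[of b "map2 (+) k l"], of "\<Prod>i<length k. (k ! i + l ! i - 1) choose (l ! i)"]
    by (simp add: mult.commute)
  then show ?thesis unfolding zeta_shifted_def by (intro mzv_space_sum)
qed

lemma zeta_S_hat_nth:
  "fps_nth (zeta_S_hat b k) m = (\<Sum>i\<le>length k. (- 1) ^ sum_list (drop i k) * zeta_reg b (take i k) *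
     zeta_shifted b m (rev (drop i k)))"
  by (simp add: zeta_S_hat_def fps_sum_nth)

lemma zeta_S_hat_in_space: "fps_nth (zeta_S_hat b k) m \<in> mzv_space"
proof -
  have "(- 1) ^ j * x * y \<in> mzv_space" if "x \<in> mzv_space" "y \<in> mzv_space" for j x y
    using mzv_space_mult[OF that] mzv_space_minus[OF mzv_space_mult[OF that]] by (cases "even j") auto
  then show ?thesis
    unfolding zeta_S_hat_nth by (intro mzv_space_sum) (auto intro: zeta_reg_in_space zeta_shifted_in_space)
qed

text \<open>Abel's theorem in the absolutely summable case, where the Weierstrass test gives uniform
  convergence on [0, 1].\<close>

lemma tendsto_abs_summable_power_series:
  fixes b :: "nat \<Rightarrow> real"
  assumes "summable (\<lambda>n. \<bar>b n\<bar>)"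
  shows "((\<lambda>s. suminf (\<lambda>n. b n * s ^ n)) \<longlongrightarrow> suminf b) (at_left 1)"
proof -
  have "uniform_limit {0..1} (\<lambda>N s. \<Sum>n<N. b n * s ^ n) (\<lambda>s. suminf (\<lambda>n. b n * s ^ n)) sequentially"
    by (rule Weierstrass_m_test[OF _ assms]) (auto simp: abs_mult intro!: mult_left_le power_le_one)
  then have "continuous_on {0..1} (\<lambda>s. suminf (\<lambda>n. b n * s ^ n))"
    by (rule uniform_limit_theorem[rotated]) (auto intro!: always_eventually continuous_intros)
  then have "((\<lambda>s. suminf (\<lambda>n. b n * s ^ n)) \<longlongrightarrow> suminf (\<lambda>n. b n * 1 ^ n)) (at 1 within {0..1})"
    unfolding continuous_on_def by (rule bspec) simp
  then show ?thesis by (simp add: at_within_Icc_at_left)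
qed

text \<open>Both regularizations are the constant term of \<open>\<Sum>\<^sub>m a\<^sub>m / m\<close>, once regularized by partial sums
  and once by Abel summation. They agree because \<open>a\<^sub>m\<close> converges fast enough to its limit.\<close>

lemma harmonic_shuffle_one_trailing:
  assumes "admissible k"
  shows "harmonic_zeta (k @ [1]) = shuffle_zeta (word (k @ [1]))"
proof -
  define L where "L = mzv k"
  define c where "c = fps_nth (li_fps (word k))"
  \<comment> \<open>The coefficient for \<open>k @ [1]\<close> is
    \<open>zpart (m - 1) k / m\<close>; subtracting L / m, the source of the divergence, leaves an
    absolutely summable sequence.\<close>
  define b where "b m = (if m = 0 then 0 else (zpart (m - 1) k - L) / real m)" for m
  have k: "is_index k" "trail Y (word k) = 0"
    using assms by (simp_all add: admissible_iff_trail trail_word)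
  have sc: "summable (\<lambda>n. \<bar>c n\<bar> * real n powr (1/4))"
    unfolding c_def by (rule summable_li_fps_X) fact
  define S where "S = suminf (\<lambda>n. \<bar>c n\<bar> * real n powr (1/4))"
  have bd: "\<bar>zpart N k - L\<bar> \<le> real N powr (- (1/4)) * S" if "N \<ge> 1" for N
    using partial_sums_tail_bound[OF sc that] li_fps_word(1)[OF k(1), of N] admissible_limits(1)[OF assms]
    by (simp add: c_def S_def L_def)
  have sb: "summable (\<lambda>n. \<bar>b n\<bar>)"
  proof -
    have "summable (\<lambda>n. S * real n powr (- (5/4)))"
      by (intro summable_mult) (simp add: summable_real_powr_iff)
    then have "summable (\<lambda>n. \<bar>b (Suc n)\<bar>)"
    proof (rule summable_comparison_test'[where N = 1])
      fix n :: nat assume n: "n \<ge> 1"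
      have "\<bar>b (Suc n)\<bar> = \<bar>zpart n k - L\<bar> / real (Suc n)" by (simp add: b_def)
      also have "\<dots> \<le> \<bar>zpart n k - L\<bar> / real n" using n by (intro divide_left_mono) auto
      also have "\<dots> \<le> real n powr (- (1/4)) * S / real n" by (intro divide_right_mono bd n) simp
      also have "\<dots> = S * (real n powr (- (1/4)) / real n powr 1)" using n by simp
      also have "real n powr (- (1/4)) / real n powr 1 = real n powr (- (5/4))"
        by (simp only: powr_diff[symmetric]) simp
      finally show "norm \<bar>b (Suc n)\<bar> \<le> S * real n powr (- (5/4))" by simp
    qed
    then show ?thesis by (subst (asm) summable_Suc_iff)
  qed
  have "harmonic_zeta (k @ [1]) = suminf b"
  proof -
    have "zpart N (k @ [1]) - poly [:suminf b, L:] (harm N) = (\<Sum>n\<le>N. b n) - suminf b" for N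
    proof (induction N)
      case 0
      then show ?case by (simp add: zpart_0 b_def harm_expand)
    next
      case (Suc N)
      have "zpart (Suc N) (k @ [1]) = zpart N (k @ [1]) + zpart N k / real (Suc N)"
        using zpart_Suc[of N k 1] by simp
      moreover have "poly [:suminf b, L:] (harm (Suc N)) = poly [:suminf b, L:] (harm N) + L / real (Suc N)"
        by (simp add: harm_Suc algebra_simps divide_inverse)
      moreover have "b (Suc N) = zpart N k / real (Suc N) - L / real (Suc N)"
        by (simp add: b_def diff_divide_distrib)
      ultimately show ?case using Suc by (simp only: sum.atMost_Suc)
    qed
    moreover have "(\<lambda>N. (\<Sum>n\<le>N. b n) - suminf b) \<longlonglongrightarrow> 0"
      using summable_LIMSEQ'[OF summable_rabs_cancel[OF sb]] by (simp add: LIM_zero)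
    ultimately have "(\<lambda>N. zpart N (k @ [1]) - poly [:suminf b, L:] (harm N)) \<longlonglongrightarrow> 0" by (simp only:)
    moreover have "polyasym sequentially harm (\<lambda>N. zpart N (k @ [1])) (zpart_poly (k @ [1]))"
      using k by (intro polyasym_zpart) simp
    ultimately have "zpart_poly (k @ [1]) = [:suminf b, L:]"
      using polyasym_unique_limit[OF harm_at_top sequentially_bot] by blast
    then show ?thesis using k by (simp add: harmonic_zeta_def)
  qed
  moreover have "shuffle_zeta (word (k @ [1])) = suminf b"
  proof -
    have "\<forall>\<^sub>F s in at_left 1. li (word (k @ [1])) s - poly [:0, L:] (- ln (1 - s)) = suminf (\<lambda>n. b n * s ^ n)"
      using at_left_1_unit
    proof eventually_elim
      case (elim s)
      then have s: "0 < s" "s < 1" by auto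
      have e: "fps_nth (li_fps (word (k @ [1]))) n * s ^ n - L * (fps_nth (li_fps [Y]) n * s ^ n) = b n * s ^ n" for n
      proof (cases "n = 0")
        case True
        then show ?thesis by (simp add: li_fps_0 b_def)
      next
        case False
        have 1: "fps_nth (li_fps (word (k @ [1]))) n = zpart (n - 1) k / real n"
          using li_fps_word(2)[of "k @ [1]" n] k False by simp
        have 2: "fps_nth (li_fps [Y]) n = 1 / real n"
          using li_fps_word(2)[of "[1]" n] word_snoc[of "[]" 1] False by simp
        show ?thesis unfolding 1 2 b_def using False by (simp add: diff_divide_distrib left_diff_distrib)
      qed
      have sm: "summable (\<lambda>n. fps_nth (li_fps u) n * s ^ n)" for u
        using abs_conv_li_fps[OF s, of u] unfolding abs_conv_def by (rule summable_rabs_cancel)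
      have "li (word (k @ [1])) s - L * li [Y] s =
          suminf (\<lambda>n. fps_nth (li_fps (word (k @ [1]))) n * s ^ n - L * (fps_nth (li_fps [Y]) n * s ^ n))"
        unfolding li_def suminf_mult[OF sm, symmetric] by (rule suminf_diff[OF sm summable_mult[OF sm]])
      also have "\<dots> = suminf (\<lambda>n. b n * s ^ n)" by (simp only: e)
      finally show ?case using s by (simp add: li_Y mult.commute)
    qed
    moreover have "((\<lambda>s. suminf (\<lambda>n. b n * s ^ n)) \<longlongrightarrow> suminf b) (at_left 1)"
      using sb by (rule tendsto_abs_summable_power_series)
    ultimately have "((\<lambda>s. li (word (k @ [1])) s - poly [:0, L:] (- ln (1 - s))) \<longlongrightarrow> suminf b) (at_left 1)"
      by (simp add: tendsto_cong)
    then have "((\<lambda>s. li (word (k @ [1])) s - poly [:suminf b, L:] (- ln (1 - s))) \<longlongrightarrow> 0) (at_left 1)"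
      by (subst (asm) LIM_zero_iff[symmetric]) (simp add: algebra_simps)
    from polyasym_unique_limit[OF minus_ln_at_top trivial_limit_at_left_real polyasym_li this]
    show ?thesis by (simp add: shuffle_zeta_def)
  qed
  ultimately show ?thesis by simp
qed

lemma zeta_reg_eq_shuffle_zeta:
  assumes "is_index k" "trail 1 k \<le> 1"
  shows "zeta_reg b k = shuffle_zeta (word k)"
proof (cases b)
  case Shuffle
  then show ?thesis by (simp only: zeta_reg_Shuffle)
next
  case Harmonic
  have "harmonic_zeta k = shuffle_zeta (word k)"
  proof (cases "trail 1 k = 0")
    case True
    with assms show ?thesis by (simp add: harmonic_zeta_admissible shuffle_zeta_admissible admissible_iff_trail)
  next
    case False
    then obtain k' where k': "k = k' @ [1]"
      by (cases k rule: rev_cases) (auto simp: trail_snoc split: if_splits)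
    with assms have "admissible k'" by (simp add: trail_snoc admissible_iff_trail)
    then show ?thesis unfolding k' by (rule harmonic_shuffle_one_trailing)
  qed
  then show ?thesis using Harmonic by (simp only: zeta_reg_Harmonic)
qed

definition no_adjacent_ones :: "nat list \<Rightarrow> bool" where
  "no_adjacent_ones k \<longleftrightarrow> (\<forall>i. Suc i < length k \<longrightarrow> k ! i \<noteq> 1 \<or> k ! Suc i \<noteq> 1)"

lemma no_adjacent_ones_trail:
  assumes "no_adjacent_ones k"
  shows "trail 1 k \<le> 1"
proof (rule ccontr)
  assume a: "\<not> trail 1 k \<le> 1"
  then obtain k1 where k1: "k = k1 @ [1]"
    by (cases k rule: rev_cases) (auto simp: trail_snoc split: if_splits)
  have "trail 1 k = Suc (trail 1 k1)" unfolding k1 using trail_snoc[of 1 k1 1] by simp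
  with a have "trail 1 k1 > 0" by linarith
  then obtain k2 where "k1 = k2 @ [1]"
    by (cases k1 rule: rev_cases) (auto simp: trail_snoc split: if_splits)
  with k1 have "k = k2 @ [1, 1]" by simp
  then show False using assms unfolding no_adjacent_ones_def
    by (auto simp: nth_append dest!: spec[of _ "length k2"])
qed

lemma no_adjacent_ones_take: "no_adjacent_ones k \<Longrightarrow> no_adjacent_ones (take i k)"
  by (auto simp: no_adjacent_ones_def)

lemma no_adjacent_ones_drop: "no_adjacent_ones k \<Longrightarrow> no_adjacent_ones (drop i k)"
  by (auto simp: no_adjacent_ones_def)

lemma no_adjacent_ones_rev:
  assumes "no_adjacent_ones k"
  shows "no_adjacent_ones (rev k)"
  unfolding no_adjacent_ones_def
proof (intro allI impI)
  fix i assume i: "Suc i < length (rev k)"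
  define j where "j = length k - Suc (Suc i)"
  have "Suc j < length k" "rev k ! i = k ! Suc j" "rev k ! Suc i = k ! j"
    using i by (auto simp: j_def rev_nth Suc_diff_Suc)
  with assms show "rev k ! i \<noteq> 1 \<or> rev k ! Suc i \<noteq> 1"
    by (auto simp: no_adjacent_ones_def)
qed

lemma no_adjacent_ones_update:
  assumes "no_adjacent_ones k" "is_index k" "i < length k"
  shows "no_adjacent_ones (k[i := Suc (k ! i)])"
proof -
  have "1 \<le> k ! j" if "j < length k" for j using assms(2) that by (auto simp: is_index_def)
  then show ?thesis using assms(1,3)
    by (force simp: no_adjacent_ones_def nth_list_update)
qed

lemma is_index_update: "is_index k \<Longrightarrow> is_index (k[i := Suc (k ! i)])"
  by (auto simp: is_index_def dest!: set_update_subset_insert[THEN subsetD])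

lemma is_index_rev [simp]: "is_index (rev k) \<longleftrightarrow> is_index k"
  by (simp add: is_index_def)

lemma is_index_take: "is_index k \<Longrightarrow> is_index (take i k)" and is_index_drop: "is_index k \<Longrightarrow> is_index (drop i k)"
  by (auto simp: is_index_def dest: in_set_takeD in_set_dropD)

section \<open>The coefficient of t\<close>

lemma map2_add_zero: "map2 (+) k (replicate (length k) 0) = (k :: nat list)"
  by (induction k) auto

lemma zeta_shifted_0: "zeta_shifted b 0 k = zeta_reg b k"
proof -
  have "{l. length l = length k \<and> sum_list l = 0} = {replicate (length k) (0::nat)}"
    by (auto simp: sum_list_eq_0_iff intro!: replicate_eqI)
  then show ?thesis by (simp add: zeta_shifted_def map2_add_zero del: zeta_reg.simps)
qed

lemma sum_list_eq_1:
  "{l. length l = n \<and> sum_list l = (1::nat)} = (\<lambda>i. (replicate n 0)[i := 1]) ` {..<n}"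
proof (induction n)
  case 0
  then show ?case by auto
next
  case (Suc n)
  have 0: "{l. length l = n \<and> sum_list l = 0} = {replicate n (0::nat)}"
    by (auto simp: sum_list_eq_0_iff intro!: replicate_eqI)
  have "{l. length l = Suc n \<and> sum_list l = (1::nat)} =
     (\<lambda>l. 0 # l) ` {l. length l = n \<and> sum_list l = 1} \<union> (\<lambda>l. 1 # l) ` {l. length l = n \<and> sum_list l = 0}"
    (is "?A = ?B")
  proof
    show "?A \<subseteq> ?B"
    proof
      fix l assume "l \<in> ?A"
      then obtain a l' where l: "l = a # l'" "length l' = n" "a + sum_list l' = 1"
        by (cases l) auto
      then have "a = 0 \<or> a = 1" by auto
      with l show "l \<in> ?B" by auto
    qed
  qed auto
  also have "\<dots> = (\<lambda>i. (replicate (Suc n) 0)[i := 1]) ` {..<Suc n}"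
    unfolding Suc 0 lessThan_Suc_eq_insert_0 by (auto simp: image_image)
  finally show ?case .
qed

text \<open>Total shift 1 means that a single entry is raised by 1; its binomial is k_i choose 1,
  all others are 1.\<close>

lemma zeta_shifted_1: "zeta_shifted b 1 k = (\<Sum>i<length k. real (k ! i) * zeta_reg b (k[i := Suc (k ! i)]))"
proof -
  let ?n = "length k"
  let ?e = "\<lambda>i. (replicate ?n 0)[i := 1::nat]"
  have inj: "inj_on ?e {..<?n}"
  proof (rule inj_onI)
    fix i j assume "i \<in> {..<?n}" "j \<in> {..<?n}" "?e i = ?e j"
    then have "?e i ! i = ?e j ! i" by simp
    with \<open>i \<in> {..<?n}\<close> show "i = j" by (cases "i = j") auto
  qed
  have "zeta_shifted b 1 k = (\<Sum>i<?n. zeta_reg b (map2 (+) k (?e i)) *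
        (\<Prod>j<?n. real ((k ! j + ?e i ! j - 1) choose (?e i ! j))))"
    unfolding zeta_shifted_def sum_list_eq_1 by (subst sum.reindex[OF inj]) simp
  also have "\<dots> = (\<Sum>i<?n. real (k ! i) * zeta_reg b (k[i := Suc (k ! i)]))"
  proof (rule sum.cong)
    fix i assume i: "i \<in> {..<?n}"
    have "map2 (+) k (?e i) = k[i := Suc (k ! i)]"
      using i by (intro nth_equalityI) (auto simp: nth_list_update)
    moreover have "(\<Prod>j<?n. real ((k ! j + ?e i ! j - 1) choose (?e i ! j))) = (\<Prod>j<?n. if j = i then real (k ! i) else 1)"
      using i by (intro prod.cong) (auto simp: nth_list_update)
    ultimately show "zeta_reg b (map2 (+) k (?e i)) * (\<Prod>j<?n. real ((k ! j + ?e i ! j - 1) choose (?e i ! j))) =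
       real (k ! i) * zeta_reg b (k[i := Suc (k ! i)])"
      using i by (simp del: zeta_reg.simps)
  qed simp
  finally show ?thesis .
qed

lemma word_Cons: "word (a # k) = Y # replicate (a - 1) X @ word k"
  by (simp add: word_def)

lemma sh_X_replicate:
  fixes g :: "letter list \<Rightarrow> real"
  shows "sh g [X] (replicate m X @ v) = real m * g (replicate (Suc m) X @ v) + sh (\<lambda>w. g (replicate m X @ w)) [X] v"
proof (induction m arbitrary: g)
  case (Suc m)
  have "sh g [X] (replicate (Suc m) X @ v) = g (X # replicate (Suc m) X @ v) + sh (\<lambda>w. g (X # w)) [X] (replicate m X @ v)"
    by simp
  also have "\<dots> = g (X # replicate (Suc m) X @ v) + (real m * g (X # replicate (Suc m) X @ v)
       + sh (\<lambda>w. g (X # replicate m X @ w)) [X] v)"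
    by (simp only: Suc)
  finally show ?case by (simp add: algebra_simps)
qed simp

text \<open>Within the block y x^(a-1) the new x has a positions, all giving y x^a; the remaining
  position is in front of the whole word.\<close>

lemma sh_X_word:
  fixes f :: "letter list \<Rightarrow> real"
  assumes "is_index k"
  shows "sh f [X] (word k) = f (X # word k) + (\<Sum>i<length k. real (k ! i) * f (word (k[i := Suc (k ! i)])))"
  using assms
proof (induction k arbitrary: f)
  case (Cons a k)
  define m where "m = a - 1"
  have a: "a = Suc m" "is_index k" using Cons.prems by (auto simp: m_def)
  have e: "replicate m X @ X # w = X # replicate m X @ w" for w
    by (metis append.assoc append_Cons append_Nil replicate_append_same)
  have "sh f [X] (word (a # k)) = f (X # word (a # k)) + sh (\<lambda>w. f (Y # w)) [X] (replicate m X @ word k)"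
    by (simp add: word_Cons m_def)
  also have "sh (\<lambda>w. f (Y # w)) [X] (replicate m X @ word k) =
     real m * f (Y # X # replicate m X @ word k) + sh (\<lambda>w. f (Y # replicate m X @ w)) [X] (word k)"
    by (subst sh_X_replicate) simp
  also have "sh (\<lambda>w. f (Y # replicate m X @ w)) [X] (word k) = f (Y # X # replicate m X @ word k) +
     (\<Sum>i<length k. real (k ! i) * f (Y # replicate m X @ word (k[i := Suc (k ! i)])))"
    using Cons.IH[OF a(2), of "\<lambda>w. f (Y # replicate m X @ w)"] by (simp only: e)
  finally show ?case
    by (simp add: a(1) word_Cons sum.lessThan_Suc_shift algebra_simps del: sum.lessThan_Suc)
qed simp

lemma shuffle_zeta_X_word:
  assumes "is_index k"
  shows "shuffle_zeta (X # word k) = - (\<Sum>i<length k. real (k ! i) * shuffle_zeta (word (k[i := Suc (k ! i)])))"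
  using sh_X_word[OF assms, of shuffle_zeta] is_char_shuffle_zeta by (simp add: is_char_def)

text \<open>Since \<chi>(x) = 0, the shuffle of x with the word has value 0, which exchanges the
  weighted sum over raised entries for one word with x in front.\<close>

lemma zeta_shifted_1_eq:
  assumes "is_index k" "no_adjacent_ones k"
  shows "zeta_shifted b 1 k = - shuffle_zeta (X # word k)"
  unfolding zeta_shifted_1 shuffle_zeta_X_word[OF assms(1)] minus_minus
  using assms by (intro sum.cong refl arg_cong2[where f = "(*)"] zeta_reg_eq_shuffle_zeta is_index_update
      no_adjacent_ones_trail no_adjacent_ones_update) auto

lemma lie_from_X: "lie_from \<phi> p (replicate m X @ w) = lie_from \<phi> (p @ replicate m X) w"
proof (induction m arbitrary: p)
  case (Suc m)
  then show ?case using Suc[of "p @ [X]"] by simp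
qed simp

lemma lie_from_word:
  "lie_from \<phi> p (word k @ r) = (\<Sum>i<length k. \<phi> (p @ word (take i k)) *
      antip \<phi> (replicate (k ! i - 1) X @ word (drop (Suc i) k) @ r)) + lie_from \<phi> (p @ word k) r"
proof (induction k arbitrary: p)
  case (Cons a k)
  show ?case
    by (simp add: word_Cons lie_from_X Cons sum.lessThan_Suc_shift del: sum.lessThan_Suc)
qed simp

lemma rev_word: "Y # rev (word k) = word (rev k) @ [Y]"
proof (induction k)
  case (Cons a k)
  have "Y # rev (word (a # k)) = (Y # rev (word k)) @ replicate (a - 1) X @ [Y]"
    by (simp add: word_Cons)
  also have "\<dots> = word (rev (a # k)) @ [Y]" unfolding Cons by (simp add: word_snoc)
  finally show ?case .
qed simp

text \<open>A cut at the y opening a block leaves the rest of that block, the later blocks and the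
  final y. Read backwards this is an index word, with the final y as its first letter.\<close>

lemma rev_word_suffix: "rev (replicate (a - 1) X @ word k @ [Y]) = word (rev (a # k))"
proof -
  have "rev (replicate (a - 1) X @ word k @ [Y]) = (Y # rev (word k)) @ replicate (a - 1) X" by simp
  also have "\<dots> = word (rev (a # k))" unfolding rev_word by (simp add: word_snoc)
  finally show ?thesis .
qed

lemma length_word: "is_index k \<Longrightarrow> length (word k) = sum_list k"
  by (induction k) (auto simp: word_Cons)

text \<open>The cut at the y opening the block of \<open>k ! i\<close> is the summand i of the
  definition, the cut at the final y is the last summand; word length equals weight, which gives the
  sign. For the coefficient of t the final x comes to the front on reversal, as in
  \<open>zeta_shifted_1_eq\<close>.\<close>

lemma zeta_S_hat_coeffs:
  assumes k: "is_index k" "no_adjacent_ones k"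
  shows "fps_nth (zeta_S_hat b k) 0 = lie_of Y shuffle_zeta (word k @ [Y])"
    and "fps_nth (zeta_S_hat b k) 1 = lie_of Y shuffle_zeta (word k @ [Y, X])"
proof -
  have nice: "zeta_reg b (take i k) = shuffle_zeta (word (take i k))"
    "zeta_reg b (rev (drop i k)) = shuffle_zeta (word (rev (drop i k)))"
    "zeta_shifted b 1 (rev (drop i k)) = - shuffle_zeta (X # word (rev (drop i k)))" for i
    using k by (auto intro!: zeta_reg_eq_shuffle_zeta[OF _ no_adjacent_ones_trail] zeta_shifted_1_eq
        no_adjacent_ones_take no_adjacent_ones_rev no_adjacent_ones_drop is_index_take is_index_drop
        simp del: zeta_reg.simps One_nat_def)
  have d: "drop i k = k ! i # drop (Suc i) k" if "i < length k" for i
    using that by (simp add: Cons_nth_drop_Suc)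
  have len: "Suc (k ! i - 1 + length (word (drop (Suc i) k))) = sum_list (drop i k)" if "i < length k" for i
  proof -
    have "length (word (drop i k)) = sum_list (drop i k)" using k by (intro length_word is_index_drop)
    then show ?thesis using that by (simp add: d word_Cons)
  qed
  have r0: "antip shuffle_zeta (replicate (k ! i - 1) X @ word (drop (Suc i) k) @ [Y]) =
     (- 1) ^ sum_list (drop i k) * shuffle_zeta (word (rev (drop i k)))" if "i < length k" for i
    using len[OF that] rev_word_suffix[of "k ! i" "drop (Suc i) k"] by (simp add: antip_def d[OF that])
  have r1: "antip shuffle_zeta (replicate (k ! i - 1) X @ word (drop (Suc i) k) @ [Y, X]) =
     - ((- 1) ^ sum_list (drop i k) * shuffle_zeta (X # word (rev (drop i k))))" if "i < length k" for i
    using len[OF that] rev_word_suffix[of "k ! i" "drop (Suc i) k"] by (simp add: antip_def d[OF that])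
  have z: "zeta_reg b [] = 1"
    using nice(1)[of 0] is_char_shuffle_zeta by (simp add: is_char_def del: zeta_reg.simps)
  have z1: "zeta_shifted b (Suc 0) [] = 0"
    using zeta_shifted_1[of b "[]"] by simp
  have a: "antip shuffle_zeta [] = 1" "antip shuffle_zeta [X] = 0" "shuffle_zeta [] = 1"
    using is_char_shuffle_zeta by (simp_all add: antip_def is_char_def)
  have s0: "(\<Sum>i<length k. shuffle_zeta ([] @ word (take i k)) * antip shuffle_zeta (replicate (k ! i - 1) X @ word (drop (Suc i) k) @ [Y])) =
     (\<Sum>i<length k. shuffle_zeta ([] @ word (take i k)) * ((- 1) ^ sum_list (drop i k) * shuffle_zeta (word (rev (drop i k)))))"
    by (rule sum.cong) (simp_all only: r0 lessThan_iff)
  have s1: "(\<Sum>i<length k. shuffle_zeta ([] @ word (take i k)) * antip shuffle_zeta (replicate (k ! i - 1) X @ word (drop (Suc i) k) @ [Y, X])) =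
     (\<Sum>i<length k. shuffle_zeta ([] @ word (take i k)) * - ((- 1) ^ sum_list (drop i k) * shuffle_zeta (X # word (rev (drop i k)))))"
    by (rule sum.cong) (simp_all only: r1 lessThan_iff)
  show "fps_nth (zeta_S_hat b k) 0 = lie_of Y shuffle_zeta (word k @ [Y])"
    unfolding zeta_S_hat_nth lie_of_eq lie_from_word lessThan_Suc_atMost[symmetric] sum.lessThan_Suc s0 zeta_shifted_0 nice
    using nice(1)[of "length k"] by (simp add: z a mult_ac del: zeta_reg.simps)
  show "fps_nth (zeta_S_hat b k) 1 = lie_of Y shuffle_zeta (word k @ [Y, X])"
    unfolding zeta_S_hat_nth lie_of_eq lie_from_word lessThan_Suc_atMost[symmetric] sum.lessThan_Suc s1 nice
    by (simp add: z1 a mult_ac)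
qed

section \<open>Evaluation of the values at two and three\<close>

text \<open>\<open>T i N\<close> plays the role of the sum over \<open>N < n\<^sub>i\<^sub>+\<^sub>1 < \<dots> < n\<^sub>r\<close>; only its recursion and its decay matter.\<close>

lemma mzv_tail_eqI:
  assumes "\<And>N. T (length k) N = 1"
    and "\<And>i N. i < length k \<Longrightarrow> T i N - T i (Suc N) = T (Suc i) (Suc N) / real (Suc N) ^ (k ! i)"
    and "\<And>i. i < length k \<Longrightarrow> admissible (take i k)"
    and "\<And>i. i < length k \<Longrightarrow> (\<lambda>N. T i N) \<longlonglongrightarrow> 0"
  shows "mzv k = T 0 0"
proof (rule mzv_eqI)
  let ?r = "length k"
  \<comment> \<open>\<open>S N\<close> splits the series by the number i of summation variables at
    most N, hence is constant. At N = 0 only i = 0 survives, in the limit only i = r.\<close>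
  define S where "S N = (\<Sum>i\<le>?r. zpart N (take i k) * T i N)" for N
  have "S (Suc N) = S N" for N
  proof -
    have z: "zpart (Suc N) (take (Suc j) k) = zpart N (take (Suc j) k) + zpart N (take j k) / real (Suc N) ^ (k ! j)"
      if "j < ?r" for j
      using that by (simp add: take_Suc_conv_app_nth zpart_Suc)
    have "S (Suc N) = T 0 (Suc N) + (\<Sum>j<?r. zpart (Suc N) (take (Suc j) k) * T (Suc j) (Suc N))"
      unfolding S_def lessThan_Suc_atMost[symmetric] sum.lessThan_Suc_shift by simp
    also have "(\<Sum>j<?r. zpart (Suc N) (take (Suc j) k) * T (Suc j) (Suc N)) =
        (\<Sum>j<?r. zpart N (take (Suc j) k) * T (Suc j) (Suc N)) +
        (\<Sum>j<?r. zpart N (take j k) * T j N - zpart N (take j k) * T j (Suc N))"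
      unfolding sum.distrib[symmetric]
    proof (rule sum.cong)
      fix j assume j: "j \<in> {..<?r}"
      then have e: "T (Suc j) (Suc N) / real (Suc N) ^ (k ! j) = T j N - T j (Suc N)" using assms(2)[of j N] by simp
      have "zpart (Suc N) (take (Suc j) k) * T (Suc j) (Suc N) = zpart N (take (Suc j) k) * T (Suc j) (Suc N) +
         zpart N (take j k) * (T (Suc j) (Suc N) / real (Suc N) ^ (k ! j))"
        using j by (simp add: z distrib_right)
      then show "zpart (Suc N) (take (Suc j) k) * T (Suc j) (Suc N) = zpart N (take (Suc j) k) * T (Suc j) (Suc N) +
         (zpart N (take j k) * T j N - zpart N (take j k) * T j (Suc N))"
        by (simp only: e right_diff_distrib)
    qed simp
    also have "T 0 (Suc N) + ((\<Sum>j<?r. zpart N (take (Suc j) k) * T (Suc j) (Suc N)) +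
        (\<Sum>j<?r. zpart N (take j k) * T j N - zpart N (take j k) * T j (Suc N))) =
       (\<Sum>j<Suc ?r. zpart N (take j k) * T j (Suc N)) +
        (\<Sum>j<?r. zpart N (take j k) * T j N - zpart N (take j k) * T j (Suc N))"
      unfolding sum.lessThan_Suc_shift by simp
    also have "\<dots> = S N"
      unfolding S_def lessThan_Suc_atMost[symmetric] sum_subtractf by (simp add: assms(1))
    finally show ?thesis .
  qed
  then have "S N = S 0" for N by (induction N) auto
  moreover have "S 0 = T 0 0"
  proof -
    have "S 0 = (\<Sum>i\<le>?r. if i = 0 then T 0 0 else 0)"
      unfolding S_def by (intro sum.cong) (auto intro!: zpart_0)
    then show ?thesis by (simp add: sum.delta)
  qed
  ultimately have "zpart N k = T 0 0 - (\<Sum>i<?r. zpart N (take i k) * T i N)" for N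
    using assms(1) unfolding S_def lessThan_Suc_atMost[symmetric] sum.lessThan_Suc
    by (metis add_diff_cancel_left' mult.right_neutral order_refl take_all)
  moreover have "(\<lambda>N. T 0 0 - (\<Sum>i<?r. zpart N (take i k) * T i N)) \<longlonglongrightarrow> T 0 0 - (\<Sum>i<?r. mzv (take i k) * 0)"
  proof (intro tendsto_intros)
    fix i assume i: "i \<in> {..<?r}"
    then show "T i \<longlonglongrightarrow> 0" using assms(4) by simp
    have "negl sequentially harm (\<lambda>N. zpart N (take i k) - mzv (take i k))"
      using i assms(3) by (intro admissible_limits) auto
    from neglD[OF this, of 0] show "(\<lambda>N. zpart N (take i k)) \<longlonglongrightarrow> mzv (take i k)"
      by (simp add: LIM_zero_iff)
  qed
  ultimately show "(\<lambda>N. zpart N k) \<longlonglongrightarrow> T 0 0" by simp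
qed

section \<open>Wallis integrals and the index consisting of twos\<close>

definition wallis :: "nat \<Rightarrow> real" where
  "wallis m = integral {0..pi/2} (\<lambda>x. cos x ^ (2 * m))"

lemma integrable_continuous_pi2: "continuous_on {0..pi/2} f \<Longrightarrow> (f :: real \<Rightarrow> real) integrable_on {0..pi/2}"
  by (rule integrable_continuous_real)

lemma deriv_cos_power_Suc:
  "((\<lambda>x. cos x ^ Suc n) has_real_derivative real (Suc n) * (- sin x * cos x ^ n)) (at x within A)"
  using DERIV_power_Suc[OF has_field_derivative_at_within[OF DERIV_cos, of x A], of n] by simp

lemma deriv_cos_power:
  "((\<lambda>x. cos x ^ (2 * Suc k)) has_real_derivative - (2 * real k + 2) * cos x ^ (2 * k + 1) * sin x) (at x within A)"
  using deriv_cos_power_Suc[of "2 * k + 1" x A] by (simp add: algebra_simps)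

lemma deriv_cos_power2:
  "((\<lambda>x. - (2 * real k + 2) * cos x ^ (2 * k + 1) * sin x) has_real_derivative
     (2 * real k + 2) * (2 * real k + 1) * cos x ^ (2 * k) - (2 * real k + 2)^2 * cos x ^ (2 * Suc k)) (at x within A)"
proof -
  have s: "sin x * sin x = 1 - cos x * cos x" by (simp add: sin_squared_eq[unfolded power2_eq_square])
  have "((\<lambda>x. - (2 * real k + 2) * cos x ^ Suc (2 * k) * sin x) has_real_derivative
     (- (2 * real k + 2)) * (real (Suc (2 * k)) * (- sin x * cos x ^ (2 * k))) * sin x + cos x * ((- (2 * real k + 2)) * cos x ^ Suc (2 * k))) (at x within A)"
    by (intro DERIV_mult DERIV_cmult deriv_cos_power_Suc has_field_derivative_at_within[OF DERIV_sin])
  then have "((\<lambda>x. - (2 * real k + 2) * cos x ^ (2 * k + 1) * sin x) has_real_derivative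
     (- (2 * real k + 2)) * (real (2 * k + 1) * cos x ^ (2 * k) * (- sin x)) * sin x + (- (2 * real k + 2)) * cos x ^ (2 * k + 1) * cos x) (at x within A)"
    by (simp add: algebra_simps)
  also have "(- (2 * real k + 2)) * (real (2 * k + 1) * cos x ^ (2 * k) * (- sin x)) * sin x + (- (2 * real k + 2)) * cos x ^ (2 * k + 1) * cos x
    = (2 * real k + 2) * (2 * real k + 1) * cos x ^ (2 * k) * (sin x * sin x) - (2 * real k + 2) * cos x ^ (2 * k) * (cos x * cos x)"
    by (simp add: algebra_simps)
  also have "\<dots> = (2 * real k + 2) * (2 * real k + 1) * cos x ^ (2 * k) - (2 * real k + 2)^2 * cos x ^ (2 * Suc k)"
    unfolding s by (simp add: algebra_simps power2_eq_square)
  finally show ?thesis .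
qed

text \<open>Two integrations by parts move the second derivative onto the cosine power. The boundary
  terms vanish by cos (pi/2) = 0, sin 0 = 0 and f' 0 = 0.\<close>

lemma cos_power_parts:
  assumes "\<And>x. (f has_real_derivative f' x) (at x)" "\<And>x. (f' has_real_derivative f'' x) (at x)" "f' 0 = 0"
    and "continuous_on UNIV f''"
  shows "integral {0..pi/2} (\<lambda>x. cos x ^ (2 * Suc k) * f'' x) =
     (2 * real k + 2) * (2 * real k + 1) * integral {0..pi/2} (\<lambda>x. cos x ^ (2 * k) * f x)
     - (2 * real k + 2)^2 * integral {0..pi/2} (\<lambda>x. cos x ^ (2 * Suc k) * f x)"
proof -
  let ?g1 = "\<lambda>x. - (2 * real k + 2) * cos x ^ (2 * k + 1) * sin x"
  let ?g2 = "\<lambda>x. (2 * real k + 2) * (2 * real k + 1) * cos x ^ (2 * k) - (2 * real k + 2)^2 * cos x ^ (2 * Suc k)"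
  have cf: "continuous_on A f" for A
    using assms(1) DERIV_isCont by (intro continuous_at_imp_continuous_on) blast
  have cf'': "continuous_on A f''" for A
    using assms(4) by (rule continuous_on_subset) simp
  note ci = continuous_intros cf cf''
  have "((\<lambda>x. cos x ^ (2 * Suc k) * f'' x - ?g2 x * f x) has_integral
     ((\<lambda>x. cos x ^ (2 * Suc k) * f' x - ?g1 x * f x) (pi/2) - (\<lambda>x. cos x ^ (2 * Suc k) * f' x - ?g1 x * f x) 0)) {0..pi/2}"
  proof (rule fundamental_theorem_of_calculus)
    fix x :: real
    have "((\<lambda>x. cos x ^ (2 * Suc k) * f' x - ?g1 x * f x) has_real_derivative
       (?g1 x * f' x + f'' x * cos x ^ (2 * Suc k)) - (?g2 x * f x + f' x * ?g1 x)) (at x)"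
      by (intro DERIV_diff DERIV_mult deriv_cos_power deriv_cos_power2 assms(1,2))
    moreover have "(a * b + c * d) - (e * g + b * a) = d * c - e * g" for a b c d e g :: real
      by (simp add: algebra_simps)
    ultimately have "((\<lambda>x. cos x ^ (2 * Suc k) * f' x - ?g1 x * f x) has_real_derivative
       cos x ^ (2 * Suc k) * f'' x - ?g2 x * f x) (at x)" by (simp only:)
    then show "((\<lambda>x. cos x ^ (2 * Suc k) * f' x - ?g1 x * f x) has_vector_derivative
       cos x ^ (2 * Suc k) * f'' x - ?g2 x * f x) (at x within {0..pi/2})"
      unfolding has_real_derivative_iff_has_vector_derivative by (rule has_vector_derivative_at_within)
  qed simp
  then have "integral {0..pi/2} (\<lambda>x. cos x ^ (2 * Suc k) * f'' x - ?g2 x * f x) = 0"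
    using assms(3) by (simp add: integral_unique)
  moreover have "integral {0..pi/2} (\<lambda>x. cos x ^ (2 * Suc k) * f'' x - ?g2 x * f x) =
     integral {0..pi/2} (\<lambda>x. cos x ^ (2 * Suc k) * f'' x) - integral {0..pi/2} (\<lambda>x. ?g2 x * f x)"
    by (intro integral_diff integrable_continuous_pi2 ci)
  moreover have "integral {0..pi/2} (\<lambda>x. ?g2 x * f x) =
     integral {0..pi/2} (\<lambda>x. (2 * real k + 2) * (2 * real k + 1) * (cos x ^ (2 * k) * f x)
        - (2 * real k + 2)^2 * (cos x ^ (2 * Suc k) * f x))"
    by (simp only: left_diff_distrib mult.assoc)
  moreover have "\<dots> = (2 * real k + 2) * (2 * real k + 1) * integral {0..pi/2} (\<lambda>x. cos x ^ (2 * k) * f x)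
     - (2 * real k + 2)^2 * integral {0..pi/2} (\<lambda>x. cos x ^ (2 * Suc k) * f x)"
  proof -
    have "integral {0..pi/2} (\<lambda>x. (2 * real k + 2) * (2 * real k + 1) * (cos x ^ (2 * k) * f x)
        - (2 * real k + 2)^2 * (cos x ^ (2 * Suc k) * f x)) =
      integral {0..pi/2} (\<lambda>x. (2 * real k + 2) * (2 * real k + 1) * (cos x ^ (2 * k) * f x))
       - integral {0..pi/2} (\<lambda>x. (2 * real k + 2)^2 * (cos x ^ (2 * Suc k) * f x))"
      by (intro integral_diff integrable_continuous_pi2 ci)
    then show ?thesis by (simp only: integral_mult_right)
  qed
  ultimately show ?thesis by linarith
qed

lemma wallis_Suc: "(2 * real k + 2) * wallis (Suc k) = (2 * real k + 1) * wallis k"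
proof -
  have "0 = (2 * real k + 2) * ((2 * real k + 1) * wallis k - (2 * real k + 2) * wallis (Suc k))"
    using cos_power_parts[of "\<lambda>_. 1" "\<lambda>_. 0" "\<lambda>_. 0" k]
    by (simp add: wallis_def algebra_simps power2_eq_square)
  then show ?thesis by simp
qed

lemma wallis_0: "wallis 0 = pi / 2"
  by (simp add: wallis_def)

lemma wallis_pos: "wallis m > 0"
proof (induction m)
  case (Suc m)
  have "(2 * real m + 2) * wallis (Suc m) > 0" unfolding wallis_Suc using Suc by simp
  then show ?case by (simp add: zero_less_mult_iff)
qed (simp add: wallis_0)

text \<open>The left side does not decrease with m, because (4m+1)(2m+2)^2 and (2m+1)^2 (4m+5)
  differ by 1 in the right direction. So \<open>wallis m\<close> is at least of order 1/sqrt m,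
  enough for the tails to vanish.\<close>

lemma wallis_lower: "wallis m ^ 2 * (4 * real m + 1) \<ge> (pi/2)^2"
proof (induction m)
  case (Suc m)
  have "wallis (Suc m) = (2 * real m + 1) / (2 * real m + 2) * wallis m"
    using wallis_Suc[of m] by (simp add: field_simps)
  then have "wallis (Suc m) ^ 2 * (4 * real (Suc m) + 1) =
     wallis m ^ 2 * ((2 * real m + 1)^2 / (2 * real m + 2)^2 * (4 * real m + 5))"
  proof -
    have "wallis (Suc m) ^ 2 = wallis m ^ 2 * ((2 * real m + 1)^2 / (2 * real m + 2)^2)"
      unfolding \<open>wallis (Suc m) = _\<close> power_mult_distrib power_divide by (rule mult.commute)
    moreover have "4 * real (Suc m) + 1 = 4 * real m + 5" by simp
    ultimately show ?thesis by (simp only: mult.assoc)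
  qed
  moreover have "(4 * real m + 1) \<le> (2 * real m + 1)^2 / (2 * real m + 2)^2 * (4 * real m + 5)"
  proof -
    have "(4 * real m + 1) * (2 * real m + 2)^2 \<le> (2 * real m + 1)^2 * (4 * real m + 5)"
      by (simp add: power2_eq_square algebra_simps)
    moreover have "(2 * real m + 2)^2 > 0" by simp
    ultimately show ?thesis by (simp add: pos_le_divide_eq)
  qed
  then have "wallis m ^ 2 * (4 * real m + 1) \<le> wallis m ^ 2 * ((2 * real m + 1)^2 / (2 * real m + 2)^2 * (4 * real m + 5))"
    by (rule mult_left_mono) simp
  ultimately show ?case using Suc by linarith
qed (simp add: wallis_0)

lemma wallis_decay: "(\<lambda>m. C / (2 * real m * wallis m)) \<longlonglongrightarrow> 0"
proof (rule Lim_null_comparison)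
  show "\<forall>\<^sub>F m in sequentially. norm (C / (2 * real m * wallis m)) \<le> \<bar>C\<bar> * sqrt (4 * real m + 1) / (2 * real m * (pi/2))"
  proof (intro eventually_sequentiallyI[of 1])
    fix m :: nat assume m: "1 \<le> m"
    have "pi/2 = sqrt ((pi/2)^2)" by simp
    also have "\<dots> \<le> sqrt (wallis m ^ 2 * (4 * real m + 1))" using wallis_lower by (rule real_sqrt_le_mono)
    also have "\<dots> = wallis m * sqrt (4 * real m + 1)" using wallis_pos[of m] by (simp add: real_sqrt_mult)
    finally have "1 / wallis m \<le> sqrt (4 * real m + 1) / (pi/2)"
      using wallis_pos[of m] by (simp add: divide_simps mult_ac)
    then have "\<bar>C\<bar> / (2 * real m) * (1 / wallis m) \<le> \<bar>C\<bar> / (2 * real m) * (sqrt (4 * real m + 1) / (pi/2))"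
      by (rule mult_left_mono) simp
    moreover have "norm (C / (2 * real m * wallis m)) = \<bar>C\<bar> / (2 * real m) * (1 / wallis m)"
      using wallis_pos[of m] by (simp add: abs_mult)
    ultimately show "norm (C / (2 * real m * wallis m)) \<le> \<bar>C\<bar> * sqrt (4 * real m + 1) / (2 * real m * (pi/2))"
      by (simp only: times_divide_times_eq)
  qed
  show "(\<lambda>m. \<bar>C\<bar> * sqrt (4 * real m + 1) / (2 * real m * (pi/2))) \<longlonglongrightarrow> 0" by real_asymp
qed

text \<open>The closed form of the tail sums of \<open>\<zeta>({2}\<^sup>b)\<close> over \<open>m < n\<^sub>1 < \<dots> < n\<^sub>b\<close>.\<close>

definition tail2 :: "nat \<Rightarrow> nat \<Rightarrow> real" where
  "tail2 b m = integral {0..pi/2} (\<lambda>x. cos x ^ (2 * m) * ((2 * x) ^ (2 * b) / fact (2 * b))) / wallis m"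

lemma tail2_0: "tail2 0 m = 1"
  using wallis_pos[of m] by (simp add: tail2_def wallis_def)

lemma deriv_even_monomial:
  "((\<lambda>x. (2 * x) ^ Suc n / fact (Suc n)) has_real_derivative 2 * ((2 * x) ^ n / fact n)) (at x)"
proof -
  have "((\<lambda>x::real. 2 * x) has_real_derivative 2) (at x)"
    by (auto intro!: derivative_eq_intros)
  from DERIV_cdivide[OF DERIV_power_Suc[OF this, of n], of "fact (Suc n)"]
  have "((\<lambda>x. (2 * x) ^ Suc n / fact (Suc n)) has_real_derivative (real (Suc n) * (2 * x) ^ n * 2) / fact (Suc n)) (at x)"
    by (simp only: of_nat_Suc mult_ac add.commute)
  also have "(real (Suc n) * (2 * x) ^ n * 2) / fact (Suc n) = 2 * ((2 * x) ^ n / fact n)"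
    by (simp add: fact_Suc divide_simps del: of_nat_Suc)
  finally show ?thesis .
qed

text \<open>\<open>cos_power_parts\<close> for the monomial whose second derivative is 4 times the
  next lower one. After division by \<open>wallis\<close> both tails carry the common coefficient
  (2k+2)^2 = 4 (k+1)^2.\<close>

lemma tail2_Suc: "tail2 (Suc b) k - tail2 (Suc b) (Suc k) = tail2 b (Suc k) / real (Suc k) ^ 2"
proof -
  let ?A = "\<lambda>m. integral {0..pi/2} (\<lambda>x. cos x ^ (2 * m) * ((2 * x) ^ (2 * Suc b) / fact (2 * Suc b)))"
  let ?B = "integral {0..pi/2} (\<lambda>x. cos x ^ (2 * Suc k) * ((2 * x) ^ (2 * b) / fact (2 * b)))"
  have d2: "((\<lambda>x. 2 * ((2 * x) ^ Suc (2 * b) / fact (Suc (2 * b)))) has_real_derivative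
      2 * (2 * ((2 * x) ^ (2 * b) / fact (2 * b)))) (at x)" for x :: real
    by (intro DERIV_cmult deriv_even_monomial)
  have d1: "((\<lambda>x. (2 * x) ^ (2 * Suc b) / fact (2 * Suc b)) has_real_derivative
      2 * ((2 * x) ^ Suc (2 * b) / fact (Suc (2 * b)))) (at x)" for x :: real
    using deriv_even_monomial[of "Suc (2 * b)" x] by (simp only: mult_Suc_right add_2_eq_Suc)
  have "integral {0..pi/2} (\<lambda>x. cos x ^ (2 * Suc k) * (2 * (2 * ((2 * x) ^ (2 * b) / fact (2 * b))))) =
     (2 * real k + 2) * (2 * real k + 1) * ?A k - (2 * real k + 2)^2 * ?A (Suc k)"
    by (rule cos_power_parts[OF d1 d2]) (auto intro!: continuous_intros)
  moreover have "integral {0..pi/2} (\<lambda>x. cos x ^ (2 * Suc k) * (2 * (2 * ((2 * x) ^ (2 * b) / fact (2 * b))))) = 4 * ?B"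
    unfolding integral_mult_right[symmetric] by (intro integral_cong) simp
  ultimately have "4 * ?B = (2 * real k + 2) * (2 * real k + 1) * ?A k - (2 * real k + 2)^2 * ?A (Suc k)" by simp
  then have "4 * ?B / wallis (Suc k) = (2 * real k + 2)^2 * (tail2 (Suc b) k - tail2 (Suc b) (Suc k))"
  proof -
    have "(2 * real k + 2) * (2 * real k + 1) * ?A k / wallis (Suc k) = (2 * real k + 2)^2 * (?A k / wallis k)"
    proof -
      have "(2 * real k + 1) / wallis (Suc k) = (2 * real k + 2) / wallis k"
        using wallis_Suc[of k] wallis_pos[of k] wallis_pos[of "Suc k"] by (simp add: divide_simps mult.commute)
      then have "(2 * real k + 2) * ?A k * ((2 * real k + 1) / wallis (Suc k)) = (2 * real k + 2) * ?A k * ((2 * real k + 2) / wallis k)"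
        by simp
      then show ?thesis by (simp only: times_divide_eq_right times_divide_eq_left power2_eq_square mult_ac)
    qed
    then show ?thesis unfolding \<open>4 * ?B = _\<close> tail2_def by (simp only: diff_divide_distrib right_diff_distrib times_divide_eq_right)
  qed
  moreover have "4 * ?B / wallis (Suc k) = 4 * tail2 b (Suc k)" by (simp add: tail2_def)
  ultimately have "4 * tail2 b (Suc k) = 4 * (real (Suc k)^2 * (tail2 (Suc b) k - tail2 (Suc b) (Suc k)))"
    by (simp add: power2_eq_square algebra_simps)
  then show ?thesis by (simp add: divide_simps mult.commute del: of_nat_Suc)
qed

lemma integral_cos_power_sin:
  assumes "0 \<le> t" "t \<le> pi/2"
  shows "((\<lambda>x. cos x ^ (2 * k + 1) * sin x) has_integral cos t ^ (2 * Suc k) / (2 * real k + 2)) {t..pi/2}"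
proof -
  have "((\<lambda>x. - (2 * real k + 2) * cos x ^ (2 * k + 1) * sin x) has_integral
     (cos (pi/2) ^ (2 * Suc k) - cos t ^ (2 * Suc k))) {t..pi/2}"
    using assms deriv_cos_power by (intro fundamental_theorem_of_calculus)
     (auto simp: has_real_derivative_iff_has_vector_derivative[symmetric])
  from has_integral_mult_right[OF this, of "- (1 / (2 * real k + 2))"]
  have "((\<lambda>x. - (1 / (2 * real k + 2)) * (- (2 * real k + 2) * cos x ^ (2 * k + 1) * sin x)) has_integral
     - (1 / (2 * real k + 2)) * (cos (pi/2) ^ (2 * Suc k) - cos t ^ (2 * Suc k))) {t..pi/2}" .
  moreover have "- (1 / (2 * real k + 2)) * (- (2 * real k + 2) * a * b) = a * b" for a b
    by (simp add: divide_simps) (simp add: algebra_simps)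
  ultimately show ?thesis by simp
qed

lemma x_cos_le_sin: "0 \<le> x \<Longrightarrow> x \<le> pi/2 \<Longrightarrow> x * cos x \<le> sin x"
proof -
  assume x: "0 \<le> x" "x \<le> pi/2"
  have "(\<lambda>x. sin x - x * cos x) 0 \<le> (\<lambda>x. sin x - x * cos x) x"
  proof (rule DERIV_nonneg_imp_nondecreasing[OF x(1)])
    fix y assume y: "0 \<le> y" "y \<le> x"
    have "((\<lambda>x. sin x - x * cos x) has_real_derivative y * sin y) (at y)"
      by (auto intro!: derivative_eq_intros simp: algebra_simps)
    moreover have "y * sin y \<ge> 0" using x y by (intro mult_nonneg_nonneg sin_ge_zero) auto
    ultimately show "\<exists>d. ((\<lambda>x. sin x - x * cos x) has_real_derivative d) (at y) \<and> 0 \<le> d" by blast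
  qed
  then show ?thesis by simp
qed

lemma tail2_tendsto:
  assumes "b > 0"
  shows "tail2 b \<longlonglongrightarrow> 0"
proof -
  \<comment> \<open>From (2x)^(2b) \<le> 2x pi^(2b-1). The remaining x is absorbed by x cos x \<le>
    sin x, and cos^(2m-1) sin has integral 1/(2m).\<close>
  define C where "C = 2 * pi ^ (2 * b - 1) / fact (2 * b)"
  show ?thesis
  proof (rule Lim_null_comparison[OF _ wallis_decay[of C]], intro eventually_sequentiallyI[of 1])
    fix m :: nat assume m: "1 \<le> m"
    then obtain k where k: "m = Suc k" by (cases m) auto
    have C: "C \<ge> 0" by (simp add: C_def)
    have 1: "integral {0..pi/2} (\<lambda>x. cos x ^ (2 * m) * ((2 * x) ^ (2 * b) / fact (2 * b))) \<le>
       integral {0..pi/2} (\<lambda>x. C * (cos x ^ (2 * k + 1) * sin x))"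
    proof (rule integral_le)
      fix x :: real assume x: "x \<in> {0..pi/2}"
      have "(2 * x) ^ (2 * b) = 2 * x * (2 * x) ^ (2 * b - 1)"
        using assms by (metis Suc_pred' mult_pos_pos pos2 power_Suc)
      also have "\<dots> \<le> 2 * x * pi ^ (2 * b - 1)"
        using x by (intro mult_left_mono power_mono) auto
      finally have "(2 * x) ^ (2 * b) / fact (2 * b) \<le> C * x"
        unfolding C_def by (simp add: divide_right_mono mult_ac)
      then have "cos x ^ (2 * m) * ((2 * x) ^ (2 * b) / fact (2 * b)) \<le> cos x ^ (2 * m) * (C * x)"
        by (rule mult_left_mono) (simp add: power_mult)
      also have "\<dots> = C * (cos x ^ (2 * k + 1) * (x * cos x))" by (simp add: k)
      also have "\<dots> \<le> C * (cos x ^ (2 * k + 1) * sin x)"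
        using x C by (intro mult_left_mono x_cos_le_sin zero_le_power cos_ge_zero) auto
      finally show "cos x ^ (2 * m) * ((2 * x) ^ (2 * b) / fact (2 * b)) \<le> C * (cos x ^ (2 * k + 1) * sin x)" .
    qed (auto intro!: integrable_continuous_pi2 continuous_intros)
    also have "\<dots> = C * (1 / (2 * real k + 2))"
      using integral_cos_power_sin[of 0 k] by (simp add: integral_unique)
    also have "\<dots> = C / (2 * real m)" by (simp add: k)
    finally have 1: "integral {0..pi/2} (\<lambda>x. cos x ^ (2 * m) * ((2 * x) ^ (2 * b) / fact (2 * b))) \<le> C / (2 * real m)" .
    have 2: "integral {0..pi/2} (\<lambda>x. cos x ^ (2 * m) * ((2 * x) ^ (2 * b) / fact (2 * b))) \<ge> 0"
      by (intro integral_nonneg integrable_continuous_pi2 continuous_intros) (auto simp: power_mult)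
    show "norm (tail2 b m) \<le> C / (2 * real m * wallis m)"
      using 1 2 wallis_pos[of m] m by (simp add: tail2_def divide_simps mult_ac)
  qed
qed

lemma admissible_twos: "admissible (replicate i 2)"
  by (cases "i = 0") (auto simp: admissible_def is_index_def last_replicate)

text \<open>At m = 0 the cosine drops out of \<open>tail2\<close>, and only a monomial has to be
  integrated.\<close>

lemma mzv_twos: "mzv (replicate b 2) = pi ^ (2 * b) / fact (2 * b + 1)"
proof -
  have "mzv (replicate b 2) = tail2 (b - 0) 0"
  proof (rule mzv_tail_eqI[where T = "\<lambda>i. tail2 (b - i)"])
    fix i N assume "i < length (replicate b (2::nat))"
    then show "tail2 (b - i) N - tail2 (b - i) (Suc N) = tail2 (b - Suc i) (Suc N) / real (Suc N) ^ (replicate b 2 ! i)"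
      using tail2_Suc[of "b - Suc i" N] by (simp add: Suc_diff_Suc)
  next
    fix i assume i: "i < length (replicate b (2::nat))"
    then have "take i (replicate b 2) = replicate i (2::nat)" by simp
    then show "admissible (take i (replicate b 2))" by (simp only: admissible_twos)
    show "tail2 (b - i) \<longlonglongrightarrow> 0" using i by (intro tail2_tendsto) simp
  qed (simp add: tail2_0)
  also have "\<dots> = pi ^ (2 * b) / fact (2 * b + 1)"
  proof -
    have "((\<lambda>x. 2 * ((2 * x) ^ (2 * b) / fact (2 * b))) has_integral
      ((2 * (pi/2)) ^ Suc (2 * b) / fact (Suc (2 * b)) - (2 * 0) ^ Suc (2 * b) / fact (Suc (2 * b)))) {0..pi/2}"
      by (rule fundamental_theorem_of_calculus, simp, unfold has_real_derivative_iff_has_vector_derivative[symmetric],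
          rule has_field_derivative_at_within, rule deriv_even_monomial)
    from has_integral_mult_right[OF this, of "1/2"]
    have "((\<lambda>x. (2 * x) ^ (2 * b) / fact (2 * b)) has_integral pi ^ Suc (2 * b) / fact (Suc (2 * b)) / 2) {0..pi/2}"
      by (simp add: mult.commute del: fact_Suc power_Suc)
    then have e: "integral {0..pi/2} (\<lambda>x. (2 * x) ^ (2 * b) / fact (2 * b)) = pi ^ Suc (2 * b) / fact (Suc (2 * b)) / 2"
      by (rule integral_unique)
    have "tail2 (b - 0) 0 = integral {0..pi/2} (\<lambda>x. (2 * x) ^ (2 * b) / fact (2 * b)) / (pi/2)"
      by (simp add: tail2_def wallis_0)
    then show ?thesis unfolding e by simp
  qed
  finally show ?thesis .
qed

text \<open>The tangent in \<open>tail3\<close> is in the way of integration by parts, so the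
  recursion in m must hold pointwise in the integrand. Iterated primitives taken from pi/2 have this
  property.\<close>

primrec cosint :: "nat \<Rightarrow> nat \<Rightarrow> real \<Rightarrow> real" where
  "cosint 0 m = (\<lambda>t. cos t ^ (2 * m))"
| "cosint (Suc j) m = (\<lambda>t. integral {t..pi/2} (cosint j m))"

lemma integral_upper_has_derivative:
  assumes "continuous_on {0..pi/2} (f :: real \<Rightarrow> real)" "t \<in> {0..pi/2}"
  shows "((\<lambda>t. integral {t..pi/2} f) has_real_derivative - f t) (at t within {0..pi/2})"
proof -
  have 1: "((\<lambda>t. integral {0..pi/2} f - integral {0..t} f) has_real_derivative 0 - f t) (at t within {0..pi/2})"
    using integral_has_real_derivative[OF assms] by (intro DERIV_diff) auto
  have 2: "integral {0..pi/2} f - integral {0..s} f = integral {s..pi/2} f" if "s \<in> {0..pi/2}" for s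
  proof -
    have "integral {0..s} f + integral {s..pi/2} f = integral {0..pi/2} f"
      using that assms(1) by (intro Henstock_Kurzweil_Integration.integral_combine integrable_continuous_real) auto
    then show ?thesis by simp
  qed
  have "((\<lambda>t. integral {t..pi/2} f) has_real_derivative 0 - f t) (at t within {0..pi/2})"
    by (rule has_field_derivative_transform_within[OF 1 zero_less_one assms(2)]) (rule 2)
  then show ?thesis by simp
qed

lemma continuous_on_integral_upper:
  assumes "continuous_on {0..pi/2} (f :: real \<Rightarrow> real)"
  shows "continuous_on {0..pi/2} (\<lambda>t. integral {t..pi/2} f)"
  by (rule DERIV_continuous_on) (rule integral_upper_has_derivative[OF assms])

lemma continuous_cosint: "continuous_on {0..pi/2} (cosint j m)"
  by (induction j) (auto intro!: continuous_intros continuous_on_integral_upper)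

lemma continuous_cosint_subset: "A \<subseteq> {0..pi/2} \<Longrightarrow> continuous_on A (cosint j m)"
  using continuous_cosint by (rule continuous_on_subset)

lemma integrable_cosint: "0 \<le> t \<Longrightarrow> cosint j m integrable_on {t..pi/2}"
  by (intro integrable_continuous_real continuous_cosint_subset) auto

lemma cosint_end: "cosint (Suc j) m (pi/2) = 0"
  by simp

lemma cosint_nonneg: "0 \<le> t \<Longrightarrow> t \<le> pi/2 \<Longrightarrow> cosint j m t \<ge> 0"
proof (induction j arbitrary: t)
  case 0
  then show ?case by (simp add: power_mult)
next
  case (Suc j)
  then show ?case by (auto intro!: integral_nonneg integrable_cosint)
qed

lemma cosint_at_0: "0 \<le> t \<Longrightarrow> t \<le> pi/2 \<Longrightarrow> cosint j 0 t = (pi/2 - t) ^ j / fact j"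
proof (induction j arbitrary: t)
  case (Suc j)
  have "((\<lambda>x. (pi/2 - x) ^ j / fact j) has_integral
     (- ((pi/2 - pi/2) ^ Suc j / fact (Suc j)) - - ((pi/2 - t) ^ Suc j / fact (Suc j)))) {t..pi/2}"
  proof (rule fundamental_theorem_of_calculus)
    fix x assume "x \<in> {t..pi/2}"
    have "((\<lambda>x::real. pi/2 - x) has_real_derivative - 1) (at x within {t..pi/2})"
      by (auto intro!: derivative_eq_intros)
    from DERIV_minus[OF DERIV_cdivide[OF DERIV_power_Suc[OF this, of j], of "fact (Suc j)"]]
    have "((\<lambda>x. - ((pi/2 - x) ^ Suc j / fact (Suc j))) has_real_derivative
        - ((1 + real j) * (- 1 * (pi/2 - x) ^ j) / fact (Suc j))) (at x within {t..pi/2})" .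
    moreover have "- ((1 + real j) * (- 1 * (pi/2 - x) ^ j) / fact (Suc j)) = (pi/2 - x) ^ j / fact j"
      by (simp add: divide_simps)
    ultimately show "((\<lambda>x. - ((pi/2 - x) ^ Suc j / fact (Suc j))) has_vector_derivative (pi/2 - x) ^ j / fact j) (at x within {t..pi/2})"
      by (simp only: has_real_derivative_iff_has_vector_derivative)
  qed (use Suc in simp)
  from integral_unique[OF this]
  have "integral {t..pi/2} (\<lambda>x. (pi/2 - x) ^ j / fact j) = (pi/2 - t) ^ Suc j / fact (Suc j)"
    by (simp del: fact_Suc power_Suc)
  moreover have "integral {t..pi/2} (cosint j 0) = integral {t..pi/2} (\<lambda>x. (pi/2 - x) ^ j / fact j)"
    using Suc by (intro integral_cong) auto
  ultimately show ?case by simp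
qed simp

text \<open>The second derivative of cos^(2k+2) is integrated twice from t to pi/2, where all
  boundary terms vanish; further integrations preserve the identity.\<close>

lemma cosint_step:
  assumes "0 \<le> t" "t \<le> pi/2"
  shows "(2 * real k + 2) * (2 * real k + 1) * cosint (Suc (Suc j)) k t = cosint j (Suc k) t + (2 * real k + 2)^2 * cosint (Suc (Suc j)) (Suc k) t"
  using assms
proof (induction j arbitrary: t)
  case 0
  let ?g1 = "\<lambda>x. - (2 * real k + 2) * cos x ^ (2 * k + 1) * sin x"
  let ?a = "(2 * real k + 2) * (2 * real k + 1)" and ?b = "(2 * real k + 2)^2"
  have 1: "?a * cosint 1 k s - ?b * cosint 1 (Suc k) s = - ?g1 s" if "0 \<le> s" "s \<le> pi/2" for s
  proof -
    have "((\<lambda>x. ?a * cosint 0 k x - ?b * cosint 0 (Suc k) x) has_integral (?g1 (pi/2) - ?g1 s)) {s..pi/2}"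
      unfolding cosint.simps using that deriv_cos_power2
      by (intro fundamental_theorem_of_calculus) (auto simp: has_real_derivative_iff_has_vector_derivative[symmetric])
    then have "integral {s..pi/2} (\<lambda>x. ?a * cosint 0 k x - ?b * cosint 0 (Suc k) x) = - ?g1 s"
      by (simp add: integral_unique)
    moreover have "integral {s..pi/2} (\<lambda>x. ?a * cosint 0 k x - ?b * cosint 0 (Suc k) x) =
        integral {s..pi/2} (\<lambda>x. ?a * cosint 0 k x) - integral {s..pi/2} (\<lambda>x. ?b * cosint 0 (Suc k) x)"
      using that by (intro integral_diff integrable_on_mult_right integrable_cosint)
    ultimately show ?thesis by (simp only: integral_mult_right cosint.simps One_nat_def)
  qed
  have "((\<lambda>x. ?g1 x) has_integral (cos (pi/2) ^ (2 * Suc k) - cos t ^ (2 * Suc k))) {t..pi/2}"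
    using 0 deriv_cos_power
    by (intro fundamental_theorem_of_calculus) (auto simp: has_real_derivative_iff_has_vector_derivative[symmetric])
  then have "integral {t..pi/2} ?g1 = - (cos t ^ (2 * Suc k))"
    by (simp add: integral_unique)
  then have "cos t ^ (2 * Suc k) = integral {t..pi/2} (\<lambda>x. - ?g1 x)"
    by (simp only: integral_neg minus_minus)
  also have "\<dots> = integral {t..pi/2} (\<lambda>x. ?a * cosint 1 k x - ?b * cosint 1 (Suc k) x)"
    using 0 1 by (intro integral_cong) auto
  also have "\<dots> = integral {t..pi/2} (\<lambda>x. ?a * cosint 1 k x) - integral {t..pi/2} (\<lambda>x. ?b * cosint 1 (Suc k) x)"
    using 0 by (intro integral_diff integrable_on_mult_right integrable_cosint)
  also have "\<dots> = ?a * cosint (Suc (Suc 0)) k t - ?b * cosint (Suc (Suc 0)) (Suc k) t"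
    by (simp only: integral_mult_right cosint.simps One_nat_def)
  finally show ?case by (simp only: cosint.simps)
next
  case (Suc j)
  let ?a = "(2 * real k + 2) * (2 * real k + 1)" and ?b = "(2 * real k + 2)^2"
  have "integral {t..pi/2} (\<lambda>x. ?a * cosint (Suc (Suc j)) k x) =
     integral {t..pi/2} (\<lambda>x. cosint j (Suc k) x + ?b * cosint (Suc (Suc j)) (Suc k) x)"
    using Suc by (intro integral_cong) auto
  also have "\<dots> = integral {t..pi/2} (cosint j (Suc k)) + integral {t..pi/2} (\<lambda>x. ?b * cosint (Suc (Suc j)) (Suc k) x)"
    using Suc.prems by (intro integral_add integrable_on_mult_right integrable_cosint)
  finally show ?case by (simp only: integral_mult_right cosint.simps(2)[of "Suc (Suc j)"] cosint.simps(2)[of j])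
qed

text \<open>For t \<le> x the inequality sin (x - t) \<ge> 0 says tan t cos x \<le> sin x, which
  removes the tangent in the base case. Each further integration moves tan inside by monotonicity
  and costs at most a factor pi/2.\<close>

lemma cosint_tan_bound:
  assumes "0 \<le> t" "t \<le> pi/2"
  shows "tan t * cosint (Suc i) (Suc k) t \<le> (pi/2) ^ i / (2 * real (Suc k))"
  using assms
proof (induction i arbitrary: t)
  case 0
  show ?case
  proof (cases "t = pi/2")
    case False
    with 0 have t: "cos t > 0" "t < pi/2" by (auto intro!: cos_gt_zero_pi)
    have mono: "tan t * cos x \<le> sin x" if "x \<in> {t..pi/2}" for x
    proof -
      have "sin t * cos x \<le> cos t * sin x"
        using sin_ge_zero[of "x - t"] that 0 by (simp add: sin_diff mult.commute)
      then show ?thesis using t by (simp add: tan_def divide_simps mult.commute)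
    qed
    have "tan t * cosint (Suc 0) (Suc k) t = integral {t..pi/2} (\<lambda>x. tan t * cos x ^ (2 * Suc k))"
      by (simp only: integral_mult_right cosint.simps)
    also have "\<dots> \<le> integral {t..pi/2} (\<lambda>x. cos x ^ (2 * k + 1) * sin x)"
    proof (rule integral_le)
      fix x assume x: "x \<in> {t..pi/2}"
      have "tan t * cos x ^ (2 * Suc k) = cos x ^ (2 * k + 1) * (tan t * cos x)" by simp
      also have "\<dots> \<le> cos x ^ (2 * k + 1) * sin x"
        using x 0 by (intro mult_left_mono mono zero_le_power cos_ge_zero) auto
      finally show "tan t * cos x ^ (2 * Suc k) \<le> cos x ^ (2 * k + 1) * sin x" .
    qed (auto intro!: integrable_continuous_real continuous_intros)
    also have "\<dots> = cos t ^ (2 * Suc k) / (2 * real k + 2)"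
      using integral_cos_power_sin[OF 0] by (rule integral_unique)
    also have "\<dots> \<le> 1 / (2 * real k + 2)"
      using cos_ge_zero[of t] 0 by (intro divide_right_mono power_le_one) auto
    finally show ?thesis by (simp add: add.commute del: cosint.simps)
  next
    case True
    show ?thesis unfolding True cosint_end by simp
  qed
next
  case (Suc i)
  show ?case
  proof (cases "t = pi/2")
    case False
    with Suc.prems have t: "cos t > 0" "t < pi/2" by (auto intro!: cos_gt_zero_pi)
    have "tan t * cosint (Suc (Suc i)) (Suc k) t = integral {t..pi/2} (\<lambda>x. tan t * cosint (Suc i) (Suc k) x)"
      by (simp only: integral_mult_right cosint.simps(2)[of "Suc i"])
    also have "\<dots> \<le> integral {t..pi/2} (\<lambda>x. (pi/2) ^ i / (2 * real (Suc k)))"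
    proof (rule integral_le)
      fix x assume x: "x \<in> {t..pi/2}"
      show "tan t * cosint (Suc i) (Suc k) x \<le> (pi/2) ^ i / (2 * real (Suc k))"
      proof (cases "x = pi/2")
        case True
        show ?thesis unfolding True cosint_end by simp
      next
        case False
        have "tan t \<le> tan x"
          using x Suc.prems False by (intro tan_mono_le) auto
        then have "tan t * cosint (Suc i) (Suc k) x \<le> tan x * cosint (Suc i) (Suc k) x"
          using x Suc.prems by (intro mult_right_mono cosint_nonneg) auto
        also have "\<dots> \<le> (pi/2) ^ i / (2 * real (Suc k))"
          using x Suc.prems by (intro Suc.IH) auto
        finally show ?thesis .
      qed
    qed (use Suc.prems in \<open>auto intro!: integrable_on_mult_right integrable_cosint simp del: cosint.simps\<close>)
    also have "\<dots> = (pi/2 - t) * ((pi/2) ^ i / (2 * real (Suc k)))"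
      using Suc.prems by simp
    also have "\<dots> \<le> pi/2 * ((pi/2) ^ i / (2 * real (Suc k)))"
      using Suc.prems by (intro mult_right_mono) auto
    finally show ?thesis by simp
  next
    case True
    show ?thesis unfolding True cosint_end by simp
  qed
qed

text \<open>Two integrations give a zero of second order at pi/2 against the simple pole of the
  tangent. The product is at most a multiple of pi/2 - t, so its value 0 at pi/2 is the continuous
  one.\<close>

lemma tan_cosint_continuous:
  "continuous_on {0..pi/2} (\<lambda>t. tan t * cosint (Suc (Suc j)) m t)"
proof -
  have "bounded (cosint j m ` {0..pi/2})"
    by (intro compact_imp_bounded compact_continuous_image continuous_cosint compact_Icc)
  then obtain B where "\<forall>y\<in>cosint j m ` {0..pi/2}. norm y \<le> B"
    unfolding bounded_iff by blast
  then have B: "\<bar>cosint j m t\<bar> \<le> B" if "t \<in> {0..pi/2}" for t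
    using that by (metis imageI real_norm_def)
  have B0: "B \<ge> 0" using B[of 0] by (auto intro: order_trans[OF abs_ge_zero])
  have b1: "cosint (Suc j) m t \<le> B * (pi/2 - t)" if "t \<in> {0..pi/2}" for t
  proof -
    have "cosint (Suc j) m t \<le> integral {t..pi/2} (\<lambda>_. B)"
      unfolding cosint.simps(2)
    proof (rule integral_le)
      fix x assume "x \<in> {t..pi/2}"
      then show "cosint j m x \<le> B" using that by (intro abs_le_D1[OF B]) auto
    qed (use that in \<open>auto intro!: integrable_cosint simp del: cosint.simps\<close>)
    then show ?thesis using that by (simp add: mult.commute)
  qed
  have b2: "cosint (Suc (Suc j)) m t \<le> B * (pi/2 - t) * (pi/2 - t)" if "t \<in> {0..pi/2}" for t
  proof -
    have "cosint (Suc (Suc j)) m t \<le> integral {t..pi/2} (\<lambda>_. B * (pi/2 - t))"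
      unfolding cosint.simps(2)[of "Suc j"]
    proof (rule integral_le)
      fix x assume x: "x \<in> {t..pi/2}"
      then have "cosint (Suc j) m x \<le> B * (pi/2 - x)" using that by (intro b1) auto
      also have "\<dots> \<le> B * (pi/2 - t)" using x B0 by (intro mult_left_mono) auto
      finally show "cosint (Suc j) m x \<le> B * (pi/2 - t)" .
    qed (use that in \<open>auto intro!: integrable_cosint simp del: cosint.simps\<close>)
    then show ?thesis using that by (simp add: mult_ac del: cosint.simps)
  qed
  have b3: "\<bar>tan t * cosint (Suc (Suc j)) m t\<bar> \<le> B * (pi/2 - t)" if t: "t \<in> {0..pi/2}" for t
  proof (cases "t = pi/2")
    case True
    show ?thesis unfolding True cosint_end using B0 by simp
  next
    case False
    with t have c: "cos t > 0" by (auto intro!: cos_gt_zero_pi)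
    have "(pi/2 - t) * cos (pi/2 - t) \<le> sin (pi/2 - t)" using t by (intro x_cos_le_sin) auto
    then have "(pi/2 - t) * sin t \<le> cos t" unfolding sin_cos_eq[of t] cos_sin_eq[of t] by simp
    then have tan: "tan t * (pi/2 - t) \<le> 1" using c by (simp add: tan_def divide_simps mult.commute)
    have tn: "tan t \<ge> 0" using c t by (auto simp: tan_def intro!: divide_nonneg_pos sin_ge_zero)
    have cn: "cosint (Suc (Suc j)) m t \<ge> 0" using t by (intro cosint_nonneg) auto
    have "tan t * cosint (Suc (Suc j)) m t \<le> tan t * (B * (pi/2 - t) * (pi/2 - t))"
      using b2[OF t] tn by (rule mult_left_mono)
    also have "\<dots> = B * (pi/2 - t) * (tan t * (pi/2 - t))" by simp
    also have "\<dots> \<le> B * (pi/2 - t) * 1"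
      using tan B0 t by (intro mult_left_mono) auto
    finally show ?thesis using tn cn by (simp add: abs_mult del: cosint.simps)
  qed
  show ?thesis
    unfolding continuous_on_def
  proof
    fix t assume t: "t \<in> {0..pi/2}"
    let ?F = "\<lambda>t. tan t * cosint (Suc (Suc j)) m t"
    show "(?F \<longlongrightarrow> ?F t) (at t within {0..pi/2})"
    proof (cases "t = pi/2")
      case True
      have "((\<lambda>t. B * (pi/2 - t)) \<longlongrightarrow> B * (pi/2 - pi/2)) (at (pi/2) within {0..pi/2})"
        by (intro tendsto_intros)
      then have "((\<lambda>t. B * (pi/2 - t)) \<longlongrightarrow> 0) (at t within {0..pi/2})" by (simp add: True)
      then have "(?F \<longlongrightarrow> 0) (at t within {0..pi/2})"
        by (rule Lim_null_comparison[rotated]) (auto simp: eventually_at_filter b3 simp del: cosint.simps)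
      then show ?thesis by (simp add: True)
    next
      case False
      with t have "cos t \<noteq> 0" using cos_gt_zero_pi[of t] by auto
      then have "(tan \<longlongrightarrow> tan t) (at t within {0..pi/2})" by (intro tendsto_tan tendsto_ident_at)
      moreover have "(cosint (Suc (Suc j)) m \<longlongrightarrow> cosint (Suc (Suc j)) m t) (at t within {0..pi/2})"
        using continuous_cosint t unfolding continuous_on_def by blast
      ultimately show ?thesis by (rule tendsto_mult)
    qed
  qed
qed

definition odd_mono :: "nat \<Rightarrow> real \<Rightarrow> real" where
  "odd_mono b x = (2 * x) ^ (2 * b + 1) / fact (2 * b + 1)"

text \<open>The closed form of the tail sums of \<open>\<zeta>({2}\<^sup>j\<^sup>-\<^sup>1, 3, {2}\<^sup>b)\<close>.\<close>

definition tail3 :: "nat \<Rightarrow> nat \<Rightarrow> nat \<Rightarrow> real" where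
  "tail3 j b m = 4 ^ j * integral {0..pi/2} (\<lambda>x. odd_mono b x * (tan x * cosint (2 * j) m x)) / wallis m"

lemma continuous_odd_mono: "continuous_on A (odd_mono b)"
  unfolding odd_mono_def[abs_def] by (intro continuous_intros) simp

text \<open>tan x cos^(2k+2) x = cos^(2k+1) x sin x is a multiple of the derivative of cos^(2k+2),
  so one integration by parts removes the tangent. The factor 1/(k+1) that it leaves raises the
  exponent from 2 to 3.\<close>

lemma tan_cosint_0_integral:
  "integral {0..pi/2} (\<lambda>x. odd_mono b x * (tan x * cosint 0 (Suc k) x)) =
     integral {0..pi/2} (\<lambda>x. cos x ^ (2 * Suc k) * ((2 * x) ^ (2 * b) / fact (2 * b))) / real (Suc k)"
  and integrable_tan_cosint_0: "(\<lambda>x. odd_mono b x * (tan x * cosint 0 (Suc k) x)) integrable_on {0..pi/2}"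
proof -
  let ?F = "\<lambda>x. cos x ^ (2 * Suc k) * odd_mono b x"
  let ?g = "\<lambda>x. odd_mono b x * (tan x * cosint 0 (Suc k) x)"
  let ?h = "\<lambda>x. cos x ^ (2 * Suc k) * ((2 * x) ^ (2 * b) / fact (2 * b))"
  have g: "?g x = odd_mono b x * (cos x ^ (2 * k + 1) * sin x)" for x
    by (cases "cos x = 0") (simp_all add: tan_def)
  show int: "?g integrable_on {0..pi/2}"
    unfolding g by (intro integrable_continuous_pi2 continuous_intros continuous_odd_mono)
  have h: "?h integrable_on {0..pi/2}"
    by (auto intro!: integrable_continuous_pi2 continuous_intros)
  have "((\<lambda>x. 2 * ?h x - 2 * real (Suc k) * ?g x) has_integral (?F (pi/2) - ?F 0)) {0..pi/2}"
  proof (rule fundamental_theorem_of_calculus)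
    fix x :: real
    have "(odd_mono b has_real_derivative 2 * ((2 * x) ^ (2 * b) / fact (2 * b))) (at x within {0..pi/2})"
      unfolding odd_mono_def[abs_def] Suc_eq_plus1[symmetric]
      by (rule has_field_derivative_at_within[OF deriv_even_monomial])
    from DERIV_mult[OF deriv_cos_power[of k x] this]
    have "(?F has_real_derivative (- (2 * real k + 2) * cos x ^ (2 * k + 1) * sin x) * odd_mono b x +
       2 * ((2 * x) ^ (2 * b) / fact (2 * b)) * cos x ^ (2 * Suc k)) (at x within {0..pi/2})" .
    moreover have "(- (2 * real k + 2) * cos x ^ (2 * k + 1) * sin x) * odd_mono b x +
       2 * ((2 * x) ^ (2 * b) / fact (2 * b)) * cos x ^ (2 * Suc k) = 2 * ?h x - 2 * real (Suc k) * ?g x"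
      unfolding g by (simp add: algebra_simps)
    ultimately show "(?F has_vector_derivative 2 * ?h x - 2 * real (Suc k) * ?g x) (at x within {0..pi/2})"
      by (simp only: has_real_derivative_iff_has_vector_derivative)
  qed simp
  then have "integral {0..pi/2} (\<lambda>x. 2 * ?h x - 2 * real (Suc k) * ?g x) = 0"
    by (simp add: integral_unique odd_mono_def)
  moreover have "integral {0..pi/2} (\<lambda>x. 2 * ?h x - 2 * real (Suc k) * ?g x) =
     integral {0..pi/2} (\<lambda>x. 2 * ?h x) - integral {0..pi/2} (\<lambda>x. 2 * real (Suc k) * ?g x)"
    by (intro integral_diff integrable_on_mult_right int h)
  ultimately have "2 * integral {0..pi/2} ?h = 2 * real (Suc k) * integral {0..pi/2} ?g"
    by (simp only: integral_mult_right)
  then have "integral {0..pi/2} ?h = real (Suc k) * integral {0..pi/2} ?g" by linarith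
  then show "integral {0..pi/2} ?g = integral {0..pi/2} ?h / real (Suc k)"
    by (simp only: nonzero_mult_div_cancel_left of_nat_eq_0_iff nat.distinct not_False_eq_True)
qed

lemma tail3_0: "tail3 0 b (Suc k) = tail2 b (Suc k) / real (Suc k)"
  unfolding tail3_def mult_0_right tan_cosint_0_integral tail2_def by simp

lemma integrable_tan_cosint: "(\<lambda>x. odd_mono b x * (tan x * cosint (Suc (Suc j)) m x)) integrable_on {0..pi/2}"
  by (intro integrable_continuous_pi2 continuous_on_mult continuous_odd_mono tan_cosint_continuous)

text \<open>\<open>cosint_step\<close> under the integral. The ratio of consecutive Wallis integrals
  gives both tails the coefficient (2k+2)^2, and the power of 4 absorbs the constant.\<close>

lemma tail3_Suc: "tail3 (Suc j) b k - tail3 (Suc j) b (Suc k) = tail3 j b (Suc k) / real (Suc k) ^ 2"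
proof -
  let ?I = "\<lambda>j m. integral {0..pi/2} (\<lambda>x. odd_mono b x * (tan x * cosint j m x))"
  let ?a = "(2 * real k + 2) * (2 * real k + 1)" and ?b = "(2 * real k + 2)^2"
  have int: "(\<lambda>x. odd_mono b x * (tan x * cosint (2 * j) (Suc k) x)) integrable_on {0..pi/2}"
  proof (cases j)
    case 0
    then show ?thesis using integrable_tan_cosint_0 by simp
  next
    case (Suc i)
    then show ?thesis using integrable_tan_cosint[of b "2 * i" "Suc k"] by (simp del: cosint.simps)
  qed
  have "?a * ?I (Suc (Suc (2 * j))) k = integral {0..pi/2} (\<lambda>x. ?a * (odd_mono b x * (tan x * cosint (Suc (Suc (2 * j))) k x)))"
    by (simp only: integral_mult_right)
  also have "\<dots> = integral {0..pi/2} (\<lambda>x. odd_mono b x * (tan x * cosint (2 * j) (Suc k) x) +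
       ?b * (odd_mono b x * (tan x * cosint (Suc (Suc (2 * j))) (Suc k) x)))"
  proof (rule integral_cong)
    fix x :: real assume "x \<in> {0..pi/2}"
    then have "?a * cosint (Suc (Suc (2 * j))) k x = cosint (2 * j) (Suc k) x + ?b * cosint (Suc (Suc (2 * j))) (Suc k) x"
      by (intro cosint_step) auto
    then have "odd_mono b x * tan x * (?a * cosint (Suc (Suc (2 * j))) k x) =
       odd_mono b x * tan x * (cosint (2 * j) (Suc k) x + ?b * cosint (Suc (Suc (2 * j))) (Suc k) x)" by (rule arg_cong)
    then show "?a * (odd_mono b x * (tan x * cosint (Suc (Suc (2 * j))) k x)) = odd_mono b x * (tan x * cosint (2 * j) (Suc k) x) +
       ?b * (odd_mono b x * (tan x * cosint (Suc (Suc (2 * j))) (Suc k) x))"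
      by (simp only: distrib_left mult_ac)
  qed
  also have "\<dots> = ?I (2 * j) (Suc k) + ?b * ?I (Suc (Suc (2 * j))) (Suc k)"
    unfolding integral_mult_right[symmetric] by (intro integral_add integrable_on_mult_right int integrable_tan_cosint)
  finally have e: "?a * ?I (Suc (Suc (2 * j))) k = ?I (2 * j) (Suc k) + ?b * ?I (Suc (Suc (2 * j))) (Suc k)" .
  have w: "(2 * real k + 1) / wallis (Suc k) = (2 * real k + 2) / wallis k"
    using wallis_Suc[of k] wallis_pos[of k] wallis_pos[of "Suc k"] by (simp add: divide_simps mult.commute)
  have "4 ^ Suc j * ?a * ?I (Suc (Suc (2 * j))) k / wallis (Suc k) =
     4 ^ Suc j * (2 * real k + 2) * ?I (Suc (Suc (2 * j))) k * ((2 * real k + 1) / wallis (Suc k))"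
  proof -
    have "p * (c * d) * i / w = p * c * i * (d / w)" for p c d i w :: real by simp
    then show ?thesis .
  qed
  also have "\<dots> = ?b * tail3 (Suc j) b k"
    unfolding w tail3_def by (simp add: power2_eq_square del: cosint.simps power_Suc)
  finally have "?b * tail3 (Suc j) b k = 4 ^ Suc j * (?a * ?I (Suc (Suc (2 * j))) k) / wallis (Suc k)"
    by (simp only: mult.assoc)
  also have "\<dots> = 4 * tail3 j b (Suc k) + ?b * tail3 (Suc j) b (Suc k)"
  proof -
    have "4 ^ Suc j * (x + b * y) / w = 4 * (4 ^ j * x / w) + b * (4 ^ Suc j * y / w)" for x b y w :: real
      by (cases "w = 0") (simp_all add: field_simps)
    then show ?thesis unfolding e tail3_def mult_Suc_right add_2_eq_Suc .
  qed
  finally have "4 * real (Suc k) ^ 2 * (tail3 (Suc j) b k - tail3 (Suc j) b (Suc k)) = 4 * tail3 j b (Suc k)"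
    by (simp add: power2_eq_square algebra_simps)
  then show ?thesis by (simp add: divide_simps mult.commute del: of_nat_Suc)
qed

lemma tail3_tendsto: "tail3 (Suc j) b \<longlonglongrightarrow> 0"
proof -
  \<comment> \<open>The power of 4, the length of the interval, the maximum of
    \<open>odd_mono b\<close>, and the bound of \<open>cosint_tan_bound\<close> for i = 2j + 1
    without its factor 1/(2m).\<close>
  define C where "C = 4 ^ Suc j * (pi/2) * (pi ^ (2 * b + 1) / fact (2 * b + 1)) * (pi/2) ^ Suc (2 * j)"
  show ?thesis
  proof (rule Lim_null_comparison[OF _ wallis_decay[of C]], intro eventually_sequentiallyI[of 1])
    fix m :: nat assume "1 \<le> m"
    then obtain k where m: "m = Suc k" by (cases m) auto
    let ?f = "\<lambda>x. odd_mono b x * (tan x * cosint (2 * Suc j) m x)"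
    let ?D = "pi ^ (2 * b + 1) / fact (2 * b + 1) * ((pi/2) ^ Suc (2 * j) / (2 * real m))"
    have int: "?f integrable_on {0..pi/2}"
      using integrable_tan_cosint[of b "2 * j" m] by (simp del: cosint.simps)
    have o: "0 \<le> odd_mono b x \<and> odd_mono b x \<le> pi ^ (2 * b + 1) / fact (2 * b + 1)" if "x \<in> {0..pi/2}" for x
      using that unfolding odd_mono_def by (intro conjI divide_right_mono power_mono divide_nonneg_pos zero_le_power) auto
    have t: "0 \<le> tan x * cosint (2 * Suc j) m x \<and> tan x * cosint (2 * Suc j) m x \<le> (pi/2) ^ Suc (2 * j) / (2 * real m)"
      if "x \<in> {0..pi/2}" for x
    proof
      have "tan x \<ge> 0" using that by (auto simp: tan_def intro!: divide_nonneg_nonneg sin_ge_zero cos_ge_zero)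
      moreover have "cosint (2 * Suc j) m x \<ge> 0" using that by (intro cosint_nonneg) auto
      ultimately show "0 \<le> tan x * cosint (2 * Suc j) m x" by (rule mult_nonneg_nonneg)
      show "tan x * cosint (2 * Suc j) m x \<le> (pi/2) ^ Suc (2 * j) / (2 * real m)"
        using cosint_tan_bound[of x "Suc (2 * j)" k] that by (simp add: m del: cosint.simps of_nat_Suc)
    qed
    have 0: "integral {0..pi/2} ?f \<ge> 0"
    proof (rule integral_nonneg[OF int])
      fix x assume x: "x \<in> {0..pi/2}"
      show "0 \<le> ?f x" by (rule mult_nonneg_nonneg[OF conjunct1[OF o[OF x]] conjunct1[OF t[OF x]]])
    qed
    have "integral {0..pi/2} ?f \<le> integral {0..pi/2} (\<lambda>_. ?D)"
    proof (rule integral_le[OF int])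
      fix x assume x: "x \<in> {0..pi/2}"
      show "?f x \<le> ?D"
        by (rule mult_mono[OF conjunct2[OF o[OF x]] conjunct2[OF t[OF x]] _ conjunct1[OF t[OF x]]]) simp
    qed (rule integrable_const_ivl)
    also have "\<dots> = pi/2 * ?D" by (simp del: power_Suc fact_Suc)
    finally have "4 ^ Suc j * integral {0..pi/2} ?f \<le> 4 ^ Suc j * (pi/2 * ?D)" by (rule mult_left_mono) simp
    also have "\<dots> = C / (2 * real m)"
      unfolding C_def by (simp only: times_divide_eq_right times_divide_eq_left mult.assoc)
    finally have "4 ^ Suc j * integral {0..pi/2} ?f / wallis m \<le> C / (2 * real m) / wallis m"
      by (rule divide_right_mono) (rule less_imp_le[OF wallis_pos])
    then have 1: "tail3 (Suc j) b m \<le> C / (2 * real m) / wallis m" unfolding tail3_def .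
    have 2: "tail3 (Suc j) b m \<ge> 0"
      unfolding tail3_def by (intro divide_nonneg_nonneg mult_nonneg_nonneg 0 less_imp_le[OF wallis_pos]) simp
    show "norm (tail3 (Suc j) b m) \<le> C / (2 * real m * wallis m)"
      using 1 2 by (simp only: real_norm_def abs_of_nonneg divide_divide_eq_left)
  qed
qed

lemma mzv_twos_three_twos:
  "mzv (replicate a 2 @ [3] @ replicate b 2) =
     2 / pi * integral {0..pi/2} (\<lambda>x. tan x * ((2 * x) ^ (2 * b + 1) / fact (2 * b + 1) * ((pi - 2 * x) ^ (2 * a + 2) / fact (2 * a + 2))))"
proof -
  let ?k = "replicate a 2 @ [3] @ replicate b (2::nat)"
  \<comment> \<open>For i \<le> a the entry 3 is still ahead, and \<open>Suc a - i\<close> counts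
    the entries up to and including it; afterwards only twos remain.\<close>
  define T where "T i = (if i \<le> a then tail3 (Suc a - i) b else tail2 (b - (i - Suc a)))" for i
  have "mzv ?k = T 0 0"
  proof (rule mzv_tail_eqI[where T = T])
    show "T (length ?k) N = 1" for N by (simp add: T_def tail2_0)
  next
    fix i N assume i: "i < length ?k"
    consider "i < a" | "i = a" | "a < i" by linarith
    then show "T i N - T i (Suc N) = T (Suc i) (Suc N) / real (Suc N) ^ (?k ! i)"
    proof cases
      case 1
      then show ?thesis using tail3_Suc[of "a - i" b N] by (simp add: T_def nth_append Suc_diff_le)
    next
      case 2
      then show ?thesis using tail3_Suc[of 0 b N] tail3_0[of b N]
        by (simp add: T_def nth_append power3_eq_cube power2_eq_square)
    next
      case 3
      then have "b - (i - Suc a) = Suc (b - (Suc i - Suc a))" using i by auto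
      moreover have "?k ! i = 2" using 3 i by (auto simp: nth_append nth_Cons split: nat.splits)
      ultimately show ?thesis using 3 tail2_Suc[of "b - (Suc i - Suc a)" N] by (simp add: T_def)
    qed
  next
    fix i assume i: "i < length ?k"
    have "take i ?k = [] \<or> last (take i ?k) \<in> set ?k"
      by (metis in_set_takeD last_in_set)
    moreover have "set ?k \<subseteq> {2, 3}" by auto
    moreover have "set (take i ?k) \<subseteq> set ?k" by (rule set_take_subset)
    ultimately show "admissible (take i ?k)"
      unfolding admissible_def is_index_def by fastforce
    show "(\<lambda>N. T i N) \<longlonglongrightarrow> 0"
      using i tail3_tendsto[of "a - i" b] tail2_tendsto[of "b - (i - Suc a)"]
      by (auto simp: T_def Suc_diff_le)
  qed
  also have "T 0 0 = 2 / pi * (4 ^ Suc a * integral {0..pi/2} (\<lambda>x. odd_mono b x * (tan x * cosint (2 * Suc a) 0 x)))"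
    by (simp add: T_def tail3_def wallis_0 del: cosint.simps)
  also have "4 ^ Suc a * integral {0..pi/2} (\<lambda>x. odd_mono b x * (tan x * cosint (2 * Suc a) 0 x)) =
     integral {0..pi/2} (\<lambda>x. 4 ^ Suc a * (odd_mono b x * (tan x * cosint (2 * Suc a) 0 x)))"
    by (simp only: integral_mult_right)
  also have "\<dots> = integral {0..pi/2} (\<lambda>x. tan x * ((2 * x) ^ (2 * b + 1) / fact (2 * b + 1) * ((pi - 2 * x) ^ (2 * a + 2) / fact (2 * a + 2))))"
  proof (rule integral_cong)
    fix x :: real assume x: "x \<in> {0..pi/2}"
    have "pi - 2 * x = 2 * (pi/2 - x)" by simp
    then have "(pi - 2 * x) ^ (2 * Suc a) = 4 ^ Suc a * (pi/2 - x) ^ (2 * Suc a)"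
      by (simp only: power_mult_distrib power_mult) simp
    moreover have "cosint (2 * Suc a) 0 x = (pi/2 - x) ^ (2 * Suc a) / fact (2 * Suc a)"
      using x by (intro cosint_at_0) auto
    ultimately have "4 ^ Suc a * cosint (2 * Suc a) 0 x = (pi - 2 * x) ^ (2 * a + 2) / fact (2 * a + 2)"
      by (simp only: times_divide_eq_right mult_Suc_right add.commute)
    then have "odd_mono b x * tan x * (4 ^ Suc a * cosint (2 * Suc a) 0 x) = odd_mono b x * tan x * ((pi - 2 * x) ^ (2 * a + 2) / fact (2 * a + 2))"
      by (rule arg_cong)
    then show "4 ^ Suc a * (odd_mono b x * (tan x * cosint (2 * Suc a) 0 x)) =
       tan x * ((2 * x) ^ (2 * b + 1) / fact (2 * b + 1) * ((pi - 2 * x) ^ (2 * a + 2) / fact (2 * a + 2)))"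
      by (simp only: odd_mono_def mult_ac)
  qed
  finally show ?thesis .
qed

section \<open>Zagier's formula\<close>

text \<open>A quantitative Riemann-Lebesgue lemma by one integration by parts. Derivatives are taken
  in the open interval only, to suit \<open>sec_sq\<close>.\<close>

lemma oscillating_integral_bound:
  fixes h h' :: "real \<Rightarrow> real"
  assumes "continuous_on {0..pi/2} h" "\<And>x. 0 < x \<Longrightarrow> x < pi/2 \<Longrightarrow> (h has_real_derivative h' x) (at x)"
    and "\<And>x. 0 < x \<Longrightarrow> x < pi/2 \<Longrightarrow> \<bar>h' x\<bar> \<le> B" "B \<ge> 0" "l > 0"
  shows "\<bar>integral {0..pi/2} (\<lambda>x. h x * sin (l * x))\<bar> \<le> (\<bar>h 0\<bar> + \<bar>h (pi/2)\<bar> + B * (pi/2)) / l"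
proof -
  let ?I = "integral {0..pi/2} (\<lambda>x. h x * sin (l * x))"
  define V where "V = h (pi/2) * cos (l * (pi/2)) - h 0 + l * ?I"
  have "((\<lambda>x. h' x * cos (l * x) - l * (h x * sin (l * x))) has_integral
      (h (pi/2) * cos (l * (pi/2)) - h 0 * cos (l * 0))) {0..pi/2}"
  proof (rule fundamental_theorem_of_calculus_interior)
    show "continuous_on {0..pi/2} (\<lambda>x. h x * cos (l * x))"
      by (intro continuous_intros assms(1))
    fix x :: real assume "x \<in> {0<..<pi/2}"
    then have "(h has_real_derivative h' x) (at x)" using assms(2) by simp
    then have "((\<lambda>x. h x * cos (l * x)) has_real_derivative h' x * cos (l * x) - l * (h x * sin (l * x))) (at x)"
      by (auto intro!: derivative_eq_intros simp: algebra_simps)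
    then show "((\<lambda>x. h x * cos (l * x)) has_vector_derivative h' x * cos (l * x) - l * (h x * sin (l * x))) (at x)"
      by (simp only: has_real_derivative_iff_has_vector_derivative)
  qed simp
  moreover have "((\<lambda>x. l * (h x * sin (l * x))) has_integral l * ?I) {0..pi/2}"
    by (intro has_integral_mult_right integrable_integral integrable_continuous_pi2 continuous_intros assms(1))
  ultimately have "((\<lambda>x. h' x * cos (l * x) - l * (h x * sin (l * x)) + l * (h x * sin (l * x))) has_integral
      (h (pi/2) * cos (l * (pi/2)) - h 0 * cos (l * 0) + l * ?I)) {0..pi/2}"
    by (rule has_integral_add)
  then have "((\<lambda>x. h' x * cos (l * x)) has_integral V) {0..pi/2}" by (simp add: V_def)
  then have "norm V \<le> B * measure lborel {0..pi/2}"
  proof (rule has_integral_bound_real[OF assms(4), of "{0, pi/2}", rotated])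
    fix x :: real assume "x \<in> {0..pi/2} - {0, pi/2}"
    then have x: "0 < x" "x < pi/2" by auto
    have "\<bar>h' x\<bar> * \<bar>cos (l * x)\<bar> \<le> B * 1"
      by (intro mult_mono assms(3) x abs_cos_le_one assms(4)) simp
    then show "norm (h' x * cos (l * x)) \<le> B" by (simp add: abs_mult)
  qed simp
  then have V: "\<bar>V\<bar> \<le> B * (pi/2)" by simp
  have c: "\<bar>h (pi/2) * cos (l * (pi/2))\<bar> \<le> \<bar>h (pi/2)\<bar>"
    by (simp add: abs_mult mult_left_le)
  have "l * \<bar>?I\<bar> = \<bar>l * ?I\<bar>" using assms(5) by (simp add: abs_mult)
  also have "\<dots> = \<bar>V - h (pi/2) * cos (l * (pi/2)) + h 0\<bar>" by (simp add: V_def)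
  also have "\<dots> \<le> \<bar>h 0\<bar> + \<bar>h (pi/2)\<bar> + B * (pi/2)" using V c by linarith
  finally show ?thesis using assms(5) by (simp add: pos_le_divide_eq mult.commute)
qed

text \<open>Jordan's inequality: sin y / y decreases, since its derivative has the sign of y cos y -
  sin y.\<close>

lemma sin_lower:
  assumes "0 \<le> y" "y \<le> pi/2"
  shows "y \<le> pi/2 * sin y"
proof (cases "y = 0")
  case False
  then have y: "0 < y" using assms by simp
  have "sin (pi/2) / (pi/2) \<le> sin y / y"
  proof (rule DERIV_nonpos_imp_nonincreasing[OF assms(2)])
    fix x assume x: "y \<le> x" "x \<le> pi/2"
    have "((\<lambda>x. sin x / x) has_real_derivative (x * cos x - sin x) / (x * x)) (at x)"
      using x y by (auto intro!: derivative_eq_intros simp: mult.commute)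
    moreover have "(x * cos x - sin x) / (x * x) \<le> 0"
      using x y x_cos_le_sin[of x] by (intro divide_nonpos_pos) auto
    ultimately show "\<exists>d. ((\<lambda>x. sin x / x) has_real_derivative d) (at x) \<and> d \<le> 0" by blast
  qed
  then show ?thesis using y by (simp add: divide_simps mult_ac)
qed simp

text \<open>The factor 1/cos x of the Fourier remainder, tamed by a double zero. At pi/2 division by
  zero yields 0, which is also the limit.\<close>

definition sec_sq :: "real \<Rightarrow> real" where
  "sec_sq x = (pi - 2 * x) ^ 2 / cos x"

lemma cos_lower: "0 \<le> x \<Longrightarrow> x \<le> pi/2 \<Longrightarrow> pi - 2 * x \<le> pi * cos x"
  using sin_lower[of "pi/2 - x"] by (simp add: cos_sin_eq algebra_simps)

lemma sec_sq_bound: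
  assumes "0 \<le> x" "x \<le> pi/2"
  shows "\<bar>sec_sq x\<bar> \<le> pi * (pi - 2 * x)"
proof (cases "x = pi/2")
  case False
  then have x: "x < pi/2" using assms by simp
  then have c: "cos x > 0" using assms by (intro cos_gt_zero_pi) auto
  have "(pi - 2 * x) * (pi - 2 * x) \<le> (pi - 2 * x) * (pi * cos x)"
    using x assms by (intro mult_left_mono cos_lower) auto
  then show ?thesis using c by (simp add: sec_sq_def power2_eq_square pos_divide_le_eq mult_ac)
next
  case True
  show ?thesis unfolding True sec_sq_def by simp
qed

lemma continuous_sec_sq: "continuous_on {0..pi/2} sec_sq"
  unfolding continuous_on_def
proof
  fix x :: real assume x: "x \<in> {0..pi/2}"
  show "(sec_sq \<longlongrightarrow> sec_sq x) (at x within {0..pi/2})"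
  proof (cases "x = pi/2")
    case True
    have "((\<lambda>x. pi * (pi - 2 * x)) \<longlongrightarrow> pi * (pi - 2 * (pi/2))) (at (pi/2) within {0..pi/2})"
      by (intro tendsto_intros)
    then have "((\<lambda>x. pi * (pi - 2 * x)) \<longlongrightarrow> 0) (at x within {0..pi/2})" by (simp add: True)
    moreover have "\<forall>\<^sub>F x in at x within {0..pi/2}. norm (sec_sq x) \<le> pi * (pi - 2 * x)"
      using sec_sq_bound by (auto simp: eventually_at_filter)
    ultimately have "(sec_sq \<longlongrightarrow> 0) (at x within {0..pi/2})" by (rule Lim_null_comparison[rotated])
    then show ?thesis by (simp add: True sec_sq_def)
  next
    case False
    with x have "cos x > 0" by (intro cos_gt_zero_pi) auto
    then show ?thesis unfolding sec_sq_def by (intro tendsto_intros) auto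
  qed
qed

lemma deriv_sec_sq:
  assumes "0 < x" "x < pi/2"
  shows "(sec_sq has_real_derivative ((pi - 2 * x) ^ 2 * sin x - 4 * (pi - 2 * x) * cos x) / cos x ^ 2) (at x)"
    and "\<bar>((pi - 2 * x) ^ 2 * sin x - 4 * (pi - 2 * x) * cos x) / cos x ^ 2\<bar> \<le> pi ^ 2 + 4 * pi"
proof -
  have c: "cos x > 0" using assms by (intro cos_gt_zero_pi) auto
  show "(sec_sq has_real_derivative ((pi - 2 * x) ^ 2 * sin x - 4 * (pi - 2 * x) * cos x) / cos x ^ 2) (at x)"
    unfolding sec_sq_def[abs_def] using c
    by (auto intro!: derivative_eq_intros simp: power2_eq_square algebra_simps)
  define q where "q = (pi - 2 * x) / cos x"
  have q: "0 \<le> q" "q \<le> pi"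
    using cos_lower[of x] assms c by (auto simp: q_def pos_divide_le_eq)
  have "((pi - 2 * x) ^ 2 * sin x - 4 * (pi - 2 * x) * cos x) / cos x ^ 2 = q ^ 2 * sin x - 4 * q"
    using c by (simp add: q_def power2_eq_square field_simps)
  moreover have "\<bar>q ^ 2 * sin x\<bar> \<le> pi ^ 2 * 1"
    unfolding abs_mult using q by (intro mult_mono) (auto intro!: power_mono)
  moreover have "4 * q \<le> 4 * pi" using q by simp
  ultimately show "\<bar>((pi - 2 * x) ^ 2 * sin x - 4 * (pi - 2 * x) * cos x) / cos x ^ 2\<bar> \<le> pi ^ 2 + 4 * pi"
    using q by (simp add: abs_le_iff)
qed

text \<open>Multiplication by cos x turns 2 sin (2(K+1)x) into sin ((2K+1)x) + sin ((2K+3)x), so the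
  alternating sum telescopes.\<close>

lemma tan_partial_fourier:
  assumes "cos x \<noteq> 0"
  shows "(\<Sum>k<K. 2 * (- 1) ^ k * sin (2 * real (Suc k) * x)) = tan x - (- 1) ^ K * sin (real (2 * K + 1) * x) / cos x"
proof (induction K)
  case 0
  then show ?case by (simp add: tan_def)
next
  case (Suc K)
  define y where "y = 2 * real (Suc K) * x"
  have a: "real (2 * K + 1) * x = y - x" "real (2 * Suc K + 1) * x = y + x"
    by (simp_all add: y_def algebra_simps)
  have "2 * sin y * cos x = sin (y - x) + sin (y + x)" by (simp add: sin_add sin_diff)
  then have "2 * sin y = sin (y - x) / cos x + sin (y + x) / cos x" using assms by (simp add: field_simps)
  then have "2 * (- 1) ^ K * sin y = (- 1) ^ K * sin (y - x) / cos x + (- 1) ^ K * sin (y + x) / cos x"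
    by (metis (no_types, opaque_lifting) distrib_left mult.assoc mult.left_commute times_divide_eq_right)
  then show ?case using Suc unfolding a by (simp add: y_def)
qed

text \<open>The terms of the sine series do not tend to 0 for general x, so the limit is taken after
  integration: the remainder is an oscillating integral of order 1/(2K+1). The double zero of F at
  pi/2 compensates 1/cos x.\<close>

lemma tan_integral_fourier:
  fixes p :: "real poly"
  defines "F \<equiv> \<lambda>x. (pi - 2 * x) ^ 2 * poly p x"
  shows "(\<lambda>k. 2 * (- 1) ^ k * integral {0..pi/2} (\<lambda>x. F x * sin (2 * real (Suc k) * x))) sums
     integral {0..pi/2} (\<lambda>x. tan x * F x)"
proof -
  define h where "h x = sec_sq x * poly p x" for x
  let ?u' = "\<lambda>x. ((pi - 2 * x) ^ 2 * sin x - 4 * (pi - 2 * x) * cos x) / cos x ^ 2"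
  define h' where "h' x = ?u' x * poly p x + poly (pderiv p) x * sec_sq x" for x
  have ch: "continuous_on {0..pi/2} h"
    unfolding h_def by (intro continuous_intros continuous_sec_sq)
  have dh: "(h has_real_derivative h' x) (at x)" if "0 < x" "x < pi/2" for x
    unfolding h_def[abs_def] h'_def by (intro DERIV_mult deriv_sec_sq(1) that poly_DERIV)
  have bp: "\<exists>B\<ge>0. \<forall>x\<in>{0..pi/2}. \<bar>poly q x\<bar> \<le> B" for q :: "real poly"
  proof -
    have "bounded (poly q ` {0..pi/2})"
      by (intro compact_imp_bounded compact_continuous_image continuous_intros compact_Icc)
    then obtain B where B: "\<forall>y\<in>poly q ` {0..pi/2}. norm y \<le> B" unfolding bounded_iff by blast
    then have "\<bar>poly q 0\<bar> \<le> B" by auto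
    then have "B \<ge> 0" by linarith
    with B show ?thesis by (intro exI[of _ B]) auto
  qed
  obtain B1 where B1: "B1 \<ge> 0" "\<And>x. x \<in> {0..pi/2} \<Longrightarrow> \<bar>poly p x\<bar> \<le> B1" using bp[of p] by blast
  obtain B2 where B2: "B2 \<ge> 0" "\<And>x. x \<in> {0..pi/2} \<Longrightarrow> \<bar>poly (pderiv p) x\<bar> \<le> B2" using bp[of "pderiv p"] by blast
  define B where "B = (pi ^ 2 + 4 * pi) * B1 + B2 * (pi * pi)"
  have B0: "B \<ge> 0" using B1 B2 by (simp add: B_def)
  have bh: "\<bar>h' x\<bar> \<le> B" if x: "0 < x" "x < pi/2" for x
  proof -
    have "\<bar>sec_sq x\<bar> \<le> pi * (pi - 2 * x)" using x by (intro sec_sq_bound) auto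
    also have "\<dots> \<le> pi * pi" using x by (intro mult_left_mono) auto
    finally have s: "\<bar>sec_sq x\<bar> \<le> pi * pi" .
    have "\<bar>h' x\<bar> \<le> \<bar>?u' x * poly p x\<bar> + \<bar>poly (pderiv p) x * sec_sq x\<bar>"
      unfolding h'_def by (rule abs_triangle_ineq)
    also have "\<dots> \<le> B"
      unfolding B_def abs_mult using x B1 B2 s deriv_sec_sq(2)[OF x]
      by (intro add_mono mult_mono) auto
    finally show ?thesis .
  qed
  define C where "C = \<bar>h 0\<bar> + \<bar>h (pi/2)\<bar> + B * (pi/2)"
  have split: "(\<Sum>k<K. 2 * (- 1) ^ k * (F x * sin (2 * real (Suc k) * x))) = tan x * F x - (- 1) ^ K * (h x * sin (real (2 * K + 1) * x))"
    if x: "x \<in> {0..pi/2}" for x K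
  proof (cases "x = pi/2")
    case True
    show ?thesis unfolding True F_def h_def sec_sq_def by simp
  next
    case False
    with x have c: "cos x > 0" by (intro cos_gt_zero_pi) auto
    have "(\<Sum>k<K. 2 * (- 1) ^ k * (F x * sin (2 * real (Suc k) * x))) = F x * (\<Sum>k<K. 2 * (- 1) ^ k * sin (2 * real (Suc k) * x))"
      unfolding sum_distrib_left by (intro sum.cong refl) (simp only: mult_ac)
    also have "\<dots> = F x * (tan x - (- 1) ^ K * sin (real (2 * K + 1) * x) / cos x)"
      using c by (subst tan_partial_fourier) auto
    also have "\<dots> = tan x * F x - (- 1) ^ K * (F x / cos x * sin (real (2 * K + 1) * x))"
    proof -
      have "f * (t - s * S / c) = t * f - s * (f / c * S)" for f t s S c :: real
        by (simp add: algebra_simps)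
      then show ?thesis .
    qed
    also have "F x / cos x = h x" by (simp add: F_def h_def sec_sq_def)
    finally show ?thesis .
  qed
  have cF: "continuous_on {0..pi/2} F" unfolding F_def by (intro continuous_intros)
  have it: "(\<lambda>x. tan x * F x) integrable_on {0..pi/2}"
  proof (rule integrable_continuous_pi2, rule continuous_on_eq)
    show "continuous_on {0..pi/2} (\<lambda>x. h x * sin x)" by (intro continuous_intros ch)
    fix x :: real assume "x \<in> {0..pi/2}"
    then show "h x * sin x = tan x * F x" by (simp add: h_def F_def sec_sq_def tan_def)
  qed
  have ih: "(\<lambda>x. h x * sin (real (2 * K + 1) * x)) integrable_on {0..pi/2}" for K
    by (intro integrable_continuous_pi2 continuous_intros ch)
  have partial: "(\<Sum>k<K. 2 * (- 1) ^ k * integral {0..pi/2} (\<lambda>x. F x * sin (2 * real (Suc k) * x))) =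
      integral {0..pi/2} (\<lambda>x. tan x * F x) - (- 1) ^ K * integral {0..pi/2} (\<lambda>x. h x * sin (real (2 * K + 1) * x))" for K
  proof -
    have "(\<Sum>k<K. 2 * (- 1) ^ k * integral {0..pi/2} (\<lambda>x. F x * sin (2 * real (Suc k) * x))) =
       (\<Sum>k<K. integral {0..pi/2} (\<lambda>x. 2 * (- 1) ^ k * (F x * sin (2 * real (Suc k) * x))))"
      by (simp only: integral_mult_right)
    also have "\<dots> = integral {0..pi/2} (\<lambda>x. \<Sum>k<K. 2 * (- 1) ^ k * (F x * sin (2 * real (Suc k) * x)))"
      by (intro integral_sum[symmetric] integrable_continuous_pi2 continuous_intros cF) simp
    also have "\<dots> = integral {0..pi/2} (\<lambda>x. tan x * F x - (- 1) ^ K * (h x * sin (real (2 * K + 1) * x)))"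
      by (rule integral_cong) (rule split)
    also have "\<dots> = integral {0..pi/2} (\<lambda>x. tan x * F x) - integral {0..pi/2} (\<lambda>x. (- 1) ^ K * (h x * sin (real (2 * K + 1) * x)))"
      by (intro integral_diff it integrable_on_mult_right ih)
    finally show ?thesis by (simp only: integral_mult_right)
  qed
  have "(\<lambda>K. (- 1) ^ K * integral {0..pi/2} (\<lambda>x. h x * sin (real (2 * K + 1) * x))) \<longlonglongrightarrow> 0"
  proof (rule Lim_null_comparison)
    show "\<forall>\<^sub>F K in sequentially. norm ((- 1) ^ K * integral {0..pi/2} (\<lambda>x. h x * sin (real (2 * K + 1) * x))) \<le> C / real (2 * K + 1)"
    proof (rule always_eventually, rule allI)
      fix K
      have "\<bar>integral {0..pi/2} (\<lambda>x. h x * sin (real (2 * K + 1) * x))\<bar> \<le> C / real (2 * K + 1)"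
        unfolding C_def by (rule oscillating_integral_bound[OF ch dh bh B0]) auto
      then show "norm ((- 1) ^ K * integral {0..pi/2} (\<lambda>x. h x * sin (real (2 * K + 1) * x))) \<le> C / real (2 * K + 1)"
        by (simp only: real_norm_def abs_mult power_abs abs_minus_cancel abs_one power_one mult_1)
    qed
    show "(\<lambda>K. C / real (2 * K + 1)) \<longlonglongrightarrow> 0" by real_asymp
  qed
  then have "(\<lambda>K. integral {0..pi/2} (\<lambda>x. tan x * F x) - (- 1) ^ K * integral {0..pi/2} (\<lambda>x. h x * sin (real (2 * K + 1) * x)))
     \<longlonglongrightarrow> integral {0..pi/2} (\<lambda>x. tan x * F x) - 0"
    by (intro tendsto_diff tendsto_const)
  then show ?thesis unfolding sums_def partial by simp
qed

text \<open>Two integrations by parts lower the degree by two and leave only even derivatives at the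
  ends, because the sine vanishes there. The signs are cos (k pi) = (-1)^k, and the degree bound
  ends the expansion.\<close>

lemma poly_sin_integral:
  fixes p :: "real poly"
  assumes "degree p < 2 * R" "k > 0"
  shows "integral {0..pi/2} (\<lambda>x. poly p (2 * x) * sin (2 * real k * x)) =
     (\<Sum>r<R. (- 1) ^ r * (poly ((pderiv ^^ (2 * r)) p) 0 - (- 1) ^ k * poly ((pderiv ^^ (2 * r)) p) pi) / real k ^ (2 * r + 1)) / 2"
  using assms(1)
proof (induction R arbitrary: p)
  case (Suc R)
  let ?k = "real k"
  let ?p1 = "pderiv p" and ?p2 = "pderiv (pderiv p)"
  have k: "?k > 0" using assms(2) by simp
  let ?F = "\<lambda>x. - (poly p (2 * x) * cos (2 * ?k * x)) / (2 * ?k) + poly ?p1 (2 * x) * sin (2 * ?k * x) / (2 * ?k ^ 2)"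
  have "((\<lambda>x. poly p (2 * x) * sin (2 * ?k * x) + poly ?p2 (2 * x) * sin (2 * ?k * x) / ?k ^ 2) has_integral (?F (pi/2) - ?F 0)) {0..pi/2}"
  proof (rule fundamental_theorem_of_calculus)
    fix x :: real
    have d: "((\<lambda>x. poly q (2 * x)) has_real_derivative poly (pderiv q) (2 * x) * 2) (at x within {0..pi/2})" for q :: "real poly"
      by (intro DERIV_chain'[OF _ poly_DERIV]) (auto intro!: derivative_eq_intros)
    have s: "((\<lambda>x. sin (2 * ?k * x)) has_real_derivative cos (2 * ?k * x) * (2 * ?k)) (at x within {0..pi/2})"
      and c: "((\<lambda>x. cos (2 * ?k * x)) has_real_derivative - sin (2 * ?k * x) * (2 * ?k)) (at x within {0..pi/2})"
      by (auto intro!: derivative_eq_intros)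
    have "(?F has_real_derivative - (poly ?p1 (2 * x) * 2 * cos (2 * ?k * x) + - sin (2 * ?k * x) * (2 * ?k) * poly p (2 * x)) / (2 * ?k)
        + (poly ?p2 (2 * x) * 2 * sin (2 * ?k * x) + cos (2 * ?k * x) * (2 * ?k) * poly ?p1 (2 * x)) / (2 * ?k ^ 2)) (at x within {0..pi/2})"
      by (intro DERIV_add DERIV_cdivide DERIV_minus DERIV_mult d s c)
    also have "- (poly ?p1 (2 * x) * 2 * cos (2 * ?k * x) + - sin (2 * ?k * x) * (2 * ?k) * poly p (2 * x)) / (2 * ?k)
        + (poly ?p2 (2 * x) * 2 * sin (2 * ?k * x) + cos (2 * ?k * x) * (2 * ?k) * poly ?p1 (2 * x)) / (2 * ?k ^ 2) =
       poly p (2 * x) * sin (2 * ?k * x) + poly ?p2 (2 * x) * sin (2 * ?k * x) / ?k ^ 2"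
      using k by (simp add: field_simps power2_eq_square)
    finally show "(?F has_vector_derivative poly p (2 * x) * sin (2 * ?k * x) + poly ?p2 (2 * x) * sin (2 * ?k * x) / ?k ^ 2) (at x within {0..pi/2})"
      by (simp only: has_real_derivative_iff_has_vector_derivative)
  qed simp
  moreover have "?F (pi/2) - ?F 0 = (poly p 0 - (- 1) ^ k * poly p pi) / ?k / 2"
  proof -
    have "cos (2 * ?k * (pi/2)) = (- 1) ^ k" "sin (2 * ?k * (pi/2)) = 0"
      using cos_npi[of k] sin_npi[of k] by simp_all
    then show ?thesis using k by (simp add: diff_divide_distrib add_divide_distrib mult.commute)
  qed
  ultimately have 1: "integral {0..pi/2} (\<lambda>x. poly p (2 * x) * sin (2 * ?k * x) + poly ?p2 (2 * x) * sin (2 * ?k * x) / ?k ^ 2) =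
      (poly p 0 - (- 1) ^ k * poly p pi) / ?k / 2"
    by (simp only: integral_unique)
  have ci: "(\<lambda>x. poly q (2 * x) * sin (2 * ?k * x)) integrable_on {0..pi/2}" for q
    by (intro integrable_continuous_pi2 continuous_intros)
  have "integral {0..pi/2} (\<lambda>x. poly p (2 * x) * sin (2 * ?k * x) + poly ?p2 (2 * x) * sin (2 * ?k * x) / ?k ^ 2) =
     integral {0..pi/2} (\<lambda>x. poly p (2 * x) * sin (2 * ?k * x)) + integral {0..pi/2} (\<lambda>x. poly ?p2 (2 * x) * sin (2 * ?k * x)) / ?k ^ 2"
    using k unfolding integral_divide[symmetric]
    by (intro integral_add ci integrable_on_divide)
  with 1 have 2: "integral {0..pi/2} (\<lambda>x. poly p (2 * x) * sin (2 * ?k * x)) =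
     (poly p 0 - (- 1) ^ k * poly p pi) / ?k / 2 - integral {0..pi/2} (\<lambda>x. poly ?p2 (2 * x) * sin (2 * ?k * x)) / ?k ^ 2"
    by linarith
  show ?case
  proof (cases "R = 0")
    case True
    then have "degree p < 2" using Suc.prems by simp
    then have "degree (pderiv p) = 0" by (simp add: degree_pderiv)
    then have "?p2 = 0" by (simp add: pderiv_eq_0_iff)
    then show ?thesis unfolding 2 True by simp
  next
    case False
    have "degree ?p2 < 2 * R" using Suc.prems False by (simp add: degree_pderiv)
    note IH = Suc.IH[OF this]
    have e: "(pderiv ^^ (2 * r)) ?p2 = (pderiv ^^ (2 * Suc r)) p" for r
      by (simp add: funpow_Suc_right del: funpow.simps)
    have "(\<Sum>r<R. (- 1) ^ r * (poly ((pderiv ^^ (2 * Suc r)) p) 0 - (- 1) ^ k * poly ((pderiv ^^ (2 * Suc r)) p) pi) / ?k ^ (2 * r + 1)) / 2 / ?k ^ 2 =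
      - ((\<Sum>r<R. (- 1) ^ Suc r * (poly ((pderiv ^^ (2 * Suc r)) p) 0 - (- 1) ^ k * poly ((pderiv ^^ (2 * Suc r)) p) pi) / ?k ^ (2 * Suc r + 1)) / 2)"
      unfolding sum_divide_distrib sum_negf[symmetric]
      using k by (intro sum.cong refl) (simp add: power2_eq_square del: funpow.simps)
    then show ?thesis
      unfolding 2 IH e sum.lessThan_Suc_shift by (simp add: add_divide_distrib del: funpow.simps)
  qed
qed simp

lemma poly_higher_pderiv_0: "poly ((pderiv ^^ n) p) 0 = fact n * coeff p n"
  for p :: "real poly"
  by (simp add: poly_0_coeff_0 coeff_higher_pderiv pochhammer_fact)

text \<open>Reflection costs a sign per derivative, and the order is even. Derivatives at pi thus
  become derivatives at 0 of the reflected polynomial.\<close>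

lemma higher_pderiv_reflect:
  fixes p :: "real poly"
  shows "(pderiv ^^ (2 * r)) (pcompose p [:c, - 1:]) = pcompose ((pderiv ^^ (2 * r)) p) [:c, - 1:]"
proof (induction r)
  case (Suc r)
  have d: "pderiv [:c, - 1:] = [:- 1:]" for c :: real by (simp add: pderiv_pCons)
  have "pderiv (pderiv (pcompose q [:c, - 1:])) = pcompose (pderiv (pderiv q)) [:c, - 1:]" for q :: "real poly"
    by (simp add: pderiv_pcompose d pderiv_minus)
  then show ?case using Suc by simp
qed simp

text \<open>Up to a constant a Bernstein polynomial on [0, pi]; its value at 2x is the factor of tan
  x in \<open>mzv_twos_three_twos\<close>.\<close>

definition bern_poly :: "nat \<Rightarrow> nat \<Rightarrow> real poly" where
  "bern_poly i j = smult (1 / (fact i * fact j)) (monom 1 i * [:pi, - 1:] ^ j)"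

lemma poly_bern_poly: "poly (bern_poly i j) x = x ^ i / fact i * ((pi - x) ^ j / fact j)"
  by (simp add: bern_poly_def poly_monom)

lemma bern_poly_reflect: "pcompose (bern_poly i j) [:pi, - 1:] = bern_poly j i"
proof -
  have "poly (pcompose (bern_poly i j) [:pi, - 1:]) = poly (bern_poly j i)"
    by (rule ext) (simp add: poly_pcompose poly_bern_poly mult_ac)
  then show ?thesis by (simp only: poly_eq_poly_eq_iff)
qed

lemma degree_bern_poly: "degree (bern_poly i j) \<le> i + j"
proof -
  have "degree (monom (1::real) i * [:pi, - 1:] ^ j) \<le> i + j"
    using degree_mult_le[of "monom (1::real) i" "[:pi, - 1:] ^ j"] degree_power_le[of "[:pi, - 1:]" j]
    by (simp add: degree_monom_eq)
  then show ?thesis unfolding bern_poly_def using degree_smult_le order_trans by blast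
qed

text \<open>For n < i both sides vanish, the right one through its binomial; otherwise the
  coefficient of x^(n-i) in (pi - x)^j is read off.\<close>

lemma bern_poly_deriv_0:
  assumes "n \<le> i + j"
  shows "poly ((pderiv ^^ n) (bern_poly i j)) 0 = (- 1) ^ (n - i) * real (n choose i) * pi ^ (i + j - n) / fact (i + j - n)"
proof (cases "n < i")
  case True
  then show ?thesis by (simp add: poly_higher_pderiv_0 bern_poly_def coeff_monom_mult)
next
  case False
  define m where "m = n - i"
  have m: "n = i + m" "m \<le> j" using False assms by (auto simp: m_def)
  have "poly ((pderiv ^^ n) (bern_poly i j)) 0 = fact n * (1 / (fact i * fact j) * (real (j choose m) * (- 1) ^ m * pi ^ (j - m)))"
    using m by (simp add: poly_higher_pderiv_0 bern_poly_def coeff_monom_mult coeff_linear_poly_power)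
  also have "real (j choose m) = fact j / (fact m * fact (j - m))" using m by (simp add: binomial_fact)
  also have "fact n * (1 / (fact i * fact j) * (fact j / (fact m * fact (j - m)) * (- 1) ^ m * pi ^ (j - m))) =
     (- 1) ^ m * (fact n / (fact i * fact m)) * pi ^ (j - m) / fact (j - m)" by (simp add: mult_ac)
  also have "fact n / (fact i * fact m) = real (n choose i)" using m by (simp add: binomial_fact)
  finally show ?thesis using m by simp
qed

lemma zeta_val_sums:
  assumes "s \<ge> 2"
  shows "(\<lambda>k. 1 / real (Suc k) ^ s) sums zeta_val s"
proof -
  have "summable (\<lambda>k. 1 / real (Suc k) ^ s)"
    using inverse_power_summable[OF assms, where 'a = real] by (subst summable_Suc_iff) (simp add: inverse_eq_divide)
  then show ?thesis using assms by (simp add: zeta_val_def summable_sums)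
qed

text \<open>The terms with even denominator are subtracted twice; they sum to 2^(-(2r+1))
  \<zeta>(2r+1), and doubling gives the factor 1/4^r.\<close>

lemma alternating_zeta_val_sums:
  assumes "r \<ge> 1"
  shows "(\<lambda>k. (- 1) ^ k / real (Suc k) ^ (2 * r + 1)) sums ((1 - 1 / 4 ^ r) * zeta_val (2 * r + 1))"
proof -
  let ?s = "2 * r + 1"
  have z: "(\<lambda>k. 1 / real (Suc k) ^ ?s) sums zeta_val ?s" by (rule zeta_val_sums) (use assms in auto)
  define g where "g k = (if odd k then 2 / real (Suc k) ^ ?s else 0)" for k
  have "(\<lambda>n. g (2 * n + 1)) sums (1 / 4 ^ r * zeta_val ?s)"
  proof -
    have "g (2 * n + 1) = 1 / 4 ^ r * (1 / real (Suc n) ^ ?s)" for n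
    proof -
      have "real (Suc (2 * n + 1)) = 2 * real (Suc n)" by simp
      then have "g (2 * n + 1) = 2 / (2 * real (Suc n)) ^ ?s" unfolding g_def by simp
      also have "\<dots> = 1 / 4 ^ r * (1 / real (Suc n) ^ ?s)"
      proof -
        have "2 / (2 * x) ^ ?s = 1 / 4 ^ r * (1 / x ^ ?s)" for x :: real
          by (simp add: power_mult_distrib power_mult)
        then show ?thesis .
      qed
      finally show ?thesis .
    qed
    then show ?thesis using sums_mult[OF z, of "1 / 4 ^ r"] by simp
  qed
  moreover have "(\<lambda>n. g (2 * n + 1)) sums (1 / 4 ^ r * zeta_val ?s) \<longleftrightarrow> g sums (1 / 4 ^ r * zeta_val ?s)"
  proof (rule sums_mono_reindex)
    show "strict_mono (\<lambda>n. 2 * n + 1 :: nat)" by (simp add: strict_mono_def)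
    fix n :: nat assume "n \<notin> range (\<lambda>n. 2 * n + 1)"
    then have "even n" by (metis oddE rangeI)
    then show "g n = 0" by (simp add: g_def)
  qed
  ultimately have "g sums (1 / 4 ^ r * zeta_val ?s)" by simp
  from sums_diff[OF z this]
  have "(\<lambda>k. 1 / real (Suc k) ^ ?s - g k) sums (zeta_val ?s - 1 / 4 ^ r * zeta_val ?s)" .
  moreover have "1 / real (Suc k) ^ ?s - g k = (- 1) ^ k / real (Suc k) ^ ?s" for k
    by (cases "odd k") (simp_all add: g_def)
  ultimately show ?thesis by (simp add: left_diff_distrib)
qed

text \<open>The sign (-1)^k of the sine series meets the (-1)^k of \<open>poly_sin_integral\<close>:
  derivatives at pi give plain zeta values, those at 0 alternating ones, whence the factor 1 -
  1/4^r. The binomials are derivatives of \<open>bern_poly\<close>.\<close>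

lemma tan_bern_poly_integral:
  fixes a b :: nat
  defines "i \<equiv> 2 * b + 1" and "j \<equiv> 2 * a + 2"
  shows "integral {0..pi/2} (\<lambda>x. tan x * poly (bern_poly i j) (2 * x)) =
     (\<Sum>r=1..a + b + 1. (- 1) ^ r * (real (2 * r choose j) - (1 - 1 / 4 ^ r) * real (2 * r choose i))
        * (pi ^ (i + j - 2 * r) / fact (i + j - 2 * r)) * zeta_val (2 * r + 1))"
proof -
  define R where "R = a + b + 2"
  define D0 where "D0 r = poly ((pderiv ^^ (2 * r)) (bern_poly i j)) 0" for r
  define D1 where "D1 r = poly ((pderiv ^^ (2 * r)) (bern_poly i j)) pi" for r
  \<comment> \<open>Since j = 2a + 2, the square of pi - 2x required by
    \<open>tan_integral_fourier\<close> can be split off.\<close>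
  define P where "P = pcompose (smult (1 / (fact i * fact j)) (monom 1 i * [:pi, - 1:] ^ (2 * a))) [:0, 2:]"
  have F: "(pi - 2 * x) ^ 2 * poly P x = poly (bern_poly i j) (2 * x)" for x
    by (simp add: P_def poly_bern_poly poly_pcompose poly_monom j_def power_add power2_eq_square mult.commute)
  have deg: "degree (bern_poly i j) < 2 * R" using degree_bern_poly[of i j] by (simp add: i_def j_def R_def)
  have S1: "(\<lambda>k. 2 * (- 1) ^ k * integral {0..pi/2} (\<lambda>x. poly (bern_poly i j) (2 * x) * sin (2 * real (Suc k) * x))) sums
     integral {0..pi/2} (\<lambda>x. tan x * poly (bern_poly i j) (2 * x))"
    using tan_integral_fourier[of P] unfolding F .
  have t: "2 * (- 1) ^ k * integral {0..pi/2} (\<lambda>x. poly (bern_poly i j) (2 * x) * sin (2 * real (Suc k) * x)) =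
     (\<Sum>r<R. (- 1) ^ r * (D0 r * ((- 1) ^ k / real (Suc k) ^ (2 * r + 1)) + D1 r * (1 / real (Suc k) ^ (2 * r + 1))))" for k
  proof -
    have s: "(- 1) ^ k * ((- 1) ^ r * (d - (- 1) ^ Suc k * e) / x) = (- 1) ^ r * (d * ((- 1) ^ k / x) + e * (1 / x))" for r d e and x :: real
      by (cases "even k") (simp_all add: algebra_simps add_divide_distrib diff_divide_distrib)
    have "2 * (- 1) ^ k * integral {0..pi/2} (\<lambda>x. poly (bern_poly i j) (2 * x) * sin (2 * real (Suc k) * x)) =
       (\<Sum>r<R. (- 1) ^ k * ((- 1) ^ r * (D0 r - (- 1) ^ Suc k * D1 r) / real (Suc k) ^ (2 * r + 1)))"
      unfolding poly_sin_integral[OF deg zero_less_Suc] D0_def D1_def sum_distrib_left[symmetric] by simp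
    then show ?thesis unfolding s .
  qed
  \<comment> \<open>For r = 0 the exponent is 1 and one of the two series diverges. The polynomial
    vanishes at both ends, so \<zeta>(1) never enters.\<close>
  have z0: "D0 0 = 0" "D1 0 = 0" by (simp_all add: D0_def D1_def poly_bern_poly i_def j_def)
  have S2: "(\<lambda>k. (- 1) ^ r * (D0 r * ((- 1) ^ k / real (Suc k) ^ (2 * r + 1)) + D1 r * (1 / real (Suc k) ^ (2 * r + 1)))) sums
     ((- 1) ^ r * (D0 r * ((1 - 1 / 4 ^ r) * zeta_val (2 * r + 1)) + D1 r * zeta_val (2 * r + 1)))" for r
  proof (cases "r = 0")
    case True
    then show ?thesis by (simp add: z0)
  next
    case False
    then show ?thesis
      by (intro sums_mult sums_add alternating_zeta_val_sums zeta_val_sums) auto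
  qed
  have "integral {0..pi/2} (\<lambda>x. tan x * poly (bern_poly i j) (2 * x)) =
     (\<Sum>r<R. (- 1) ^ r * (D0 r * ((1 - 1 / 4 ^ r) * zeta_val (2 * r + 1)) + D1 r * zeta_val (2 * r + 1)))"
    using S1 sums_sum[OF S2] unfolding t by (rule sums_unique2)
  also have "\<dots> = (\<Sum>r=1..a + b + 1. (- 1) ^ r * (D0 r * ((1 - 1 / 4 ^ r) * zeta_val (2 * r + 1)) + D1 r * zeta_val (2 * r + 1)))"
    by (rule sum.mono_neutral_right) (auto simp: R_def z0 not_le)
  also have "\<dots> = (\<Sum>r=1..a + b + 1. (- 1) ^ r * (real (2 * r choose j) - (1 - 1 / 4 ^ r) * real (2 * r choose i))
        * (pi ^ (i + j - 2 * r) / fact (i + j - 2 * r)) * zeta_val (2 * r + 1))"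
  proof (rule sum.cong)
    fix r assume r: "r \<in> {1..a + b + 1}"
    then have le: "2 * r \<le> i + j" "2 * r \<le> j + i" by (auto simp: i_def j_def)
    let ?c = "pi ^ (i + j - 2 * r) / fact (i + j - 2 * r)"
    have 0: "D0 r = - real (2 * r choose i) * ?c"
    proof (cases "2 * r < i")
      case True
      then show ?thesis using bern_poly_deriv_0[OF le(1)] by (simp add: D0_def)
    next
      case False
      then have "odd (2 * r - i)" by (simp add: i_def)
      then show ?thesis using bern_poly_deriv_0[OF le(1)] by (simp add: D0_def)
    qed
    have "D1 r = poly (pcompose ((pderiv ^^ (2 * r)) (bern_poly i j)) [:pi, - 1:]) 0"
      by (simp add: D1_def poly_pcompose)
    also have "\<dots> = poly ((pderiv ^^ (2 * r)) (bern_poly j i)) 0"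
      unfolding higher_pderiv_reflect[symmetric] bern_poly_reflect ..
    also have "\<dots> = (- 1) ^ (2 * r - j) * real (2 * r choose j) * pi ^ (j + i - 2 * r) / fact (j + i - 2 * r)"
      by (rule bern_poly_deriv_0[OF le(2)])
    also have "(- 1) ^ (2 * r - j) = (1::real)" by (simp add: j_def)
    finally have 1: "D1 r = real (2 * r choose j) * ?c" by (simp add: add.commute)
    show "(- 1) ^ r * (D0 r * ((1 - 1 / 4 ^ r) * zeta_val (2 * r + 1)) + D1 r * zeta_val (2 * r + 1)) =
       (- 1) ^ r * (real (2 * r choose j) - (1 - 1 / 4 ^ r) * real (2 * r choose i)) * ?c * zeta_val (2 * r + 1)"
    proof -
      have "s * (- A * c * (t * z) + B * c * z) = s * (B - t * A) * c * z" for s A B c t z :: real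
        by (simp add: algebra_simps)
      then show ?thesis unfolding 0 1 .
    qed
  qed simp
  finally show ?thesis .
qed

lemma zagier_twos_three_twos:
  "mzv (replicate a 2 @ [3] @ replicate b 2) =
     2 / pi * (\<Sum>r=1..a + b + 1. (- 1) ^ r * (real (2 * r choose (2 * a + 2)) - (1 - 1 / 4 ^ r) * real (2 * r choose (2 * b + 1)))
        * (pi ^ (2 * (a + b + 1 - r) + 1) / fact (2 * (a + b + 1 - r) + 1)) * zeta_val (2 * r + 1))"
proof -
  have "mzv (replicate a 2 @ [3] @ replicate b 2) =
     2 / pi * integral {0..pi/2} (\<lambda>x. tan x * poly (bern_poly (2 * b + 1) (2 * a + 2)) (2 * x))"
    unfolding mzv_twos_three_twos poly_bern_poly ..
  moreover have "2 * b + 1 + (2 * a + 2) - 2 * r = 2 * (a + b + 1 - r) + 1" if "r \<in> {1..a + b + 1}" for r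
    using that by auto
  ultimately show ?thesis unfolding tan_bern_poly_integral by simp
qed

section \<open>Summation over the index\<close>

text \<open>Up to a power of pi the product of \<zeta>({2}^l) and \<zeta>({2}^(m-l)). It is a
  normalized binomial coefficient with odd lower index, which makes its sums computable.\<close>

definition odd_fact_prod :: "nat \<Rightarrow> nat \<Rightarrow> real" where
  "odd_fact_prod m l = 1 / (fact (2 * l + 1) * fact (2 * (m - l) + 1))"

lemma odd_fact_prod_choose:
  "l \<le> m \<Longrightarrow> odd_fact_prod m l = real ((2 * m + 2) choose (2 * l + 1)) / fact (2 * m + 2)"
proof -
  assume l: "l \<le> m"
  then have e: "2 * m + 2 - (2 * l + 1) = 2 * (m - l) + 1" by simp
  have "real ((2 * m + 2) choose (2 * l + 1)) = fact (2 * m + 2) / (fact (2 * l + 1) * fact (2 * (m - l) + 1))"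
    using l by (subst binomial_fact) (auto simp only: e)
  then show ?thesis by (simp add: odd_fact_prod_def del: fact_Suc)
qed

lemma sum_choose_odd: "(\<Sum>l\<le>m. real ((2 * m + 2) choose (2 * l + 1))) = 2 ^ (2 * m + 1)"
proof -
  have "2 * (\<Sum>i\<le>2 * m + 2. if odd i then real ((2 * m + 2) choose i) else 0) = 2 ^ (2 * m + 2)"
    by (rule choose_odd_sum) simp
  moreover have "(\<Sum>i\<le>2 * m + 2. if odd i then real ((2 * m + 2) choose i) else 0) =
     (\<Sum>i\<in>(\<lambda>l. 2 * l + 1) ` {..m}. real ((2 * m + 2) choose i))"
  proof (rule sum.mono_neutral_cong_right)
    show "(\<lambda>l. 2 * l + 1) ` {..m} \<subseteq> {..2 * m + 2}" by auto
    show "\<forall>i\<in>{..2 * m + 2} - (\<lambda>l. 2 * l + 1) ` {..m}. (if odd i then real ((2 * m + 2) choose i) else 0) = 0"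
    proof
      fix i assume i: "i \<in> {..2 * m + 2} - (\<lambda>l. 2 * l + 1) ` {..m}"
      have "even i"
      proof (rule ccontr)
        assume "odd i"
        then obtain l where "i = 2 * l + 1" by (rule oddE)
        with i show False by auto
      qed
      then show "(if odd i then real ((2 * m + 2) choose i) else 0) = 0" by simp
    qed
  qed auto
  moreover have "(\<Sum>i\<in>(\<lambda>l. 2 * l + 1) ` {..m}. real ((2 * m + 2) choose i)) = (\<Sum>l\<le>m. real ((2 * m + 2) choose (2 * l + 1)))"
    by (subst sum.reindex) (auto simp: inj_on_def)
  ultimately show ?thesis by simp
qed

lemma sum_odd_fact_prod: "(\<Sum>l\<le>m. odd_fact_prod m l) = 2 ^ (2 * m + 1) / fact (2 * m + 2)"
proof -
  have "(\<Sum>l\<le>m. odd_fact_prod m l) = (\<Sum>l\<le>m. real ((2 * m + 2) choose (2 * l + 1)) / fact (2 * m + 2))"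
    by (intro sum.cong refl odd_fact_prod_choose) simp
  then show ?thesis by (simp only: sum_divide_distrib[symmetric] sum_choose_odd)
qed

text \<open>For odd m the terms l and m - l have opposite signs and cancel.\<close>

lemma alternating_flip:
  fixes f :: "nat \<Rightarrow> real"
  assumes "odd m" "\<And>l. l \<le> m \<Longrightarrow> f (m - l) = f l"
  shows "(\<Sum>l\<le>m. (- 1) ^ l * f l) = 0"
proof -
  have "(\<Sum>l\<le>m. (- 1) ^ l * f l) = (\<Sum>l\<le>m. (- 1) ^ (m - l) * f (m - l))"
    by (rule sum.reindex_bij_witness[of _ "\<lambda>l. m - l" "\<lambda>l. m - l"]) auto
  also have "\<dots> = (\<Sum>l\<le>m. - ((- 1) ^ l * f l))"
  proof (rule sum.cong)
    fix l assume l: "l \<in> {..m}"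
    then have "(- 1 :: real) ^ (m - l) = - ((- 1) ^ l)" using assms(1) by (auto simp: minus_one_power_iff)
    then show "(- 1) ^ (m - l) * f (m - l) = - ((- 1) ^ l * f l)" using l assms(2) by simp
  qed simp
  finally show ?thesis by (simp add: sum_negf)
qed

lemma alternating_odd_fact_prod: "odd m \<Longrightarrow> (\<Sum>l\<le>m. (- 1) ^ l * odd_fact_prod m l) = 0"
  by (rule alternating_flip) (auto simp: odd_fact_prod_def mult.commute)

lemma alternating_choose_odd:
  assumes "odd m"
  shows "(\<Sum>b\<le>m. (- 1) ^ b * real ((2 * m + 2) choose (2 * b + 1))) = 0"
  using assms
proof (rule alternating_flip)
  fix l assume "l \<le> m"
  then have "2 * m + 2 - (2 * (m - l) + 1) = 2 * l + 1" by auto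
  moreover have "(2 * m + 2) choose (2 * (m - l) + 1) = (2 * m + 2) choose (2 * m + 2 - (2 * (m - l) + 1))"
    by (rule binomial_symmetric) simp
  ultimately show "real ((2 * m + 2) choose (2 * (m - l) + 1)) = real ((2 * m + 2) choose (2 * l + 1))" by simp
qed

text \<open>The real part of (1 + i)^(2r) = (2i)^r: it is 0 for odd r and (-4)^m for r = 2m.\<close>

definition alt_choose :: "nat \<Rightarrow> real" where
  "alt_choose r = (\<Sum>j\<le>r. (- 1) ^ j * real ((2 * r) choose (2 * j)))"

lemma alt_choose_odd:
  assumes "odd r"
  shows "alt_choose r = 0"
  unfolding alt_choose_def using assms
proof (rule alternating_flip)
  fix l assume "l \<le> r"
  then have "2 * r - 2 * (r - l) = 2 * l" by auto
  moreover have "(2 * r) choose (2 * (r - l)) = (2 * r) choose (2 * r - 2 * (r - l))"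
    by (rule binomial_symmetric) simp
  ultimately show "real ((2 * r) choose (2 * (r - l))) = real ((2 * r) choose (2 * l))" by simp
qed

lemma sum_even_indices:
  fixes f :: "nat \<Rightarrow> 'a::comm_monoid_add"
  shows "(\<Sum>i\<le>2 * r. if even i then f i else 0) = (\<Sum>j\<le>r. f (2 * j))"
proof -
  have "(\<Sum>i\<le>2 * r. if even i then f i else 0) = (\<Sum>i\<in>(\<lambda>j. 2 * j) ` {..r}. f i)"
  proof (rule sum.mono_neutral_cong_right)
    show "\<forall>i\<in>{..2 * r} - (\<lambda>j. 2 * j) ` {..r}. (if even i then f i else 0) = 0"
    proof
      fix i assume i: "i \<in> {..2 * r} - (\<lambda>j. 2 * j) ` {..r}"
      have "odd i"
      proof
        assume "even i"
        then obtain l where "i = 2 * l" by (rule evenE)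
        with i show False by auto
      qed
      then show "(if even i then f i else 0) = 0" by simp
    qed
  qed auto
  also have "\<dots> = (\<Sum>j\<le>r. f (2 * j))"
    by (subst sum.reindex) (auto simp: inj_on_def)
  finally show ?thesis .
qed

lemma alt_choose_even: "alt_choose (2 * m) = (- 4) ^ m"
proof -
  have i4: "(1 + \<i>) ^ (4 * m) = (- 4) ^ m"
    by (simp add: power_mult) (simp add: power4_eq_xxxx algebra_simps)
  have "Re ((1 + \<i>) ^ (4 * m)) = Re (\<Sum>k\<le>4 * m. of_nat ((4 * m) choose k) * \<i> ^ k)"
    using binomial_ring[of \<i> 1 "4 * m"] by (simp add: add.commute)
  also have "\<dots> = (\<Sum>k\<le>4 * m. real ((4 * m) choose k) * Re (\<i> ^ k))" by simp
  also have "\<dots> = (\<Sum>k\<le>2 * (2 * m). if even k then (- 1) ^ (k div 2) * real ((4 * m) choose k) else 0)"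
  proof (rule sum.cong)
    fix k
    show "real ((4 * m) choose k) * Re (\<i> ^ k) = (if even k then (- 1) ^ (k div 2) * real ((4 * m) choose k) else 0)"
    proof (cases "even k")
      case True
      then obtain j where "k = 2 * j" by (rule evenE)
      then show ?thesis by (simp add: power_mult minus_one_power_iff)
    next
      case False
      then obtain j where "k = 2 * j + 1" by (rule oddE)
      then show ?thesis by (simp add: power_mult minus_one_power_iff)
    qed
  qed simp
  also have "\<dots> = alt_choose (2 * m)"
    unfolding sum_even_indices alt_choose_def by (simp add: mult.assoc)
  finally have "Re ((- 4) ^ m) = alt_choose (2 * m)" unfolding i4 .
  moreover have "(- 4 :: complex) ^ m = of_real ((- 4) ^ m)" by simp
  ultimately show ?thesis by (metis Re_complex_of_real)
qed

lemma sum_choose_even: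
  assumes "r > 0"
  shows "(\<Sum>j\<le>r. real ((2 * r) choose (2 * j))) = 2 ^ (2 * r - 1)"
proof -
  have "2 * (\<Sum>i\<le>2 * r. if even i then real ((2 * r) choose i) else 0) = 2 ^ (2 * r)"
    using assms by (intro choose_even_sum) simp
  moreover have "(2::real) ^ (2 * r) = 2 * 2 ^ (2 * r - 1)"
    using assms by (metis Suc_pred' mult_pos_pos pos2 power_Suc)
  ultimately show ?thesis unfolding sum_even_indices by simp
qed

text \<open>With j = a + 1 these are the sums over all even binomials without j = 0; the two
  constants so produced cancel.\<close>

lemma sum_weight_even:
  assumes "r > 0"
  shows "(\<Sum>a<r. (2 + 2 * (- 1) ^ a) * real ((2 * r) choose (2 * a + 2))) = 4 ^ r - 2 * alt_choose r"
proof -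
  have s: "(\<Sum>j\<le>r. h j) = h 0 + (\<Sum>a<r. h (Suc a))" for h :: "nat \<Rightarrow> real"
    by (simp only: lessThan_Suc_atMost[symmetric] sum.lessThan_Suc_shift)
  have 1: "(\<Sum>a<r. real ((2 * r) choose (2 * a + 2))) = 2 ^ (2 * r - 1) - 1"
    using sum_choose_even[OF assms] s[of "\<lambda>j. real ((2 * r) choose (2 * j))"] by simp
  have 2: "(\<Sum>a<r. (- 1) ^ a * real ((2 * r) choose (2 * a + 2))) = 1 - alt_choose r"
    using s[of "\<lambda>j. (- 1) ^ j * real ((2 * r) choose (2 * j))"] by (simp add: alt_choose_def sum_negf)
  have "(2::real) ^ (2 * r) = 2 * 2 ^ (2 * r - 1)"
    using assms by (metis Suc_pred' mult_pos_pos pos2 power_Suc)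
  then have 3: "(4::real) ^ r = 2 * 2 ^ (2 * r - 1)" by (simp add: power_mult)
  have "(\<Sum>a<r. (2 + 2 * (- 1) ^ a) * real ((2 * r) choose (2 * a + 2))) =
     2 * (\<Sum>a<r. real ((2 * r) choose (2 * a + 2))) + 2 * (\<Sum>a<r. (- 1) ^ a * real ((2 * r) choose (2 * a + 2)))"
    by (simp add: sum_distrib_left sum.distrib[symmetric] algebra_simps)
  then show ?thesis unfolding 1 2 3 by simp
qed

text \<open>The pairs that feed the r-th zeta value once the sum over r is moved outside.\<close>

definition strip :: "nat \<Rightarrow> nat \<Rightarrow> (nat \<times> nat) set" where
  "strip N r = {(a, b). a + b < N \<and> r \<le> a + b + 1}"

lemma finite_strip [simp]: "finite (strip N r)"
  by (rule finite_subset[of _ "{..<N} \<times> {..<N}"]) (auto simp: strip_def)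

lemma sum_strip_swap:
  fixes f :: "nat \<Rightarrow> nat \<Rightarrow> nat \<Rightarrow> real"
  shows "(\<Sum>a<N. \<Sum>b<N - a. \<Sum>r=1..a + b + 1. f r a b) = (\<Sum>r=1..N. \<Sum>(a,b)\<in>strip N r. f r a b)"
proof -
  have "(\<Sum>a<N. \<Sum>b<N - a. \<Sum>r=1..a + b + 1. f r a b) = (\<Sum>p\<in>(SIGMA a:{..<N}. {..<N - a}). \<Sum>r=1..fst p + snd p + 1. f r (fst p) (snd p))"
    by (simp add: sum.Sigma case_prod_beta)
  also have "\<dots> = (\<Sum>q\<in>(SIGMA p:(SIGMA a:{..<N}. {..<N - a}). {1..fst p + snd p + 1}). f (snd q) (fst (fst q)) (snd (fst q)))"
    by (subst sum.Sigma) (auto simp: case_prod_beta)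
  also have "\<dots> = (\<Sum>q\<in>(SIGMA r:{1..N}. strip N r). f (fst q) (fst (snd q)) (snd (snd q)))"
    by (rule sum.reindex_bij_witness[of _ "\<lambda>(r,p). (p,r)" "\<lambda>(p,r). (r,p)"]) (auto simp: strip_def)
  also have "\<dots> = (\<Sum>r=1..N. \<Sum>(a,b)\<in>strip N r. f r a b)"
    by (subst sum.Sigma) (auto simp: case_prod_beta)
  finally show ?thesis .
qed

text \<open>With l = a + b + 1 - r the pairs with a < r become the rectangle a < r, l \<le> N - r,
  over which the sum factors; for a \<ge> r the summand is 0.\<close>

lemma sum_strip_fst:
  fixes u g :: "nat \<Rightarrow> real"
  assumes "\<And>a. a \<ge> r \<Longrightarrow> u a = 0" "r \<le> N"
  shows "(\<Sum>(a,b)\<in>strip N r. u a * g (a + b + 1 - r)) = (\<Sum>a<r. u a) * (\<Sum>l\<le>N - r. g l)"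
proof -
  have "(\<Sum>(a,b)\<in>strip N r. u a * g (a + b + 1 - r)) = (\<Sum>(a,b)\<in>{(a,b)\<in>strip N r. a < r}. u a * g (a + b + 1 - r))"
    by (rule sum.mono_neutral_right) (auto, metis assms(1) not_le)
  also have "\<dots> = (\<Sum>(a,l)\<in>{..<r} \<times> {..N - r}. u a * g l)"
    by (rule sum.reindex_bij_witness[of _ "\<lambda>(a,l). (a, l + r - 1 - a)" "\<lambda>(a,b). (a, a + b + 1 - r)"])
      (use assms(2) in \<open>auto simp: strip_def\<close>)
  also have "\<dots> = (\<Sum>a<r. u a) * (\<Sum>l\<le>N - r. g l)"
    by (simp add: sum_product sum.cartesian_product)
  finally show ?thesis .
qed

lemma sum_strip_snd:
  fixes u g :: "nat \<Rightarrow> real"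
  assumes "\<And>a. a \<ge> r \<Longrightarrow> u a = 0" "r \<le> N"
  shows "(\<Sum>(a,b)\<in>strip N r. u b * g (a + b + 1 - r)) = (\<Sum>a<r. u a) * (\<Sum>l\<le>N - r. g l)"
proof -
  have "(\<Sum>(a,b)\<in>strip N r. u b * g (a + b + 1 - r)) = (\<Sum>(a,b)\<in>strip N r. u a * g (a + b + 1 - r))"
    by (rule sum.reindex_bij_witness[of _ "\<lambda>(a,b). (b,a)" "\<lambda>(a,b). (b,a)"]) (auto simp: strip_def add.commute)
  then show ?thesis using sum_strip_fst[of r u N g] assms by simp
qed

text \<open>The part with the binomial in a factors over a rectangle. In the part with the binomial
  in b, the sign (-1)^a is rewritten through b and l = a + b + 1 - r; the signed sum factors, and
  since N is even one factor vanishes by antisymmetry for either parity of r. What remains is 4^r -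
  2 \<open>alt_choose r\<close> - (4^r - 1).\<close>

lemma strip_weighted_sum:
  assumes "even N" "1 \<le> r" "r \<le> N"
  shows "(\<Sum>(a,b)\<in>strip N r. (2 + 2 * (- 1) ^ a) * (real (2 * r choose (2 * a + 2)) - (1 - 1 / 4 ^ r) * real (2 * r choose (2 * b + 1)))
      * odd_fact_prod (N - r) (a + b + 1 - r)) = (1 - 2 * alt_choose r) * (2 ^ (2 * (N - r) + 1) / fact (2 * (N - r) + 2))"
proof -
  let ?g = "odd_fact_prod (N - r)"
  let ?B = "\<lambda>b. real (2 * r choose (2 * b + 1))"
  obtain m where m: "r = Suc m" using assms(2) by (cases r) auto
  have A: "(\<Sum>(a,b)\<in>strip N r. (2 + 2 * (- 1) ^ a) * real (2 * r choose (2 * a + 2)) * ?g (a + b + 1 - r)) =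
     (4 ^ r - 2 * alt_choose r) * (\<Sum>l\<le>N - r. ?g l)"
    using sum_strip_fst[of r "\<lambda>a. (2 + 2 * (- 1) ^ a) * real (2 * r choose (2 * a + 2))" N ?g] assms sum_weight_even[of r]
    by simp
  have B1: "(\<Sum>(a,b)\<in>strip N r. ?B b * ?g (a + b + 1 - r)) = 2 ^ (2 * m + 1) * (\<Sum>l\<le>N - r. ?g l)"
  proof -
    have "?B b = 0" if "b \<ge> r" for b using that by (simp add: binomial_eq_0)
    from sum_strip_snd[where u = ?B and g = ?g, OF this assms(3)]
    have "(\<Sum>(a,b)\<in>strip N r. ?B b * ?g (a + b + 1 - r)) = (\<Sum>b<r. ?B b) * (\<Sum>l\<le>N - r. ?g l)" by simp
    also have "(\<Sum>b<r. ?B b) = 2 ^ (2 * m + 1)"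
      using sum_choose_odd[of m] by (simp add: m lessThan_Suc_atMost del: binomial_Suc_Suc power_Suc)
    finally show ?thesis .
  qed
  have B2: "(\<Sum>(a,b)\<in>strip N r. ((- 1) ^ b * ?B b) * ((- 1) ^ (a + b + 1 - r) * ?g (a + b + 1 - r))) = 0"
  proof -
    have "(\<Sum>(a,b)\<in>strip N r. ((- 1) ^ b * ?B b) * ((- 1) ^ (a + b + 1 - r) * ?g (a + b + 1 - r))) =
       (\<Sum>b<r. (- 1) ^ b * ?B b) * (\<Sum>l\<le>N - r. (- 1) ^ l * ?g l)"
      by (rule sum_strip_snd) (use assms(3) in auto)
    also have "\<dots> = 0"
    proof (cases "odd m")
      case True
      then show ?thesis using alternating_choose_odd[of m] by (simp add: m lessThan_Suc_atMost)
    next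
      case False
      then have "odd (N - r)" using assms(1,3) m by auto
      then show ?thesis using alternating_odd_fact_prod by simp
    qed
    finally show ?thesis .
  qed
  \<comment> \<open>With m = r - 1 and l = a + b + 1 - r one has m + b + l = 2b + a.\<close>
  have sign: "(- 1 :: real) ^ a = (- 1) ^ m * ((- 1) ^ b * (- 1) ^ (a + b + 1 - r))" if "(a, b) \<in> strip N r" for a b
  proof -
    have "m + (b + (a + b + 1 - r)) = 2 * b + a" using that m by (auto simp: strip_def)
    then have "(- 1 :: real) ^ (m + (b + (a + b + 1 - r))) = (- 1) ^ (2 * b + a)" by (rule arg_cong)
    then show ?thesis by (simp add: power_add power_mult)
  qed
  have "(\<Sum>(a,b)\<in>strip N r. (2 + 2 * (- 1) ^ a) * ?B b * ?g (a + b + 1 - r)) =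
     (\<Sum>(a,b)\<in>strip N r. 2 * (?B b * ?g (a + b + 1 - r)) + 2 * (- 1) ^ m * (((- 1) ^ b * ?B b) * ((- 1) ^ (a + b + 1 - r) * ?g (a + b + 1 - r))))"
    by (intro sum.cong refl) (auto simp: sign algebra_simps)
  also have "\<dots> = 2 * (\<Sum>(a,b)\<in>strip N r. ?B b * ?g (a + b + 1 - r)) +
     2 * (- 1) ^ m * (\<Sum>(a,b)\<in>strip N r. ((- 1) ^ b * ?B b) * ((- 1) ^ (a + b + 1 - r) * ?g (a + b + 1 - r)))"
    by (simp add: case_prod_beta sum.distrib sum_distrib_left)
  also have "\<dots> = 4 ^ r * (\<Sum>l\<le>N - r. ?g l)"
    unfolding B1 B2 by (simp add: m power_mult)
  finally have B: "(\<Sum>(a,b)\<in>strip N r. (2 + 2 * (- 1) ^ a) * ?B b * ?g (a + b + 1 - r)) = 4 ^ r * (\<Sum>l\<le>N - r. ?g l)" .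
  have "(\<Sum>(a,b)\<in>strip N r. (2 + 2 * (- 1) ^ a) * (real (2 * r choose (2 * a + 2)) - (1 - 1 / 4 ^ r) * ?B b) * ?g (a + b + 1 - r)) =
     (\<Sum>(a,b)\<in>strip N r. (2 + 2 * (- 1) ^ a) * real (2 * r choose (2 * a + 2)) * ?g (a + b + 1 - r)) -
     (1 - 1 / 4 ^ r) * (\<Sum>(a,b)\<in>strip N r. (2 + 2 * (- 1) ^ a) * ?B b * ?g (a + b + 1 - r))"
    unfolding sum_distrib_left case_prod_beta sum_subtractf[symmetric]
    by (intro sum.cong refl) (simp only: left_diff_distrib right_diff_distrib mult_ac)
  also have "\<dots> = (1 - 2 * alt_choose r) * (\<Sum>l\<le>N - r. ?g l)"
    unfolding A B by (simp add: algebra_simps)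
  finally show ?thesis unfolding sum_odd_fact_prod .
qed

section \<open>The two coefficients at {1,3} repeated\<close>

lemma zig_eq_word: "zig m = word (replicate m 2)"
  by (induction m) (simp_all add: zig_Suc word_Cons)

lemma word_append: "word (k @ l) = word k @ word l"
  by (simp add: word_def)

lemma shuffle_zeta_zig: "shuffle_zeta (zig m) = pi ^ (2 * m) / fact (2 * m + 1)"
  unfolding zig_eq_word shuffle_zeta_admissible[OF admissible_twos] by (rule mzv_twos)

lemma shuffle_zeta_zig_X_zig:
  "shuffle_zeta (zig (Suc a) @ X # zig b) = mzv (replicate a 2 @ [3] @ replicate b 2)"
proof -
  have "zig (Suc a) @ X # zig b = zig a @ [Y, X, X] @ zig b" by (simp add: zig_Suc2)
  also have "\<dots> = word (replicate a 2 @ [3] @ replicate b 2)"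
    by (simp add: word_append zig_eq_word word_Cons numeral_2_eq_2)
  finally have "zig (Suc a) @ X # zig b = word (replicate a 2 @ [3] @ replicate b 2)" .
  moreover have "admissible (replicate a 2 @ [3] @ replicate b 2)"
    by (cases "b = 0") (auto simp: admissible_def is_index_def last_append)
  ultimately show ?thesis by (simp only: shuffle_zeta_admissible)
qed

text \<open>Zagier's formula is inserted and the sum over r moved outside, so that
  \<open>strip_weighted_sum\<close> applies. A factor pi is added to match the exponent with the
  factorial, whence 2 / pi^2 instead of 2 / pi.\<close>

lemma twos_three_twos_sum:
  assumes "even N"
  shows "(\<Sum>a<N. \<Sum>b<N - a. (2 + 2 * (- 1) ^ a) * (shuffle_zeta (zig (Suc a) @ X # zig b) * shuffle_zeta (zig (N - 1 - a - b)))) =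
     2 / pi ^ 2 * (\<Sum>r=1..N. (- 1) ^ r * (1 - 2 * alt_choose r) * (2 ^ (2 * (N - r) + 1) / fact (2 * (N - r) + 2))
        * pi ^ (2 * (N - r) + 2) * zeta_val (2 * r + 1))"
proof -
  define c where "c r a b = (2 + 2 * (- 1) ^ a) * (real (2 * r choose (2 * a + 2)) - (1 - 1 / 4 ^ r) * real (2 * r choose (2 * b + 1)))" for r a b :: nat
  define t where "t r = (- 1) ^ r * pi ^ (2 * (N - r) + 2) * zeta_val (2 * r + 1)" for r
  have 1: "(2 + 2 * (- 1) ^ a) * (shuffle_zeta (zig (Suc a) @ X # zig b) * shuffle_zeta (zig (N - 1 - a - b))) =
    (\<Sum>r=1..a + b + 1. 2 / pi ^ 2 * (t r * (c r a b * odd_fact_prod (N - r) (a + b + 1 - r))))"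
    if "a + b < N" for a b
  proof -
    let ?Z = "pi ^ (2 * (N - 1 - a - b)) / fact (2 * (N - 1 - a - b) + 1)"
    have "(2 + 2 * (- 1) ^ a) * (shuffle_zeta (zig (Suc a) @ X # zig b) * shuffle_zeta (zig (N - 1 - a - b))) =
      (\<Sum>r=1..a + b + 1. (2 + 2 * (- 1) ^ a) * (2 / pi * ((- 1) ^ r * (real (2 * r choose (2 * a + 2)) - (1 - 1 / 4 ^ r) * real (2 * r choose (2 * b + 1)))
        * (pi ^ (2 * (a + b + 1 - r) + 1) / fact (2 * (a + b + 1 - r) + 1)) * zeta_val (2 * r + 1)) * ?Z))"
      unfolding shuffle_zeta_zig_X_zig zagier_twos_three_twos shuffle_zeta_zig sum_distrib_left sum_distrib_right ..
    also have "\<dots> = (\<Sum>r=1..a + b + 1. 2 / pi ^ 2 * (t r * (c r a b * odd_fact_prod (N - r) (a + b + 1 - r))))"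
    proof (rule sum.cong)
      fix r assume r: "r \<in> {1..a + b + 1}"
      let ?l = "a + b + 1 - r"
      have i: "N - 1 - a - b = N - r - ?l" using r that by auto
      have e: "2 * (N - r) + 2 = 2 * ?l + 1 + (2 * (N - r - ?l) + 1)" using r that by auto
      have p: "pi ^ (2 * (N - r) + 2) = pi ^ (2 * ?l + 1) * (pi ^ (2 * (N - r - ?l)) * pi)"
        unfolding e power_add by simp
      have g: "w * (2 / pi * (s * d * (P / F) * z) * (Q / G)) = 2 / pi ^ 2 * (s * (P * (Q * pi)) * z * (w * d * (1 / (F * G))))"
        for w s d P F z Q G :: real
        by (simp add: power2_eq_square mult_ac)
      show "(2 + 2 * (- 1) ^ a) * (2 / pi * ((- 1) ^ r * (real (2 * r choose (2 * a + 2)) - (1 - 1 / 4 ^ r) * real (2 * r choose (2 * b + 1)))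
        * (pi ^ (2 * (a + b + 1 - r) + 1) / fact (2 * (a + b + 1 - r) + 1)) * zeta_val (2 * r + 1)) * ?Z) =
        2 / pi ^ 2 * (t r * (c r a b * odd_fact_prod (N - r) (a + b + 1 - r)))"
        unfolding t_def c_def odd_fact_prod_def p i by (rule g)
    qed simp
    finally show ?thesis .
  qed
  have "(\<Sum>a<N. \<Sum>b<N - a. (2 + 2 * (- 1) ^ a) * (shuffle_zeta (zig (Suc a) @ X # zig b) * shuffle_zeta (zig (N - 1 - a - b)))) =
     (\<Sum>a<N. \<Sum>b<N - a. \<Sum>r=1..a + b + 1. 2 / pi ^ 2 * (t r * (c r a b * odd_fact_prod (N - r) (a + b + 1 - r))))"
    by (intro sum.cong refl 1) auto
  also have "\<dots> = (\<Sum>r=1..N. \<Sum>(a,b)\<in>strip N r. 2 / pi ^ 2 * (t r * (c r a b * odd_fact_prod (N - r) (a + b + 1 - r))))"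
    by (rule sum_strip_swap)
  also have "\<dots> = (\<Sum>r=1..N. 2 / pi ^ 2 * (t r * (\<Sum>(a,b)\<in>strip N r. c r a b * odd_fact_prod (N - r) (a + b + 1 - r))))"
    by (simp only: sum_distrib_left case_prod_beta')
  also have "\<dots> = (\<Sum>r=1..N. 2 / pi ^ 2 * (t r * ((1 - 2 * alt_choose r) * (2 ^ (2 * (N - r) + 1) / fact (2 * (N - r) + 2)))))"
    unfolding c_def by (rule sum.cong) (simp_all only: atLeastAtMost_iff strip_weighted_sum[OF assms])
  also have "\<dots> = 2 / pi ^ 2 * (\<Sum>r=1..N. (- 1) ^ r * (1 - 2 * alt_choose r) * (2 ^ (2 * (N - r) + 1) / fact (2 * (N - r) + 2))
        * pi ^ (2 * (N - r) + 2) * zeta_val (2 * r + 1))"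
    unfolding sum_distrib_left t_def by (intro sum.cong refl) (simp only: mult_ac)
  finally show ?thesis .
qed

definition one_three :: "nat \<Rightarrow> nat list" where
  "one_three n = concat (replicate n [1, 3])"

text \<open>yyxx repeated and closed by y is yxxy repeated and opened by y, the word left over by
  \<open>altsum_zig\<close>.\<close>

lemma word_one_three: "word (one_three n) @ [Y] = Y # concat (replicate n [Y, X, X, Y])"
proof (induction n)
  case (Suc n)
  have "word (one_three (Suc n)) @ [Y] = [Y, Y, X, X] @ (word (one_three n) @ [Y])"
    by (simp add: one_three_def word_Cons numeral_2_eq_2)
  also have "\<dots> = Y # concat (replicate (Suc n) [Y, X, X, Y])" unfolding Suc by simp
  finally show ?case .
qed (simp add: one_three_def)

lemma is_index_one_three: "is_index (one_three n)"
  by (induction n) (simp_all add: one_three_def)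

lemma no_adjacent_ones_one_three: "no_adjacent_ones (one_three n)"
proof -
  have "no_adjacent_ones (1 # 3 # k)" if "no_adjacent_ones k" for k
    using that by (auto simp: no_adjacent_ones_def nth_Cons split: nat.splits)
  moreover have "no_adjacent_ones []" by (simp add: no_adjacent_ones_def)
  ultimately show ?thesis by (induction n) (simp_all add: one_three_def)
qed

lemma power_neg4_cancel: "(- 4) ^ n * x = y \<Longrightarrow> x = y / (- 4 :: real) ^ n"
  by (simp add: field_simps)

text \<open>The sum of binomials contributes 16^n = (-4)^n (-4)^n, one factor of which cancels the
  constant of \<open>altsum_zig\<close>.\<close>

lemma zeta_S_hat_one_three_0:
  "fps_nth (zeta_S_hat b (one_three n)) 0 = 2 * (- 4) ^ n / fact (4 * n + 2) * pi ^ (4 * n)"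
proof -
  let ?c = "fps_nth (zeta_S_hat b (one_three n)) 0"
  have "(- 4) ^ n * ?c = altsum [] [Y] (2 * n) (lie_of Y shuffle_zeta)"
    unfolding zeta_S_hat_coeffs(1)[OF is_index_one_three no_adjacent_ones_one_three] altsum_zig word_one_three ..
  also have "\<dots> = (\<Sum>i\<le>2 * n. shuffle_zeta (zig i) * shuffle_zeta (zig (2 * n - i)))"
    unfolding altsum_lie_of[OF is_char_shuffle_zeta] by simp
  also have "\<dots> = (\<Sum>i\<le>2 * n. pi ^ (4 * n) * odd_fact_prod (2 * n) i)"
  proof (rule sum.cong)
    fix i assume "i \<in> {..2 * n}"
    then have "4 * n = 2 * i + 2 * (2 * n - i)" by auto
    then have "pi ^ (4 * n) = pi ^ (2 * i) * pi ^ (2 * (2 * n - i))" by (metis power_add)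
    then show "shuffle_zeta (zig i) * shuffle_zeta (zig (2 * n - i)) = pi ^ (4 * n) * odd_fact_prod (2 * n) i"
      by (simp add: shuffle_zeta_zig odd_fact_prod_def)
  qed simp
  also have "\<dots> = pi ^ (4 * n) * (2 * 16 ^ n / fact (4 * n + 2))"
    unfolding sum_distrib_left[symmetric] sum_odd_fact_prod by (simp add: power_mult power_add)
  finally have "?c = pi ^ (4 * n) * (2 * 16 ^ n / fact (4 * n + 2)) / (- 4) ^ n"
    by (rule power_neg4_cancel)
  also have "(16::real) ^ n = (- 4) ^ n * (- 4) ^ n" by (simp flip: power_mult_distrib)
  finally show ?thesis by (simp add: mult.commute)
qed

lemma zeta_S_hat_one_three_1_aux:
  "fps_nth (zeta_S_hat b (one_three n)) 1 =
     2 / pi ^ 2 * (\<Sum>r=1..2 * n. (- 1) ^ r * (1 - 2 * alt_choose r) * (2 ^ (2 * (2 * n - r) + 1) / fact (2 * (2 * n - r) + 2))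
        * pi ^ (2 * (2 * n - r) + 2) * zeta_val (2 * r + 1)) / (- 4) ^ n"
proof (rule power_neg4_cancel)
  have w: "word (one_three n) @ [Y, X] = (Y # concat (replicate n [Y, X, X, Y])) @ [X]"
    unfolding word_one_three[symmetric] by simp
  show "(- 4) ^ n * fps_nth (zeta_S_hat b (one_three n)) 1 =
     2 / pi ^ 2 * (\<Sum>r=1..2 * n. (- 1) ^ r * (1 - 2 * alt_choose r) * (2 ^ (2 * (2 * n - r) + 1) / fact (2 * (2 * n - r) + 2))
        * pi ^ (2 * (2 * n - r) + 2) * zeta_val (2 * r + 1))"
    using altsum_zig[of n "\<lambda>w. lie_of Y shuffle_zeta (w @ [X])"] altsum_lie_of_X[OF is_char_shuffle_zeta shuffle_zeta_X, of n]
      twos_three_twos_sum[of "2 * n"]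
    unfolding zeta_S_hat_coeffs(2)[OF is_index_one_three no_adjacent_ones_one_three] w by simp
qed

lemma sum_parity_split:
  fixes f :: "nat \<Rightarrow> real"
  shows "(\<Sum>r=1..2 * n. f r) = (\<Sum>m=1..n. f (2 * m)) + (\<Sum>r\<in>{r\<in>{1..2 * n}. odd r}. f r)"
proof -
  have "{1..2 * n} = (\<lambda>m. 2 * m) ` {1..n} \<union> {r\<in>{1..2 * n}. odd r}"
    by (auto elim!: evenE)
  then have "(\<Sum>r=1..2 * n. f r) = (\<Sum>r\<in>(\<lambda>m. 2 * m) ` {1..n} \<union> {r\<in>{1..2 * n}. odd r}. f r)" by (rule arg_cong)
  also have "\<dots> = (\<Sum>r\<in>(\<lambda>m. 2 * m) ` {1..n}. f r) + (\<Sum>r\<in>{r\<in>{1..2 * n}. odd r}. f r)"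
    by (rule sum.union_disjoint) auto
  also have "(\<Sum>r\<in>(\<lambda>m. 2 * m) ` {1..n}. f r) = (\<Sum>m=1..n. f (2 * m))"
    by (subst sum.reindex) (auto simp: inj_on_def)
  finally show ?thesis .
qed

text \<open>The parity of r separates the two sums: \<open>alt_choose r\<close> is (-4)^m for r =
  2m, which gives \<zeta>(4m+1), and 0 for odd r, which gives \<zeta>(2r+1).\<close>

lemma zeta_S_hat_one_three_1:
  "fps_nth (zeta_S_hat b (one_three n)) 1 =
     (\<Sum>(n0, n1) | n0 + n1 = n.
               (- 4) ^ (n0 + 1) * (2 - (- 4) powi (- int n1)) / fact (4 * n0 + 2)
                 * pi ^ (4 * n0) * zeta_val (4 * n1 + 1))
            - (- 1) ^ n *
              (\<Sum>(n0, n1) | n0 + n1 = 2 * n \<and> odd n0 \<and> odd n1.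
               2 powi (int n0 - int n1 + 2) / fact (2 * n0 + 2)
                 * pi ^ (2 * n0) * zeta_val (2 * n1 + 1))"
proof -
  define f where "f r = 2 / pi ^ 2 * ((- 1) ^ r * (1 - 2 * alt_choose r) * (2 ^ (2 * (2 * n - r) + 1) / fact (2 * (2 * n - r) + 2))
        * pi ^ (2 * (2 * n - r) + 2) * zeta_val (2 * r + 1)) / (- 4) ^ n" for r
  define g where "g n0 n1 = (- 4) ^ (n0 + 1) * (2 - (- 4) powi (- int n1)) / fact (4 * n0 + 2) * pi ^ (4 * n0) * zeta_val (4 * n1 + 1)" for n0 n1
  define h where "h n0 n1 = 2 powi (int n0 - int n1 + 2) / fact (2 * n0 + 2) * pi ^ (2 * n0) * zeta_val (2 * n1 + 1)" for n0 n1
  have fr: "f r = 4 * 4 ^ (2 * n - r) * pi ^ (2 * (2 * n - r)) / fact (2 * (2 * n - r) + 2) * zeta_val (2 * r + 1) * ((- 1) ^ r * (1 - 2 * alt_choose r)) / (- 4) ^ n" for r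
    unfolding f_def by (simp add: power_add power_mult power2_eq_square)
  have even: "f (2 * m) = g (n - m) m" if "m \<in> {1..n}" for m
  proof -
    obtain k where k: "n = k + m" using \<open>m \<in> {1..n}\<close> by (metis atLeastAtMost_iff le_add_diff_inverse2)
    have e: "2 * n - 2 * m = 2 * k" "n - m = k" by (simp_all add: k)
    have p: "(4::real) ^ (2 * k) = (- 4) ^ k * (- 4) ^ k"
      by (simp add: power_mult flip: power_mult_distrib)
    have q: "(- 4 :: real) powi (- int m) = 1 / (- 4) ^ m"
      by (simp add: power_int_minus divide_inverse)
    have nz: "(- 4 :: real) ^ k \<noteq> 0" "(- 4 :: real) ^ m \<noteq> 0" by simp_all
    have "f (2 * m) = 4 * ((- 4) ^ k * (- 4) ^ k) * pi ^ (4 * k) / fact (4 * k + 2) * zeta_val (4 * m + 1) * (1 - 2 * (- 4) ^ m) / ((- 4) ^ k * (- 4) ^ m)"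
      unfolding fr e alt_choose_even p by (simp add: k power_add)
    also have "\<dots> = (- 4) ^ (k + 1) * (2 - 1 / (- 4) ^ m) / fact (4 * k + 2) * pi ^ (4 * k) * zeta_val (4 * m + 1)"
    proof -
      have "4 * (A * A) * P / F * z * (1 - 2 * B) / (A * B) = (A * - 4) * (2 - 1 / B) / F * P * z"
        if "A \<noteq> 0" "B \<noteq> 0" "F \<noteq> 0" for A B P F z :: real
        using that by (simp add: field_simps)
      from this[OF nz, of "fact (4 * k + 2)" "pi ^ (4 * k)" "zeta_val (4 * m + 1)"] show ?thesis
        by (simp only: power_add power_one_right fact_nonzero not_False_eq_True)
    qed
    finally show ?thesis unfolding g_def e q .
  qed
  have odd: "f r = - ((- 1) ^ n) * h (2 * n - r) r" if "r \<in> {r\<in>{1..2 * n}. odd r}" for r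
  proof -
    define k where "k = 2 * n - r"
    have r: "odd r" "r + k = 2 * n" using that by (auto simp: k_def)
    have p: "2 powi (int k - int r + 2) = 4 * 4 ^ k / (4::real) ^ n"
    proof -
      have "int k - int r + 2 = int (2 * k + 2) - int (2 * n)" using r(2) by linarith
      then have "2 powi (int k - int r + 2) = (2::real) powi (int (2 * k + 2)) / 2 powi (int (2 * n))"
        by (metis power_int_diff zero_neq_numeral)
      also have "\<dots> = 2 ^ (2 * k + 2) / 2 ^ (2 * n)" by (simp only: power_int_of_nat)
      finally show ?thesis by (simp add: power_add power_mult)
    qed
    have m: "(- 4 :: real) ^ n = (- 1) ^ n * 4 ^ n" by (simp flip: power_mult_distrib)
    have s: "(- 1 :: real) ^ n * (- 1) ^ n = 1" by (simp flip: power_mult_distrib)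
    have "f r = - (4 * 4 ^ k * pi ^ (2 * k) / fact (2 * k + 2) * zeta_val (2 * r + 1)) / ((- 1) ^ n * 4 ^ n)"
      unfolding fr k_def[symmetric] m using r(1) by (simp add: alt_choose_odd)
    also have "\<dots> = - ((- 1) ^ n) * (4 * 4 ^ k / 4 ^ n / fact (2 * k + 2) * pi ^ (2 * k) * zeta_val (2 * r + 1))"
      by (cases "even n") simp_all
    finally show ?thesis unfolding h_def k_def[symmetric] p .
  qed
  have "fps_nth (zeta_S_hat b (one_three n)) 1 = (\<Sum>r=1..2 * n. f r)"
    unfolding zeta_S_hat_one_three_1_aux f_def sum_divide_distrib sum_distrib_left ..
  also have "\<dots> = (\<Sum>m=1..n. g (n - m) m) + (\<Sum>r\<in>{r\<in>{1..2 * n}. odd r}. - ((- 1) ^ n) * h (2 * n - r) r)"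
    unfolding sum_parity_split by (intro arg_cong2[where f = "(+)"] sum.cong refl even odd)
  \<comment> \<open>The term m = 0 can be added because \<open>zeta_val 1 = 0\<close>.\<close>
  also have "(\<Sum>m=1..n. g (n - m) m) = (\<Sum>m\<le>n. g (n - m) m)"
    by (rule sum.mono_neutral_left) (auto simp: g_def zeta_val_def not_less_eq_eq)
  also have "\<dots> = (\<Sum>(n0, n1) | n0 + n1 = n. g n0 n1)"
    by (rule sum.reindex_bij_witness[of _ "\<lambda>(n0, n1). n1" "\<lambda>m. (n - m, m)"]) auto
  also have "(\<Sum>r\<in>{r\<in>{1..2 * n}. odd r}. - ((- 1) ^ n) * h (2 * n - r) r) = - ((- 1) ^ n) * (\<Sum>r\<in>{r\<in>{1..2 * n}. odd r}. h (2 * n - r) r)"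
    by (simp only: sum_distrib_left)
  also have "(\<Sum>r\<in>{r\<in>{1..2 * n}. odd r}. h (2 * n - r) r) = (\<Sum>(n0, n1) | n0 + n1 = 2 * n \<and> odd n0 \<and> odd n1. h n0 n1)"
    by (rule sum.reindex_bij_witness[of _ "\<lambda>(n0, n1). n1" "\<lambda>m. (2 * n - m, m)"]) (auto elim: oddE)
  finally show ?thesis unfolding g_def h_def by simp
qed

section \<open>Passage to the quotient ring\<close>

lemma trunc_class_eq: "trunc_class m f = {q * fps_X ^ m + f | q. \<forall>j. fps_nth q j \<in> mzv_space}"
proof -
  have *: "mult mzv_fps_ring = (*)" "add mzv_fps_ring = (+)" "carrier mzv_fps_ring = {f. \<forall>j. fps_nth f j \<in> mzv_space}"
    by (simp_all add: mzv_fps_ring_def)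
  show ?thesis
    unfolding trunc_class_def t_ideal_def a_r_coset_def r_coset_def cgenideal_def monoid_record_simps *
    by blast
qed

text \<open>The difference is \<open>fps_X ^ 2\<close> times its shift by two, whose coefficients
  again lie in \<open>mzv_space\<close>, so it belongs to the ideal.\<close>

lemma trunc_class_2_eqI:
  assumes "\<And>m. fps_nth f m \<in> mzv_space" "\<And>m. fps_nth g m \<in> mzv_space"
    and "fps_nth f 0 = fps_nth g 0" "fps_nth f 1 = fps_nth g 1"
  shows "trunc_class 2 f = trunc_class 2 g"
proof -
  have sub: "trunc_class 2 f \<subseteq> trunc_class 2 g"
    if f: "\<And>m. fps_nth f m \<in> mzv_space" and g: "\<And>m. fps_nth g m \<in> mzv_space"
      and e: "fps_nth f 0 = fps_nth g 0" "fps_nth f 1 = fps_nth g 1" for f g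
  proof
    fix x assume "x \<in> trunc_class 2 f"
    then obtain q where q: "\<And>m. fps_nth q m \<in> mzv_space" "x = q * fps_X ^ 2 + f"
      by (auto simp: trunc_class_eq)
    define d where "d = fps_shift 2 (f - g)"
    have d: "f - g = d * fps_X ^ 2"
    proof (rule fps_ext)
      fix m :: nat
      consider "m = 0" | "m = 1" | k where "m = k + 2"
        by (metis One_nat_def add_2_eq_Suc' not0_implies_Suc)
      then show "fps_nth (f - g) m = fps_nth (d * fps_X ^ 2) m"
        by cases (simp_all add: e[unfolded One_nat_def] d_def fps_X_power_mult_right_nth)
    qed
    have "x = (q + d) * fps_X ^ 2 + g" using q(2) d by (simp add: algebra_simps)
    moreover have "fps_nth (q + d) m \<in> mzv_space" for m
      using q(1) f g by (auto simp: d_def intro!: mzv_space_add mzv_space_diff)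
    ultimately show "x \<in> trunc_class 2 g" unfolding trunc_class_eq by blast
  qed
  show ?thesis using sub[of f g] sub[of g f] assms by auto
qed

theorem theorem1p1:
  fixes b :: reg and n :: nat
  shows "zeta_S b 2 (concat (replicate n [1, 3])) \<in> carrier (mzv_trunc_ring 2) \<and>
    zeta_S b 2 (concat (replicate n [1, 3])) =
      trunc_class 2
        (fps_const (2 * (- 4) ^ n / fact (4 * n + 2) * pi ^ (4 * n)) +
         fps_const
           ((\<Sum>(n0, n1) | n0 + n1 = n.
               (- 4) ^ (n0 + 1) * (2 - (- 4) powi (- int n1)) / fact (4 * n0 + 2)
                 * pi ^ (4 * n0) * zeta_val (4 * n1 + 1))
            - (- 1) ^ n *
              (\<Sum>(n0, n1) | n0 + n1 = 2 * n \<and> odd n0 \<and> odd n1.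
               2 powi (int n0 - int n1 + 2) / fact (2 * n0 + 2)
                 * pi ^ (2 * n0) * zeta_val (2 * n1 + 1)))
         * fps_X)"
proof
  show "zeta_S b 2 (concat (replicate n [1, 3])) \<in> carrier (mzv_trunc_ring 2)"
  proof -
    have "zeta_S_hat b (concat (replicate n [1, 3])) \<in> carrier mzv_fps_ring"
      using zeta_S_hat_in_space by (simp add: mzv_fps_ring_def)
    then show ?thesis
      unfolding zeta_S_def trunc_class_def mzv_trunc_ring_def FactRing_def A_RCOSETS_def RCOSETS_def a_r_coset_def
        partial_object.simps monoid_record_simps by blast
  qed
next
  let ?f = "zeta_S_hat b (concat (replicate n [1, 3]))"
  \<comment> \<open>The right-hand side lies in the ring because both of its coefficients are
    coefficients of \<open>zeta_S_hat\<close>; the explicit values are inserted only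
    afterwards.\<close>
  have "fps_nth (fps_const (fps_nth ?f 0) + fps_const (fps_nth ?f 1) * fps_X) m \<in> mzv_space" for m
    using zeta_S_hat_in_space by (cases m) (auto simp: fps_X_def)
  then have "zeta_S b 2 (concat (replicate n [1, 3])) = trunc_class 2 (fps_const (fps_nth ?f 0) + fps_const (fps_nth ?f 1) * fps_X)"
    unfolding zeta_S_def by (intro trunc_class_2_eqI zeta_S_hat_in_space) (simp_all add: fps_X_def)
  then show "zeta_S b 2 (concat (replicate n [1, 3])) =
      trunc_class 2
        (fps_const (2 * (- 4) ^ n / fact (4 * n + 2) * pi ^ (4 * n)) +
         fps_const
           ((\<Sum>(n0, n1) | n0 + n1 = n.
               (- 4) ^ (n0 + 1) * (2 - (- 4) powi (- int n1)) / fact (4 * n0 + 2)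
                 * pi ^ (4 * n0) * zeta_val (4 * n1 + 1))
            - (- 1) ^ n *
              (\<Sum>(n0, n1) | n0 + n1 = 2 * n \<and> odd n0 \<and> odd n1.
               2 powi (int n0 - int n1 + 2) / fact (2 * n0 + 2)
                 * pi ^ (2 * n0) * zeta_val (2 * n1 + 1)))
         * fps_X)"
    unfolding zeta_S_hat_one_three_0[unfolded one_three_def] zeta_S_hat_one_three_1[unfolded one_three_def] .
qed

end
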